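(* Fix $a>0$. For each $r$ in a sequence $r\to\infty$, consider the system below operated under the GRAND($aZ$)-FF algorithm, and let $U^r(\infty)$ be the rank of the right-most occupied server in steady state. Then for every $\epsilon>0$, $$\frac{|U^r(\infty)-q^{*,a}\, r|}{r^{1/2+\epsilon}} \Longrightarrow 0 \quad (r\to\infty),$$ where $\Longrightarrow$ denotes convergence in distribution.
   Context: Model. There are $I$ customer types $i\in\mathcal I=\{1,\dots,I\}$. Type-$i$ customers arrive as a Poisson process of rate $\Lambda_i=\lambda_i r$ ($\lambda_i>0$ fixed, $r>0$ a scaling parameter). A type-$i$ service time is exponential with mean $1/\mu_i$. All arrival processes and service times are mutually independent. Set $\rho_i=\lambda_i/\mu_i$ and assume $\sum_i\rho_i=1$. There is a countably infinite set of servers with distinct ranks $\ell=1,2,3,\dots$. A configuration is a vector $\mathbf k=(k_1,\dots,k_I)$ of nonnegative integers. There is a finite set $\bar{\mathcal K}$ of allowed configurations. It is monotone: if $\mathbf k\in\bar{\mathcal K}$ and $0\le k'_i\le k_i$ for all $i$, then $\mathbf k'\in\bar{\mathcal K}$. It contains $\mathbf 0$ and every unit vector $\mathbf e_i$. Set $\mathcal K=\bar{\mathcal K}\setminus\{\mathbf 0\}$. A type-$i$ customer may be added to a server in configuration $\mathbf k$ iff $\mathbf k+\mathbf e_i\in\mathcal K$. Each arriving customer is placed immediately into some server. It stays there until its service ends (no migration); the server's configuration then changes from $\mathbf k$ to $\mathbf k-\mathbf e_i$. Service times are unaffected by other customers in the same server. A server is occupied if its configuration is not $\mathbf 0$. Notation: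 - $X^r_{\mathbf k}(t)$: number of servers in configuration $\mathbf k\in\mathcal K$ at time $t$. - $Z^r(t)=\sum_i\sum_{\mathbf k\in\mathcal K}k_iX^r_{\mathbf k}(t)$: total number of customers. - $Q^r(t)=\sum_{\mathbf k\in\mathcal K}X^r_{\mathbf k}(t)$: number of occupied servers. - $U^r(t)$: rank of the right-most (highest-ranked) occupied server. Under the algorithms considered, the system is a positive recurrent Markov chain. The suffix $(\infty)$ denotes the value in the stationary regime. GRAND($aZ$)-FF algorithm (parameter $a>0$). Set $X_{\mathbf 0}(t)=\lceil aZ(t)\rceil$, $X_{(i),\diamond}(t)=\sum_{\mathbf k\in\mathcal K:\ \mathbf k+\mathbf e_i\in\mathcal K}X_{\mathbf k}(t)$ and $X_{(i)}(t)=X_{\mathbf 0}(t)+X_{(i),\diamond}(t)$. A type-$i$ customer arriving at time $t$ is placed as follows: - with probability $X_{\mathbf 0}(t)/X_{(i)}(t)$ it goes into an empty server; - with probability $X_{(i),\diamond}(t)/X_{(i)}(t)$ it goes into one of the $X_{(i),\diamond}(t)$ occupied servers able to accept it, chosen uniformly at random; - if $X_{(i)}(t)=0$ it goes into an empty server. Whenever an empty server is to be used, the lowest-ranked empty server is taken (First-Fit). Optimization quantities. Let $\mathcal X=\{\mathbf x\in\mathbb R_+^{|\mathcal K|}:\ \sum_{\mathbf k\in\mathcal K}k_ix_{\mathbf k}=\rho_i\ \forall i\}$. Let $c_{\mathbf k}=\prod_i k_i!$. Define $\mathbf x^{*,a}$ as the unique minimizer over $\mathcal X$ of the strictly convex function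 $\sum_{\mathbf k\in\mathcal K}x_{\mathbf k}\log[x_{\mathbf k}c_{\mathbf k}/(ea)]$. For $0<a<1$ this is the same as minimizing $L^{(a)}(\mathbf x)=[-\log a]^{-1}\sum_{\mathbf k}x_{\mathbf k}\log[x_{\mathbf k}c_{\mathbf k}/(ea)]$. Set $q^{*,a}=\sum_{\mathbf k\in\mathcal K}x^{*,a}_{\mathbf k}$. *)

theory Defs
  imports "HOL-Analysis.Analysis" "HOL-Probability.Probability" "HOL-Library.Function_Algebras"
begin

(* Customer types: a finite type 'i.  Configurations: 'i \<Rightarrow> nat.
   States: s :: nat \<Rightarrow> ('i \<Rightarrow> nat), s l = configuration of the server of rank l
   (ranks are l = 1,2,3,...; index 0 is unused and must carry the zero configuration). *)

definition unitv :: "'i \<Rightarrow> ('i \<Rightarrow> nat)" where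
  "unitv i = (\<lambda>j. if j = i then 1 else 0)"

definition config_set_ok :: "('i::finite \<Rightarrow> nat) set \<Rightarrow> bool" where
  "config_set_ok Kb \<longleftrightarrow> finite Kb \<and> (0 \<in> Kb) \<and> (\<forall>i. unitv i \<in> Kb) \<and>
     (\<forall>k\<in>Kb. \<forall>k'. (\<forall>i. k' i \<le> k i) \<longrightarrow> k' \<in> Kb)"

definition Kset :: "('i \<Rightarrow> nat) set \<Rightarrow> ('i \<Rightarrow> nat) set" where
  "Kset Kb = Kb - {0}"

definition valid_state :: "('i \<Rightarrow> nat) set \<Rightarrow> (nat \<Rightarrow> 'i \<Rightarrow> nat) \<Rightarrow> bool" where
  "valid_state Kb s \<longleftrightarrow> s 0 = 0 \<and> finite {l. s l \<noteq> 0} \<and> (\<forall>l. s l \<in> Kb)"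

definition occ :: "(nat \<Rightarrow> 'i \<Rightarrow> nat) \<Rightarrow> nat set" where
  "occ s = {l. s l \<noteq> 0}"

definition Ztot :: "(nat \<Rightarrow> 'i::finite \<Rightarrow> nat) \<Rightarrow> nat" where
  "Ztot s = (\<Sum>l\<in>occ s. \<Sum>i\<in>UNIV. s l i)"

definition Urank :: "(nat \<Rightarrow> 'i \<Rightarrow> nat) \<Rightarrow> nat" where
  "Urank s = (if occ s = {} then 0 else Max (occ s))"

definition X0 :: "real \<Rightarrow> (nat \<Rightarrow> 'i::finite \<Rightarrow> nat) \<Rightarrow> nat" where
  "X0 a s = nat \<lceil>a * real (Ztot s)\<rceil>"

definition acc :: "('i \<Rightarrow> nat) set \<Rightarrow> 'i \<Rightarrow> (nat \<Rightarrow> 'i \<Rightarrow> nat) \<Rightarrow> nat set" where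
  "acc Kb i s = {l. s l \<noteq> 0 \<and> s l + unitv i \<in> Kset Kb}"

definition Xdiam :: "('i \<Rightarrow> nat) set \<Rightarrow> 'i \<Rightarrow> (nat \<Rightarrow> 'i \<Rightarrow> nat) \<Rightarrow> nat" where
  "Xdiam Kb i s = card (acc Kb i s)"

definition Xi :: "('i \<Rightarrow> nat) set \<Rightarrow> real \<Rightarrow> 'i \<Rightarrow> (nat \<Rightarrow> 'i::finite \<Rightarrow> nat) \<Rightarrow> nat" where
  "Xi Kb a i s = X0 a s + Xdiam Kb i s"

definition first_empty :: "(nat \<Rightarrow> 'i \<Rightarrow> nat) \<Rightarrow> nat" where
  "first_empty s = (LEAST l. 1 \<le> l \<and> s l = 0)"

definition add_cust :: "(nat \<Rightarrow> 'i \<Rightarrow> nat) \<Rightarrow> nat \<Rightarrow> 'i \<Rightarrow> (nat \<Rightarrow> 'i \<Rightarrow> nat)" where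
  "add_cust s l i = s(l := s l + unitv i)"

definition rem_cust :: "(nat \<Rightarrow> 'i \<Rightarrow> nat) \<Rightarrow> nat \<Rightarrow> 'i \<Rightarrow> (nat \<Rightarrow> 'i \<Rightarrow> nat)" where
  "rem_cust s l i = s(l := s l - unitv i)"

definition arr_rate ::
  "('i \<Rightarrow> nat) set \<Rightarrow> ('i \<Rightarrow> real) \<Rightarrow> real \<Rightarrow> real \<Rightarrow> (nat \<Rightarrow> 'i::finite \<Rightarrow> nat) \<Rightarrow> 'i \<Rightarrow> nat \<Rightarrow> real" where
  "arr_rate Kb lam a r s i l =
     lam i * r *
     (if Xi Kb a i s = 0 then (if l = first_empty s then 1 else 0)
      else (if l = first_empty s then real (X0 a s) / real (Xi Kb a i s) else 0)
         + (if l \<in> acc Kb i s then 1 / real (Xi Kb a i s) else 0))"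

definition rate ::
  "('i \<Rightarrow> nat) set \<Rightarrow> ('i \<Rightarrow> real) \<Rightarrow> ('i \<Rightarrow> real) \<Rightarrow> real \<Rightarrow> real
    \<Rightarrow> (nat \<Rightarrow> 'i::finite \<Rightarrow> nat) \<Rightarrow> (nat \<Rightarrow> 'i \<Rightarrow> nat) \<Rightarrow> real" where
  "rate Kb lam mu a r s s' =
     (\<Sum>i\<in>UNIV. \<Sum>l | s' = add_cust s l i. arr_rate Kb lam a r s i l)
   + (\<Sum>i\<in>UNIV. \<Sum>l | 0 < s l i \<and> s' = rem_cust s l i. mu i * real (s l i))"

definition outrate ::
  "('i \<Rightarrow> nat) set \<Rightarrow> ('i \<Rightarrow> real) \<Rightarrow> ('i \<Rightarrow> real) \<Rightarrow> real \<Rightarrow> real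
    \<Rightarrow> (nat \<Rightarrow> 'i::finite \<Rightarrow> nat) \<Rightarrow> real" where
  "outrate Kb lam mu a r s = (\<Sum>\<^sub>\<infinity>s'. rate Kb lam mu a r s s')"

definition stationary ::
  "('i \<Rightarrow> nat) set \<Rightarrow> ('i \<Rightarrow> real) \<Rightarrow> ('i \<Rightarrow> real) \<Rightarrow> real \<Rightarrow> real
    \<Rightarrow> (nat \<Rightarrow> 'i::finite \<Rightarrow> nat) pmf \<Rightarrow> bool" where
  "stationary Kb lam mu a r \<pi> \<longleftrightarrow>
     (\<forall>s. 0 < pmf \<pi> s \<longrightarrow> valid_state Kb s) \<and>
     (\<forall>s. valid_state Kb s \<longrightarrow>
        ((\<lambda>s'. pmf \<pi> s' * rate Kb lam mu a r s' s) has_sum (pmf \<pi> s * outrate Kb lam mu a r s)) UNIV)"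

definition ccoef :: "('i::finite \<Rightarrow> nat) \<Rightarrow> real" where
  "ccoef k = (\<Prod>i\<in>UNIV. fact (k i))"

definition feasible ::
  "('i \<Rightarrow> nat) set \<Rightarrow> ('i \<Rightarrow> real) \<Rightarrow> ('i \<Rightarrow> real) \<Rightarrow> (('i::finite \<Rightarrow> nat) \<Rightarrow> real) \<Rightarrow> bool" where
  "feasible Kb lam mu x \<longleftrightarrow>
     (\<forall>k\<in>Kset Kb. 0 \<le> x k) \<and> (\<forall>k. k \<notin> Kset Kb \<longrightarrow> x k = 0) \<and>
     (\<forall>i. (\<Sum>k\<in>Kset Kb. real (k i) * x k) = lam i / mu i)"

definition objF :: "('i \<Rightarrow> nat) set \<Rightarrow> real \<Rightarrow> (('i::finite \<Rightarrow> nat) \<Rightarrow> real) \<Rightarrow> real" where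
  "objF Kb a x = (\<Sum>k\<in>Kset Kb. if x k = 0 then 0 else x k * ln (x k * ccoef k / (exp 1 * a)))"

definition xstar ::
  "('i \<Rightarrow> nat) set \<Rightarrow> ('i \<Rightarrow> real) \<Rightarrow> ('i \<Rightarrow> real) \<Rightarrow> real \<Rightarrow> (('i::finite \<Rightarrow> nat) \<Rightarrow> real)" where
  "xstar Kb lam mu a = (THE x. feasible Kb lam mu x \<and>
      (\<forall>y. feasible Kb lam mu y \<longrightarrow> objF Kb a x \<le> objF Kb a y))"

definition qstar :: "(('i::finite) \<Rightarrow> nat) set \<Rightarrow> ('i \<Rightarrow> real) \<Rightarrow> ('i \<Rightarrow> real) \<Rightarrow> real \<Rightarrow> real" where
  "qstar Kb lam mu a = (\<Sum>k\<in>Kset Kb. xstar Kb lam mu a k)"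

end

theory Submission
  imports Defs "HOL-Real_Asymp.Real_Asymp"
begin

text \<open>
  Let \<open>r x\<^sub>k\<close>, with \<open>x\<^sub>k = a exp (\<nu> \<cdot> k) / c\<^sub>k\<close> and Lagrange multipliers \<open>\<nu>\<close>, be the equilibrium number of
  servers in configuration \<open>k\<close>.  Summing the balance equation against a test function \<open>f\<close> gives
  \<open>E (gen f) = 0\<close>; the whole argument consists in choosing \<open>f\<close>.

  The Lyapunov function \<open>lyap\<close> is the relative entropy of the counts with respect to \<open>r x\<^sub>k\<close> plus
  \<open>ln r\<close> times the squared load deviations.  Write \<open>V\<close> and \<open>W\<close> for the up and down flow along an edge
  \<open>(k, k + e\<^sub>i)\<close>.  The entropy decreases at rate \<open>\<Sum> (V - W) (ln V - ln W)\<close>, up to terms controlled by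
  the load deviations.  If this dissipation is small, each flow is nearly balanced, so the counts are
  nearly of product form, and since the loads are nearly \<open>\<rho>\<^sub>i\<close> the counts are near \<open>r x\<^sub>k\<close>.  Hence \<open>lyap\<close>
  has drift at most \<open>- c lyap + C ln r\<close>, and the exponential test function \<open>exp (\<kappa> lyap / ln r)\<close> shows
  that \<open>lyap\<close> exceeds \<open>(ln r)\<^sup>3\<close> with probability smaller than any power of \<open>r\<close>.  So the number of
  occupied servers is \<open>q r\<close> up to \<open>sqrt r (ln r)\<^sup>2\<close>.

  Outside this event no server of rank above \<open>N \<approx> q r + sqrt r (ln r)\<^sup>2\<close> is ever opened, by First-Fit, while
  every such server receives customers at a bounded rate only.  A weighted count of the occupied servers
  of rank above \<open>N\<close> therefore has drift at most \<open>-1\<close> as long as there is one, which makes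
  the probability that such a server exists at most \<open>O(r)\<close> times that of the exceptional event.
\<close>

subsection \<open>The equilibrium\<close>

text \<open>Entropy alone is not a Lyapunov function. Load deviations feed it through the product of
  \<open>discrepancy\<close> and \<open>load_dev_sum\<close>, which after the arithmetic-geometric
  inequality leaves a constant times \<open>r * load_dev_sq\<close>. The numbers of customers revert
  to their means at a fixed rate, so the weight \<open>ln r\<close> on the quadratic part wins for
  large \<open>r\<close>, however the constants compare.

  The same scale governs the exponent. When a count is near 0 the logarithm of a flow ratio can be
  of order \<open>ln r\<close>, so squared jumps are bounded only by \<open>ln r\<close> times the
  dissipation. Hence the exponent \<open>\<kappa> / ln r\<close>; at the level
  \<open>(ln r) ^ 3\<close> it gives \<open>exp (- \<kappa> * (ln r)\<^sup>2)\<close>, small enough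
  to pay for the factor \<open>r\<close> in the rank estimate.

  Stationarity is available only as balance equations. Integrability of the jump rate therefore has
  to precede any use of vanishing expectations, and states with loads off by order \<open>r\<close>
  are excluded by the exact Poisson laws of the customer numbers.\<close>

lemma entropy_ge:
  fixes x y :: real
  assumes "0 \<le> y" "0 < x"
  shows "(sqrt y - sqrt x)\<^sup>2 \<le> y * ln (y / x) - y + x"
proof (cases "y = 0")
  case True
  then show ?thesis using assms by simp
next
  case False
  with assms have y: "0 < y" by simp
  \<comment> \<open>Using \<open>ln t \<le> t - 1\<close> at the square root, and not at
    \<open>x / y\<close> itself, yields the squared Hellinger distance instead of mere
    nonnegativity.\<close>
  define t where "t = sqrt (x / y)"
  have t: "0 < t" "y * t = sqrt x * sqrt y"
    using y assms by (auto simp: t_def real_sqrt_divide real_div_sqrt field_simps)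
  have "ln (x / y) = 2 * ln t"
    using y assms by (simp add: t_def ln_sqrt)
  moreover have "ln (x / y) = - ln (y / x)"
    using y assms by (simp add: ln_div)
  moreover have "ln t \<le> t - 1"
    using t by (simp add: ln_le_minus_one)
  ultimately have "ln (y / x) \<ge> 2 - 2 * t" by linarith
  then have "y * ln (y / x) \<ge> y * (2 - 2 * t)"
    using y by (intro mult_left_mono) auto
  moreover have "(sqrt y - sqrt x)\<^sup>2 = y + x - 2 * (y * t)"
    using y assms t by (simp add: power2_diff)
  ultimately show ?thesis by (simp add: algebra_simps)
qed

lemma entropy_nonneg:
  fixes x y :: real
  assumes "0 \<le> y" "0 < x"
  shows "0 \<le> y * ln (y / x) - y + x"
  using entropy_ge[OF assms] zero_le_power2[of "sqrt y - sqrt x"] by linarith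

lemma entropy_le:
  fixes x y :: real
  assumes "0 \<le> y" "0 < x"
  shows "y * ln (y / x) - y + x \<le> (y - x)\<^sup>2 / x"
proof (cases "y = 0")
  case True
  then show ?thesis using assms by (simp add: power2_eq_square)
next
  case False
  with assms have "ln (y / x) \<le> y / x - 1"
    by (intro ln_le_minus_one) auto
  then have "y * ln (y / x) \<le> y * (y / x - 1)"
    using assms by (intro mult_left_mono) auto
  also have "\<dots> - y + x = (y - x)\<^sup>2 / x"
    using assms by (simp add: field_simps power2_eq_square)
  finally show ?thesis by simp
qed

text \<open>Coercivity of the dual objective in one coordinate: for negative \<open>t\<close> the
  linear term suffices, for positive \<open>t\<close> the exponential wins. It confines the
  minimizer in \<open>multipliers_exist\<close> to a ball.\<close>

lemma exp_minus_linear_ge: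
  fixes \<rho> a t :: real
  assumes "0 < \<rho>" "0 < a"
  shows "\<rho> * \<bar>t\<bar> - \<bar>2 * \<rho> * ln (2 * \<rho> / a)\<bar> \<le> a * exp t - \<rho> * t"
proof (cases "t \<le> 0")
  case True
  have "0 \<le> a * exp t" using assms by simp
  moreover have "\<rho> * \<bar>t\<bar> = - (\<rho> * t)" using True by simp
  ultimately show ?thesis
    using abs_ge_zero[of "2 * \<rho> * ln (2 * \<rho> / a)"] by linarith
next
  case False
  \<comment> \<open>The tangent to \<open>a * exp t\<close> at this point has slope
    \<open>2 * \<rho>\<close>, so slope \<open>\<rho>\<close> survives the subtraction of
    \<open>\<rho> * t\<close>.\<close>
  define s where "s = ln (2 * \<rho> / a)"
  have "1 + (t - s) \<le> exp (t - s)" by (rule exp_ge_add_one_self)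
  then have "a * exp s * (1 + (t - s)) \<le> a * exp s * exp (t - s)"
    using assms by (intro mult_left_mono) auto
  also have "\<dots> = a * exp t" by (simp add: exp_diff)
  also have "a * exp s = 2 * \<rho>" using assms by (simp add: s_def)
  finally have "2 * \<rho> * t - 2 * \<rho> * s + 2 * \<rho> \<le> a * exp t"
    by (simp add: algebra_simps)
  moreover have "2 * \<rho> * s \<le> \<bar>2 * \<rho> * s\<bar>" by (rule abs_ge_self)
  ultimately show ?thesis using False assms by (simp add: s_def algebra_simps)
qed

lemma unitv_inj: "inj unitv"
  by (rule injI) (metis unitv_def zero_neq_one)

lemma unitv_neq_0 [simp]: "unitv i \<noteq> 0"
  by (auto simp: unitv_def fun_eq_iff)

lemma ccoef_pos: "0 < ccoef k"
  by (simp add: ccoef_def prod_pos)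

lemma ccoef_unitv [simp]: "ccoef (unitv i) = 1"
  by (auto simp: ccoef_def unitv_def intro!: prod.neutral)

lemma sum_unitv: "(\<Sum>j\<in>UNIV. real (unitv (i::'i::finite) j) * f j) = f i"
proof -
  have "(\<Sum>j\<in>UNIV. real (unitv i j) * f j) = (\<Sum>j\<in>UNIV. if j = i then f j else 0)"
    by (intro sum.cong) (auto simp: unitv_def)
  then show ?thesis by simp
qed

lemma ccoef_0 [simp]: "ccoef 0 = 1"
  by (simp add: ccoef_def)

lemma ccoef_add_unitv: "ccoef (k + unitv i) = real (k i + 1) * ccoef k"
proof -
  have "ccoef (k + unitv i) = (\<Prod>j\<in>UNIV. (if j = i then real (k i + 1) else 1) * fact (k j))"
    unfolding ccoef_def by (intro prod.cong) (auto simp: unitv_def)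
  also have "\<dots> = real (k i + 1) * ccoef k"
    by (simp add: prod.distrib ccoef_def prod.delta)
  finally show ?thesis .
qed

locale packing =
  fixes Kb :: "('i::finite \<Rightarrow> nat) set" and lam mu :: "'i \<Rightarrow> real" and a :: real
  assumes Kb: "config_set_ok Kb"
    and lam_pos: "\<And>i. 0 < lam i"
    and mu_pos: "\<And>i. 0 < mu i"
    and load: "(\<Sum>i\<in>UNIV. lam i / mu i) = 1"
    and a_pos: "0 < a"
begin

abbreviation "K \<equiv> Kset Kb"
abbreviation "rho i \<equiv> lam i / mu i"

lemma rho_pos: "0 < rho i"
  using lam_pos mu_pos by simp

lemma finite_Kb [simp]: "finite Kb"
  and zero_in_Kb [simp]: "0 \<in> Kb"
  and unitv_in_Kb [simp]: "unitv i \<in> Kb"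
  using Kb by (auto simp: config_set_ok_def)

lemma Kb_down: "k \<in> Kb \<Longrightarrow> (\<And>i. k' i \<le> k i) \<Longrightarrow> k' \<in> Kb"
  using Kb unfolding config_set_ok_def by blast

lemma finite_K [simp]: "finite K"
  by (simp add: Kset_def)

lemma unitv_in_K [simp]: "unitv i \<in> K"
  by (simp add: Kset_def)

text \<open>Convex duality: the load equations say that the gradient of the dual function
  \<open>\<Psi>\<close> vanishes. A minimizer exists because \<open>\<Psi>\<close> is continuous and
  coercive.\<close>

lemma multipliers_exist:
  "\<exists>\<nu>. \<forall>i. (\<Sum>k\<in>K. real (k i) * (a / ccoef k * exp (\<Sum>j\<in>UNIV. real (k j) * \<nu> j))) = rho i"
proof -
  define \<Psi> where "\<Psi> v = (\<Sum>k\<in>K. a / ccoef k * exp (\<Sum>j\<in>UNIV. real (k j) * v $ j)) - (\<Sum>i\<in>UNIV. rho i * v $ i)"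
    for v :: "real ^ 'i"
  define C where "C = (\<Sum>i\<in>UNIV. \<bar>2 * rho i * ln (2 * rho i / a)\<bar>)"
  define c where "c = Min (range (\<lambda>i. rho i))"
  have c_pos: "0 < c" and c_le: "c \<le> rho i" for i
    unfolding c_def using rho_pos by (auto simp: Min_gr_iff)
  have lower: "c * norm v - C \<le> \<Psi> v" for v
  proof -
    have "c * norm v \<le> c * (\<Sum>i\<in>UNIV. \<bar>v $ i\<bar>)"
      using c_pos norm_le_l1_cart[of v] by (intro mult_left_mono) auto
    also have "\<dots> \<le> (\<Sum>i\<in>UNIV. rho i * \<bar>v $ i\<bar>)"
      unfolding sum_distrib_left by (intro sum_mono mult_right_mono c_le) auto
    also have "\<dots> - C \<le> (\<Sum>i\<in>UNIV. a * exp (v $ i) - rho i * v $ i)"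
      unfolding C_def sum_subtractf[symmetric]
      by (intro sum_mono exp_minus_linear_ge rho_pos a_pos)
    \<comment> \<open>All summands are positive, and the unit configurations, which belong to
      \<open>K\<close>, already provide one exponential for each coordinate.\<close>
    also have "(\<Sum>i\<in>UNIV. a * exp (v $ i)) \<le> (\<Sum>k\<in>K. a / ccoef k * exp (\<Sum>j\<in>UNIV. real (k j) * v $ j))"
    proof -
      have "(\<Sum>i\<in>UNIV. a * exp (v $ i)) = (\<Sum>k\<in>range unitv. a / ccoef k * exp (\<Sum>j\<in>UNIV. real (k j) * v $ j))"
        by (subst sum.reindex[OF unitv_inj])
          (simp add: sum_unitv)
      also have "\<dots> \<le> (\<Sum>k\<in>K. a / ccoef k * exp (\<Sum>j\<in>UNIV. real (k j) * v $ j))"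
        using a_pos by (intro sum_mono2) (auto intro!: mult_nonneg_nonneg divide_nonneg_pos ccoef_pos)
      finally show ?thesis .
    qed
    then have "(\<Sum>i\<in>UNIV. a * exp (v $ i) - rho i * v $ i) \<le> \<Psi> v"
      by (simp add: \<Psi>_def sum_subtractf)
    finally show ?thesis by simp
  qed
  \<comment> \<open>Outside the ball of this radius the lower bound exceeds \<open>\<Psi> 0\<close>,
    so a minimum over the ball is global.\<close>
  define R where "R = (\<bar>\<Psi> 0\<bar> + \<bar>C\<bar> + 1) / c"
  have "R \<ge> 0" using c_pos by (simp add: R_def)
  have "continuous_on (cball 0 R) \<Psi>"
    unfolding \<Psi>_def by (intro continuous_intros)
  then obtain v where v: "v \<in> cball 0 R" "\<And>w. w \<in> cball 0 R \<Longrightarrow> \<Psi> v \<le> \<Psi> w"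
    using continuous_attains_inf[of "cball 0 R" \<Psi>] \<open>R \<ge> 0\<close> by auto
  have vmin: "\<Psi> v \<le> \<Psi> w" for w
  proof (cases "w \<in> cball 0 R")
    case False
    then have "R < norm w" by simp
    then have "c * R < c * norm w" using c_pos by simp
    then have "\<Psi> 0 \<le> \<Psi> w" using lower[of w] c_pos by (simp add: R_def)
    moreover have "\<Psi> v \<le> \<Psi> 0" using v \<open>R \<ge> 0\<close> by simp
    ultimately show ?thesis by simp
  qed (use v in simp)
  have "(\<Sum>k\<in>K. real (k i) * (a / ccoef k * exp (\<Sum>j\<in>UNIV. real (k j) * v $ j))) = rho i" for i
  proof -
    define w where "w k = a / ccoef k * exp (\<Sum>j\<in>UNIV. real (k j) * v $ j)" for k
    \<comment> \<open>The restriction of \<open>\<Psi>\<close> to the line through the minimizer in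
      direction \<open>i\<close>; a one-dimensional derivative test gives the partial derivative
      condition.\<close>
    define g where "g t = (\<Sum>k\<in>K. w k * exp (t * real (k i))) - rho i * t - (\<Sum>j\<in>UNIV. rho j * v $ j)" for t
    have ax: "(\<Sum>j\<in>UNIV. f j * (v + t *\<^sub>R axis i 1) $ j) = (\<Sum>j\<in>UNIV. f j * v $ j) + t * f i" for f :: "'i \<Rightarrow> real" and t
    proof -
      have "axis i 1 $ j = real (unitv i j)" for j by (simp add: axis_def unitv_def)
      then have "(\<Sum>j\<in>UNIV. f j * (v + t *\<^sub>R axis i 1) $ j) = (\<Sum>j\<in>UNIV. f j * v $ j + t * (real (unitv i j) * f j))"
        by (intro sum.cong) (auto simp: algebra_simps)
      then show ?thesis by (simp add: sum.distrib sum_distrib_left[symmetric] sum_unitv)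
    qed
    have g: "\<Psi> (v + t *\<^sub>R axis i 1) = g t" for t
      unfolding \<Psi>_def ax by (simp add: g_def w_def exp_add mult.assoc)
    have "(g has_field_derivative (\<Sum>k\<in>K. w k * real (k i)) - rho i) (at 0)"
    proof -
      have "((\<lambda>t. (\<Sum>k\<in>K. w k * exp (t * real (k i))) - q * t - s) has_field_derivative
          (\<Sum>k\<in>K. w k * real (k i)) - q) (at 0)" for q s :: real
        by (auto intro!: derivative_eq_intros sum.cong)
      then show ?thesis unfolding g_def .
    qed
    moreover have "g 0 \<le> g t" for t
      using vmin[of "v + t *\<^sub>R axis i 1"] g[of 0] g[of t] by simp
    ultimately have "(\<Sum>k\<in>K. w k * real (k i)) - rho i = 0"
      by (intro DERIV_local_min[of g _ 0 1]) auto
    then have "(\<Sum>k\<in>K. w k * real (k i)) = rho i" by linarith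
    then show ?thesis by (simp only: w_def mult.commute)
  qed
  then show ?thesis by blast
qed

end

locale packing_eq = packing Kb lam mu a for Kb :: "('i::finite \<Rightarrow> nat) set" and lam mu a +
  fixes \<nu> :: "'i \<Rightarrow> real"
  assumes multiplier_eq:
    "(\<Sum>k\<in>K. real (k i) * (a / ccoef k * exp (\<Sum>j\<in>UNIV. real (k j) * \<nu> j))) = rho i"
begin

definition xst :: "('i \<Rightarrow> nat) \<Rightarrow> real" where
  "xst k = a / ccoef k * exp (\<Sum>j\<in>UNIV. real (k j) * \<nu> j)"

lemma xst_pos: "0 < xst k"
  using a_pos ccoef_pos[of k] by (simp add: xst_def)

lemma xst_0 [simp]: "xst 0 = a"
  by (simp add: xst_def)

lemma sum_xst: "(\<Sum>k\<in>K. real (k i) * xst k) = rho i"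
  using multiplier_eq by (simp add: xst_def)

text \<open>Detailed balance of the product form, with \<open>mu i\<close> cancelled: departures
  from \<open>k + unitv i\<close> match arrivals at rate \<open>mu i * exp (\<nu> i)\<close> to each
  server in configuration \<open>k\<close>.\<close>

lemma xst_add_unitv: "real (k i + 1) * xst (k + unitv i) = exp (\<nu> i) * xst k"
proof -
  have *: "(\<Sum>j\<in>UNIV. real ((k + unitv i) j) * \<nu> j) = (\<Sum>j\<in>UNIV. real (k j) * \<nu> j) + \<nu> i"
    using sum_unitv[of i \<nu>] by (simp add: distrib_right sum.distrib)
  show ?thesis
    unfolding xst_def * ccoef_add_unitv exp_add using ccoef_pos[of k] by simp
qed

text \<open>The load constraints fix the value of every function linear in the loads. On the
  feasible set the objective is therefore the relative entropy with respect to \<open>xst\<close>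
  plus a constant, and relative entropy vanishes only at \<open>xst\<close>.\<close>

lemma xstar_eq: "xstar Kb lam mu a = (\<lambda>k. if k \<in> K then xst k else 0)"
proof -
  let ?x = "\<lambda>k. if k \<in> K then xst k else 0"
  let ?e = "\<lambda>k y. y * ln (y / xst k) - y + xst k"
  have feas: "feasible Kb lam mu ?x"
    using sum_xst xst_pos by (auto simp: feasible_def less_imp_le intro!: sum.cong)
  have obj: "objF Kb a y = (\<Sum>k\<in>K. ?e k (y k)) + (\<Sum>i\<in>UNIV. \<nu> i * rho i) - (\<Sum>k\<in>K. xst k)"
    if y: "feasible Kb lam mu y" for y
  proof -
    have "objF Kb a y = (\<Sum>k\<in>K. ?e k (y k) - xst k + (\<Sum>i\<in>UNIV. \<nu> i * (real (k i) * y k)))"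
      unfolding objF_def
    proof (intro sum.cong refl)
      fix k assume "k \<in> K"
      show "(if y k = 0 then 0 else y k * ln (y k * ccoef k / (exp 1 * a))) =
          ?e k (y k) - xst k + (\<Sum>i\<in>UNIV. \<nu> i * (real (k i) * y k))"
      proof (cases "y k = 0")
        case False
        with y \<open>k \<in> K\<close> have "0 < y k"
          by (auto simp: feasible_def less_le)
        then have "ln (y k * ccoef k / (exp 1 * a)) = ln (y k / xst k) - 1 + (\<Sum>i\<in>UNIV. \<nu> i * real (k i))"
          using a_pos ccoef_pos[of k]
          by (simp add: xst_def ln_div ln_mult mult.commute)
        then show ?thesis using False
          by (simp only: if_False) (simp add: algebra_simps sum_distrib_left)
      qed simp
    qed
    also have "\<dots> = (\<Sum>k\<in>K. ?e k (y k)) + (\<Sum>k\<in>K. (\<Sum>i\<in>UNIV. \<nu> i * (real (k i) * y k))) - (\<Sum>k\<in>K. xst k)"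
      by (simp add: sum.distrib sum_subtractf)
    also have "(\<Sum>k\<in>K. (\<Sum>i\<in>UNIV. \<nu> i * (real (k i) * y k))) = (\<Sum>i\<in>UNIV. \<nu> i * (\<Sum>k\<in>K. real (k i) * y k))"
      by (subst sum.swap) (simp add: sum_distrib_left)
    also have "\<dots> = (\<Sum>i\<in>UNIV. \<nu> i * rho i)"
      using y by (simp add: feasible_def)
    finally show ?thesis .
  qed
  have zero: "(\<Sum>k\<in>K. ?e k (?x k)) = 0"
    using xst_pos by (intro sum.neutral) (auto simp: less_imp_neq[symmetric])
  have nn: "0 \<le> ?e k (y k)" if "feasible Kb lam mu y" "k \<in> K" for y k
    using that xst_pos by (intro entropy_nonneg) (auto simp: feasible_def)
  show ?thesis unfolding xstar_def
  proof (rule the_equality)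
    show "feasible Kb lam mu ?x \<and> (\<forall>y. feasible Kb lam mu y \<longrightarrow> objF Kb a ?x \<le> objF Kb a y)"
      using feas obj[OF feas] obj zero nn by (auto intro!: sum_nonneg)
  next
    fix y assume y: "feasible Kb lam mu y \<and> (\<forall>z. feasible Kb lam mu z \<longrightarrow> objF Kb a y \<le> objF Kb a z)"
    then have "(\<Sum>k\<in>K. ?e k (y k)) \<le> 0"
      using obj[OF feas] obj[of y] zero feas by force
    moreover have ynn: "0 \<le> ?e k (y k)" if "k \<in> K" for k using nn y that by blast
    moreover have "(\<Sum>k\<in>K. ?e k (y k)) \<ge> 0" using ynn by (intro sum_nonneg)
    ultimately have e0: "?e k (y k) = 0" if "k \<in> K" for k
      using that sum_nonneg_eq_0_iff[of K "\<lambda>k. ?e k (y k)"] by (meson finite_K order_antisym)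
    show "y = ?x"
    proof
      fix k
      show "y k = ?x k"
      proof (cases "k \<in> K")
        case True
        have "0 \<le> y k" using y True by (auto simp: feasible_def)
        then have "(sqrt (y k) - sqrt (xst k))\<^sup>2 \<le> 0"
          using entropy_ge[OF _ xst_pos, of "y k" k] e0[OF True] by simp
        then show ?thesis using True by simp
      next
        case False
        then show ?thesis using y by (auto simp: feasible_def)
      qed
    qed
  qed
qed

lemma qstar_eq: "qstar Kb lam mu a = (\<Sum>k\<in>K. xst k)"
  by (simp add: qstar_def xstar_eq)

end

subsection \<open>The generator in the stationary regime\<close>

text \<open>Balance equations are unordered sums, expectations are Bochner integrals; this lemma and
  the next one translate between them.\<close>

lemma pmf_summable_integrable:
  fixes f :: "'a \<Rightarrow> real"
  shows "(\<lambda>x. pmf p x * f x) summable_on UNIV \<longleftrightarrow> integrable (measure_pmf p) f"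
proof -
  have "(\<lambda>x. pmf p x * f x) summable_on UNIV \<longleftrightarrow> integrable (count_space UNIV) (\<lambda>x. pmf p x * f x)"
    using summable_on_iff_abs_summable_on_real abs_summable_equivalent abs_summable_on_def by metis
  then show ?thesis
    by (simp add: measure_pmf_eq_density integrable_density)
qed

lemma pmf_has_sum_expectation:
  fixes f :: "'a \<Rightarrow> real"
  assumes "integrable (measure_pmf p) f"
  shows "((\<lambda>x. pmf p x * f x) has_sum measure_pmf.expectation p f) UNIV"
proof -
  have s: "(\<lambda>x. pmf p x * f x) summable_on UNIV"
    using assms by (simp add: pmf_summable_integrable)
  then have "Infinite_Set_Sum.abs_summable_on (\<lambda>x. pmf p x * f x) UNIV"
    using summable_on_iff_abs_summable_on_real abs_summable_equivalent by metis
  then have "infsum (\<lambda>x. pmf p x * f x) UNIV = (\<integral>x. pmf p x * f x \<partial>count_space UNIV)"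
    by (metis infsetsum_infsum infsetsum_def)
  also have "\<dots> = measure_pmf.expectation p f"
    by (simp add: measure_pmf_eq_density integral_density)
  finally show ?thesis using has_sum_infsum[OF s] by simp
qed

text \<open>\<open>rate\<close> groups jumps by their target state. Injectivity of \<open>h\<close>
  makes each fibre a single server, so a sum over target states becomes a finite sum over
  servers.\<close>

lemma has_sum_fibre:
  fixes c :: "'b \<Rightarrow> real" and g :: "'a \<Rightarrow> real"
  assumes F: "finite F" and c: "\<And>l. P l \<Longrightarrow> l \<notin> F \<Longrightarrow> c l = 0" and h: "inj_on h {l. P l}"
  shows "((\<lambda>x. (\<Sum>l | P l \<and> x = h l. c l) * g x) has_sum (\<Sum>l | l \<in> F \<and> P l. c l * g (h l))) UNIV"
proof (rule has_sum_finite_neutralI)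
  let ?F = "{l. l \<in> F \<and> P l}"
  have fib: "(\<Sum>l' | P l' \<and> h l = h l'. c l') = c l" if "P l" for l
  proof -
    have "{l'. P l' \<and> h l = h l'} = {l}" using that h by (auto simp: inj_on_def)
    then show ?thesis by simp
  qed
  show "finite (h ` ?F)" using F by simp
  show "(\<Sum>l | P l \<and> x = h l. c l) * g x = 0" if "x \<in> UNIV - h ` ?F" for x
  proof -
    have "(\<Sum>l | P l \<and> x = h l. c l) = 0"
      using that c by (intro sum.neutral) auto
    then show ?thesis by simp
  qed
  have "inj_on h ?F" using h by (auto simp: inj_on_def)
  then show "(\<Sum>l\<in>?F. c l * g (h l)) = (\<Sum>x\<in>h ` ?F. (\<Sum>l | P l \<and> x = h l. c l) * g x)"
    by (subst sum.reindex) (auto simp: fib intro!: sum.cong)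
qed auto

lemma has_sum_finite_sum:
  fixes f :: "'i \<Rightarrow> 'a \<Rightarrow> 'b::topological_comm_monoid_add"
  assumes "finite I" "\<And>i. i \<in> I \<Longrightarrow> (f i has_sum g i) A"
  shows "((\<lambda>x. \<Sum>i\<in>I. f i x) has_sum (\<Sum>i\<in>I. g i)) A"
  using assms by (induction I rule: finite_induct) (auto intro!: has_sum_add)

section \<open>Effect of a single arrival or departure on a state\<close>

definition Zi :: "(nat \<Rightarrow> 'i \<Rightarrow> nat) \<Rightarrow> 'i \<Rightarrow> nat" where
  "Zi s i = (\<Sum>l\<in>occ s. s l i)"

lemma Ztot_eq: "Ztot s = (\<Sum>i\<in>UNIV. Zi s i)"
  unfolding Ztot_def Zi_def by (rule sum.swap)

lemma Zi_superset: "finite A \<Longrightarrow> occ s \<subseteq> A \<Longrightarrow> Zi s i = (\<Sum>l\<in>A. s l i)"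
  unfolding Zi_def by (rule sum.mono_neutral_left) (auto simp: occ_def)

lemma occ_add: "occ (add_cust s l i) = insert l (occ s)"
  by (auto simp: occ_def add_cust_def unitv_def fun_eq_iff)

lemma occ_rem: "occ (rem_cust s l i) \<subseteq> occ s"
  by (auto simp: occ_def rem_cust_def)

lemma Zi_add:
  assumes "finite (occ s)"
  shows "Zi (add_cust s l i) j = Zi s j + unitv i j"
proof -
  have "Zi (add_cust s l i) j = (\<Sum>m\<in>insert l (occ s). add_cust s l i m j)"
    by (simp add: Zi_def occ_add)
  also have "\<dots> = (\<Sum>m\<in>insert l (occ s). s m j + (if m = l then unitv i j else 0))"
    by (intro sum.cong) (auto simp: add_cust_def)
  also have "\<dots> = Zi s j + unitv i j"
    using assms by (simp add: sum.distrib Zi_superset[of "insert l (occ s)", symmetric] subset_insertI)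
  finally show ?thesis .
qed

lemma Zi_rem:
  assumes "finite (occ s)" "0 < s l i"
  shows "Zi (rem_cust s l i) j = Zi s j - unitv i j" "unitv i j \<le> Zi s j"
proof -
  have s: "add_cust (rem_cust s l i) l i = s"
    using assms by (auto simp: add_cust_def rem_cust_def fun_eq_iff unitv_def)
  have "Zi (add_cust (rem_cust s l i) l i) j = Zi (rem_cust s l i) j + unitv i j"
    by (rule Zi_add[OF finite_subset[OF occ_rem assms(1)]])
  then have "Zi s j = Zi (rem_cust s l i) j + unitv i j" by (simp only: s)
  then show "Zi (rem_cust s l i) j = Zi s j - unitv i j" "unitv i j \<le> Zi s j"
    by auto
qed

lemma inj_add_cust: "inj (\<lambda>l. add_cust s l i)"
proof (rule injI, rule ccontr)
  fix l m assume "add_cust s l i = add_cust s m i" "l \<noteq> m"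
  then have "add_cust s l i l i = add_cust s m i l i" by simp
  then show False using \<open>l \<noteq> m\<close> by (simp add: add_cust_def unitv_def)
qed

lemma inj_on_rem_cust: "inj_on (\<lambda>l. rem_cust s l i) {l. 0 < s l i}"
proof (rule inj_onI, rule ccontr)
  fix l m assume "rem_cust s l i = rem_cust s m i" "l \<noteq> m" "l \<in> {l. 0 < s l i}"
  then have "rem_cust s l i l i = rem_cust s m i l i" "0 < s l i" by auto
  then show False using \<open>l \<noteq> m\<close> by (simp add: rem_cust_def unitv_def)
qed

text \<open>Pigeonhole: the ranks from 1 to \<open>card (occ s) + 1\<close> cannot all be occupied.
  The upper bound is where First-Fit enters the rank estimate.\<close>

lemma first_empty:
  assumes "finite (occ s)"
  shows "1 \<le> first_empty s" "s (first_empty s) = 0" "first_empty s \<le> card (occ s) + 1"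
proof -
  define n where "n = card (occ s) + 1"
  have "\<exists>l\<in>{1..n}. s l = 0"
  proof (rule ccontr)
    assume "\<not> (\<exists>l\<in>{1..n}. s l = 0)"
    then have "{1..n} \<subseteq> occ s" unfolding occ_def by blast
    from card_mono[OF assms this] show False by (simp add: n_def)
  qed
  then obtain l where "l \<in> {1..n}" "s l = 0" by (rule bexE)
  then have l: "1 \<le> l \<and> s l = 0" "l \<le> card (occ s) + 1"
    by (simp_all add: n_def)
  have "1 \<le> first_empty s \<and> s (first_empty s) = 0"
    unfolding first_empty_def by (rule LeastI[of "\<lambda>l. 1 \<le> l \<and> s l = 0", OF l(1)])
  then show "1 \<le> first_empty s" "s (first_empty s) = 0" by auto
  have "first_empty s \<le> l"
    unfolding first_empty_def by (rule Least_le[of "\<lambda>l. 1 \<le> l \<and> s l = 0", OF l(1)])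
  with l(2) show "first_empty s \<le> card (occ s) + 1" by simp
qed

lemma occ_finite: "valid_state Kb s \<Longrightarrow> finite (occ s)"
  by (simp add: valid_state_def occ_def)

context packing
begin

lemma acc_subset: "acc Kb i s \<subseteq> occ s"
  by (auto simp: acc_def occ_def)

lemma valid_add:
  assumes "valid_state Kb s" "l \<in> insert (first_empty s) (acc Kb i s)"
  shows "valid_state Kb (add_cust s l i)"
proof -
  have fin: "finite (occ s)" using assms by (intro occ_finite)
  have "l \<noteq> 0" "s l + unitv i \<in> Kb"
    using assms first_empty[OF fin] by (auto simp: acc_def Kset_def valid_state_def)
  moreover have "finite {m. add_cust s l i m \<noteq> 0}"
    using fin occ_add[of s l i] by (simp add: occ_def[symmetric])
  ultimately show ?thesis using assms by (auto simp: valid_state_def add_cust_def)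
qed

lemma valid_rem:
  assumes "valid_state Kb s"
  shows "valid_state Kb (rem_cust s l i)"
proof -
  have "s l - unitv i \<in> Kb" using assms Kb_down[of "s l"] by (auto simp: valid_state_def)
  moreover have "finite {m. rem_cust s l i m \<noteq> 0}"
    using finite_subset[OF occ_rem occ_finite[OF assms]] by (simp add: occ_def)
  ultimately show ?thesis using assms by (auto simp: valid_state_def rem_cust_def)
qed

text \<open>The first empty server never lies in \<open>acc\<close>, so the two summands of
  \<open>arr_rate\<close> never meet at one server. When \<open>Xi\<close> is 0, \<open>acc\<close>
  is empty and the first case is exact.\<close>

lemma arr_rate_sum:
  fixes F :: "nat \<Rightarrow> real"
  assumes "finite (occ s)"
  shows "(\<Sum>l\<in>insert (first_empty s) (acc Kb i s). arr_rate Kb lam a r s i l * F l) =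
    (if Xi Kb a i s = 0 then lam i * r * F (first_empty s)
     else lam i * r / Xi Kb a i s * (X0 a s * F (first_empty s) + (\<Sum>l\<in>acc Kb i s. F l)))"
proof -
  have fin: "finite (acc Kb i s)" by (simp add: finite_subset[OF acc_subset assms])
  have notin: "first_empty s \<notin> acc Kb i s"
    using first_empty[OF assms] by (auto simp: acc_def)
  show ?thesis
  proof (cases "Xi Kb a i s = 0")
    case True
    then have "acc Kb i s = {}" using fin by (auto simp: Xi_def Xdiam_def)
    then show ?thesis using True by (simp add: arr_rate_def)
  next
    case False
    have "(\<Sum>l\<in>acc Kb i s. arr_rate Kb lam a r s i l * F l) = (\<Sum>l\<in>acc Kb i s. lam i * r / Xi Kb a i s * F l)"
      using notin False by (intro sum.cong) (auto simp: arr_rate_def)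
    moreover have "arr_rate Kb lam a r s i (first_empty s) = lam i * r / Xi Kb a i s * X0 a s"
      using notin False by (simp add: arr_rate_def)
    ultimately show ?thesis
      using notin False fin by (simp add: sum_distrib_left distrib_left mult.assoc)
  qed
qed

lemma arr_rate_total:
  assumes "finite (occ s)"
  shows "(\<Sum>l\<in>insert (first_empty s) (acc Kb i s). arr_rate Kb lam a r s i l) = lam i * r"
proof (cases "Xi Kb a i s = 0")
  case True
  then show ?thesis using arr_rate_sum[OF assms, of r i "\<lambda>_. 1"] by simp
next
  case False
  have "X0 a s * 1 + (\<Sum>l\<in>acc Kb i s. 1) = real (Xi Kb a i s)"
    by (simp add: Xi_def Xdiam_def)
  then show ?thesis using arr_rate_sum[OF assms, of r i "\<lambda>_. 1"] False by simp
qed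

text \<open>Summing over jumps and not over target states keeps every sum finite in a valid state,
  so the generator can be applied to any test function.\<close>

definition gen :: "real \<Rightarrow> ((nat \<Rightarrow> 'i \<Rightarrow> nat) \<Rightarrow> real) \<Rightarrow> (nat \<Rightarrow> 'i \<Rightarrow> nat) \<Rightarrow> real" where
  "gen r f s =
     (\<Sum>i\<in>UNIV. \<Sum>l\<in>insert (first_empty s) (acc Kb i s). arr_rate Kb lam a r s i l * (f (add_cust s l i) - f s))
   + (\<Sum>i\<in>UNIV. \<Sum>l\<in>{l\<in>occ s. 0 < s l i}. mu i * s l i * (f (rem_cust s l i) - f s))"

lemma arr_rate_outside: "l \<notin> insert (first_empty s) (acc Kb i s) \<Longrightarrow> arr_rate Kb lam a r s i l = 0"
  by (simp add: arr_rate_def)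

lemma arr_rate_nonneg: "0 \<le> r \<Longrightarrow> 0 \<le> arr_rate Kb lam a r s i l"
  using lam_pos[of i] by (simp add: arr_rate_def)

lemma rate_nonneg: "0 \<le> r \<Longrightarrow> 0 \<le> rate Kb lam mu a r s s'"
  unfolding rate_def using mu_pos less_imp_le
  by (intro add_nonneg_nonneg sum_nonneg arr_rate_nonneg mult_nonneg_nonneg) (auto simp: less_imp_le)

lemma rate_has_sum:
  assumes "finite (occ s)"
  shows "((\<lambda>s'. rate Kb lam mu a r s s' * g s') has_sum
     ((\<Sum>i\<in>UNIV. \<Sum>l\<in>insert (first_empty s) (acc Kb i s). arr_rate Kb lam a r s i l * g (add_cust s l i))
      + (\<Sum>i\<in>UNIV. \<Sum>l\<in>{l\<in>occ s. 0 < s l i}. mu i * s l i * g (rem_cust s l i)))) UNIV"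
proof -
  have fin: "finite (insert (first_empty s) (acc Kb i s))" for i
    by (simp add: finite_subset[OF acc_subset assms])
  have "((\<lambda>s'. (\<Sum>l | s' = add_cust s l i. arr_rate Kb lam a r s i l) * g s') has_sum
      (\<Sum>l\<in>insert (first_empty s) (acc Kb i s). arr_rate Kb lam a r s i l * g (add_cust s l i))) UNIV" for i
  proof -
    have "((\<lambda>s'. (\<Sum>l | True \<and> s' = add_cust s l i. arr_rate Kb lam a r s i l) * g s') has_sum
      (\<Sum>l | l \<in> insert (first_empty s) (acc Kb i s) \<and> True. arr_rate Kb lam a r s i l * g (add_cust s l i))) UNIV"
      by (rule has_sum_fibre[OF fin arr_rate_outside]) (auto intro: inj_add_cust)
    then show ?thesis by (simp only: simp_thms Collect_mem_eq)
  qed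
  moreover have "((\<lambda>s'. (\<Sum>l | 0 < s l i \<and> s' = rem_cust s l i. mu i * s l i) * g s') has_sum
      (\<Sum>l\<in>{l\<in>occ s. 0 < s l i}. mu i * s l i * g (rem_cust s l i))) UNIV" for i
    by (rule has_sum_fibre[OF assms _ inj_on_rem_cust]) (auto simp: occ_def)
  ultimately show ?thesis
    unfolding rate_def distrib_right sum_distrib_right[of _ UNIV]
    by (intro has_sum_add has_sum_finite_sum finite)
qed

text \<open>If the increments depend on the type alone, the placement rule drops out and only the
  total rates \<open>lam i * r\<close> and \<open>mu i * Zi s i\<close> matter.\<close>

lemma gen_uniform:
  assumes "finite (occ s)"
    and "\<And>i l. l \<in> insert (first_empty s) (acc Kb i s) \<Longrightarrow> f (add_cust s l i) - f s = A i"
    and "\<And>i l. l \<in> occ s \<Longrightarrow> 0 < s l i \<Longrightarrow> f (rem_cust s l i) - f s = B i"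
  shows "gen r f s = (\<Sum>i\<in>UNIV. lam i * r * A i) + (\<Sum>i\<in>UNIV. mu i * Zi s i * B i)"
proof -
  have "(\<Sum>l\<in>insert (first_empty s) (acc Kb i s). arr_rate Kb lam a r s i l * (f (add_cust s l i) - f s)) = lam i * r * A i" for i
  proof -
    have "(\<Sum>l\<in>insert (first_empty s) (acc Kb i s). arr_rate Kb lam a r s i l * (f (add_cust s l i) - f s)) =
        (\<Sum>l\<in>insert (first_empty s) (acc Kb i s). arr_rate Kb lam a r s i l * A i)"
      using assms by (intro sum.cong) auto
    also have "\<dots> = lam i * r * A i"
      by (simp only: sum_distrib_right[symmetric] arr_rate_total[OF assms(1)])
    finally show ?thesis .
  qed
  moreover have "(\<Sum>l\<in>{l\<in>occ s. 0 < s l i}. mu i * s l i * (f (rem_cust s l i) - f s)) = mu i * Zi s i * B i" for i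
  proof -
    have "(\<Sum>l\<in>{l\<in>occ s. 0 < s l i}. mu i * s l i * (f (rem_cust s l i) - f s)) = (\<Sum>l\<in>{l\<in>occ s. 0 < s l i}. mu i * s l i * B i)"
      using assms by (intro sum.cong) auto
    also have "\<dots> = (\<Sum>l\<in>occ s. mu i * s l i * B i)"
      using assms by (intro sum.mono_neutral_left) auto
    finally show ?thesis by (simp add: Zi_def sum_distrib_left sum_distrib_right)
  qed
  ultimately show ?thesis by (simp add: gen_def)
qed

definition total_rate :: "real \<Rightarrow> (nat \<Rightarrow> 'i \<Rightarrow> nat) \<Rightarrow> real" where
  "total_rate r s = (\<Sum>i\<in>UNIV. lam i * r) + (\<Sum>i\<in>UNIV. mu i * Zi s i)"

lemma rate_sum:
  assumes "finite (occ s)"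
  shows "((\<lambda>s'. rate Kb lam mu a r s s' * f s') has_sum (gen r f s + total_rate r s * f s)) UNIV"
proof -
  have "gen r (\<lambda>_. 1) s = 0" by (simp add: gen_def)
  let ?S = "\<lambda>g. (\<Sum>i\<in>UNIV. \<Sum>l\<in>insert (first_empty s) (acc Kb i s). arr_rate Kb lam a r s i l * g (add_cust s l i))
      + (\<Sum>i\<in>UNIV. \<Sum>l\<in>{l\<in>occ s. 0 < s l i}. mu i * s l i * g (rem_cust s l i))"
  note arr_rate_total[OF assms]
  moreover have "(\<Sum>l\<in>{l\<in>occ s. 0 < s l i}. mu i * real (s l i)) = mu i * Zi s i" for i
    unfolding Zi_def of_nat_sum sum_distrib_left
    by (rule sum.mono_neutral_left) (use assms in auto)
  ultimately have "?S f = gen r f s + total_rate r s * f s"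
    unfolding gen_def total_rate_def right_diff_distrib sum_subtractf sum_distrib_right[symmetric]
    by (simp only:) (simp add: distrib_right sum_distrib_right[of lam])
  with rate_has_sum[OF assms, of r f] show ?thesis by simp
qed

lemma outrate_eq: "finite (occ s) \<Longrightarrow> outrate Kb lam mu a r s = total_rate r s"
  unfolding outrate_def using rate_sum[of s r "\<lambda>_. 1"]
  by (simp add: gen_def infsumI)

text \<open>Balance is postulated at valid states only; closedness of that set under jumps supplies
  the trivial balance elsewhere.\<close>

lemma rate_valid:
  assumes "valid_state Kb s" "rate Kb lam mu a r s s' \<noteq> 0"
  shows "valid_state Kb s'"
proof (rule ccontr)
  assume inv: "\<not> valid_state Kb s'"
  have "(\<Sum>l | s' = add_cust s l i. arr_rate Kb lam a r s i l) = 0" for i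
    using inv valid_add[OF assms(1)] arr_rate_outside[of _ s i r] by (intro sum.neutral) blast
  moreover have "{l. 0 < s l i \<and> s' = rem_cust s l i} = {}" for i
    using inv valid_rem[OF assms(1)] by auto
  ultimately have "rate Kb lam mu a r s s' = 0"
    unfolding rate_def by (simp only: sum.empty sum.neutral_const)
  then show False using assms by simp
qed

text \<open>The balance equation at \<open>s\<close> is multiplied by \<open>f s\<close>, and the
  double family is summed in both orders: one order gives the outflow term, the other the generator
  plus the same outflow term.\<close>

lemma stationary_gen:
  assumes st: "stationary Kb lam mu a r \<pi>" and r: "0 \<le> r"
    and f: "\<And>s. 0 \<le> f s" and int: "integrable \<pi> (\<lambda>s. total_rate r s * f s)"
  shows "integrable \<pi> (gen r f)" "measure_pmf.expectation \<pi> (gen r f) = 0"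
proof -
  have pz: "pmf \<pi> s = 0" if "\<not> valid_state Kb s" for s
  proof -
    have "\<not> 0 < pmf \<pi> s" using st that by (auto simp: stationary_def)
    then show ?thesis using pmf_nonneg[of \<pi> s] by linarith
  qed
  let ?q = "rate Kb lam mu a r"
  have bal: "((\<lambda>s'. pmf \<pi> s' * ?q s' s) has_sum (pmf \<pi> s * total_rate r s)) UNIV" for s
  proof (cases "valid_state Kb s")
    case True
    then show ?thesis using st outrate_eq[OF occ_finite[OF True]] by (auto simp: stationary_def)
  next
    case False
    then have "pmf \<pi> s' * ?q s' s = 0" for s'
      using pz rate_valid[of s' r s] by (cases "valid_state Kb s'") auto
    then show ?thesis using pz[OF False] by (simp add: has_sum_0)
  qed
  define S where "S = measure_pmf.expectation \<pi> (\<lambda>s. total_rate r s * f s)"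
  have S: "((\<lambda>s. pmf \<pi> s * (total_rate r s * f s)) has_sum S) UNIV"
    unfolding S_def by (rule pmf_has_sum_expectation[OF int])
  let ?F = "\<lambda>(s, s'). pmf \<pi> s' * ?q s' s * f s"
  have in1: "((\<lambda>s'. ?F (s, s')) has_sum (pmf \<pi> s * (total_rate r s * f s))) UNIV" for s
    using has_sum_cmult_left[OF bal[of s], of "f s"] by (simp add: mult.assoc)
  \<comment> \<open>Nonnegative entries with summable row sums make the double family summable,
    which licenses the exchange.\<close>
  have summ: "?F summable_on UNIV \<times> UNIV"
    using summable_on_SigmaI[OF in1, of UNIV] S rate_nonneg[OF r] f
    by (auto simp: summable_on_def)
  have "(?F has_sum S) (UNIV \<times> UNIV)"
    by (rule has_sum_SigmaI[OF in1 S summ])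
  then have "((\<lambda>(s', s). pmf \<pi> s' * ?q s' s * f s) has_sum S) (UNIV \<times> UNIV)"
    using has_sum_swap[where f = ?F and A = UNIV and B = UNIV and S = S] by simp
  moreover have "((\<lambda>s. pmf \<pi> s' * ?q s' s * f s) has_sum (pmf \<pi> s' * (gen r f s' + total_rate r s' * f s'))) UNIV" for s'
  proof (cases "valid_state Kb s'")
    case True
    from has_sum_cmult_right[OF rate_sum[OF occ_finite[OF True], of r f], of "pmf \<pi> s'"]
    show ?thesis by (simp add: mult.assoc)
  next
    case False
    then show ?thesis using pz by (simp add: has_sum_0)
  qed
  ultimately have "((\<lambda>s. pmf \<pi> s * (gen r f s + total_rate r s * f s)) has_sum S) UNIV"
    using has_sum_SigmaD[where f = "\<lambda>(s', s). pmf \<pi> s' * ?q s' s * f s" and S = S and A = UNIV and B = "\<lambda>_. UNIV"] by auto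
  from has_sum_add[OF this has_sum_uminusI[OF S]] have 0: "((\<lambda>s. pmf \<pi> s * gen r f s) has_sum 0) UNIV"
    by (simp add: algebra_simps)
  then show i: "integrable \<pi> (gen r f)"
    using pmf_summable_integrable[of \<pi> "gen r f"] by (auto simp: summable_on_def)
  from pmf_has_sum_expectation[OF i] 0 show "measure_pmf.expectation \<pi> (gen r f) = 0"
    using has_sum_unique by blast
qed

end

subsection \<open>Customer numbers\<close>

lemma exp_quadratic_bound:
  fixes x :: real
  assumes "x \<le> 1"
  shows "exp x \<le> 1 + x + x\<^sup>2"
proof (cases "0 \<le> x")
  case True
  then show ?thesis using exp_bound assms by simp
next
  case False
  have "x ^ 3 \<le> 0" using False by (simp add: power3_eq_cube mult_nonneg_nonpos mult_nonpos_nonpos)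
  \<comment> \<open>The product equals \<open>1 - x ^ 3\<close>, which is at least 1 for negative
    \<open>x\<close>.\<close>
  then have "1 \<le> (1 + x + x\<^sup>2) * (1 - x)" by (simp add: algebra_simps power2_eq_square power3_eq_cube)
  also have "\<dots> \<le> (1 + x + x\<^sup>2) * exp (- x)"
  proof (rule mult_left_mono)
    show "1 - x \<le> exp (- x)" using exp_ge_add_one_self[of "- x"] by simp
    have "1 + x + x\<^sup>2 = (1 + x / 2)\<^sup>2 + 3 / 4 * x\<^sup>2" by (simp add: power2_eq_square algebra_simps)
    then show "0 \<le> 1 + x + x\<^sup>2" by simp
  qed
  finally show ?thesis by (simp add: exp_minus field_simps)
qed

text \<open>Exponential tilting: weighting the Poisson law of mean \<open>m\<close> by
  \<open>exp (\<theta> * n)\<close> gives a multiple of the Poisson law of mean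
  \<open>m * exp \<theta>\<close>, whose total mass is 1.\<close>

lemma poisson_exp_moment:
  assumes "0 < m"
  shows "integrable (poisson_pmf m) (\<lambda>n. exp (\<theta> * real n))"
    and "measure_pmf.expectation (poisson_pmf m) (\<lambda>n. exp (\<theta> * real n)) = exp (m * (exp \<theta> - 1))"
proof -
  have m': "0 < m * exp \<theta>" using assms by simp
  have eq: "pmf (poisson_pmf m) n * exp (\<theta> * real n) = exp (m * (exp \<theta> - 1)) * pmf (poisson_pmf (m * exp \<theta>)) n" for n
  proof -
    have 1: "exp (\<theta> * real n) = exp \<theta> ^ n" by (rule exp_of_nat2_mult)
    have 2: "exp (- m) = exp (m * (exp \<theta> - 1)) * exp (- (m * exp \<theta>))"
      unfolding exp_add[symmetric] by (simp add: algebra_simps)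
    show ?thesis
      unfolding pmf_poisson[OF assms] pmf_poisson[OF m'] 1 2 power_mult_distrib by (simp only: ac_simps times_divide_eq_left times_divide_eq_right)
  qed
  have "((\<lambda>n. pmf (poisson_pmf (m * exp \<theta>)) n * 1) has_sum 1) UNIV"
    using pmf_has_sum_expectation[of "poisson_pmf (m * exp \<theta>)" "\<lambda>_. 1"] by simp
  from has_sum_cmult_right[OF this, of "exp (m * (exp \<theta> - 1))"]
  have sum: "((\<lambda>n. pmf (poisson_pmf m) n * exp (\<theta> * real n)) has_sum exp (m * (exp \<theta> - 1))) UNIV"
    unfolding eq by simp
  then show int: "integrable (poisson_pmf m) (\<lambda>n. exp (\<theta> * real n))"
    using pmf_summable_integrable[of "poisson_pmf m" "\<lambda>n. exp (\<theta> * real n)"] by (auto simp: summable_on_def)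
  show "measure_pmf.expectation (poisson_pmf m) (\<lambda>n. exp (\<theta> * real n)) = exp (m * (exp \<theta> - 1))"
    using has_sum_unique[OF pmf_has_sum_expectation[OF int] sum] .
qed

context packing
begin

lemma stationary_AE_valid:
  assumes "stationary Kb lam mu a r \<pi>"
  shows "AE s in \<pi>. valid_state Kb s"
  using assms by (auto simp: AE_measure_pmf_iff stationary_def dest: pmf_positive)

lemma total_rate_nonneg: "0 \<le> r \<Longrightarrow> 0 \<le> total_rate r s"
  unfolding total_rate_def using lam_pos mu_pos
  by (intro add_nonneg_nonneg sum_nonneg mult_nonneg_nonneg) (auto simp: less_imp_le)

lemma total_rate_le: "total_rate r s \<le> (\<Sum>i\<in>UNIV. lam i * r) + (\<Sum>i\<in>UNIV. mu i) * real (Ztot s)"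
proof -
  have "Zi s i \<le> Ztot s" for i
    unfolding Ztot_eq by (rule member_le_sum) auto
  then show ?thesis
    unfolding total_rate_def sum_distrib_right using mu_pos
    by (intro add_left_mono sum_mono mult_left_mono) (auto simp: less_imp_le)
qed

lemma Ztot_add: "finite (occ s) \<Longrightarrow> Ztot (add_cust s l i) = Ztot s + 1"
  by (simp add: Ztot_eq Zi_add sum.distrib) (simp add: unitv_def)

lemma Ztot_rem:
  assumes "finite (occ s)" "0 < s l i"
  shows "Ztot s = Ztot (rem_cust s l i) + 1"
proof -
  have "(\<Sum>j\<in>UNIV. Zi s j) = (\<Sum>j\<in>UNIV. Zi (rem_cust s l i) j + unitv i j)"
    using Zi_rem[OF assms] by (intro sum.cong) auto
  also have "\<dots> = (\<Sum>j\<in>UNIV. Zi (rem_cust s l i) j) + 1"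
    by (simp add: sum.distrib) (simp add: unitv_def)
  finally show ?thesis by (simp add: Ztot_eq)
qed

lemma total_rate_integrable:
  assumes st: "stationary Kb lam mu a r \<pi>" and r: "0 < r"
  shows "integrable \<pi> (total_rate r)"
proof -
  define M where "M s = (\<Sum>i\<in>UNIV. mu i * real (Zi s i))" for s :: "nat \<Rightarrow> 'i \<Rightarrow> nat"
  define \<Lambda> where "\<Lambda> = (\<Sum>i\<in>UNIV. lam i * r)"
  have M_nn: "0 \<le> M s" for s
    unfolding M_def using mu_pos by (intro sum_nonneg) (auto simp: less_imp_le)
  have \<Lambda>_nn: "0 \<le> \<Lambda>"
    unfolding \<Lambda>_def using lam_pos r by (intro sum_nonneg) (auto simp: less_imp_le)
  txt \<open>The test function \<open>(N - Z)\<^sup>+\<close> vanishes wherever the jump rate exceeds a bound, so it may be used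
    before the jump rate is known to be integrable.\<close>
  have bound: "measure_pmf.expectation \<pi> (\<lambda>s. M s * of_bool (Ztot s \<le> N)) \<le> \<Lambda>"
    and int: "integrable \<pi> (\<lambda>s. M s * of_bool (Ztot s \<le> N))" for N :: nat
  proof -
    define f where "f s = real (N - Ztot s)" for s :: "nat \<Rightarrow> 'i \<Rightarrow> nat"
    have gen: "gen r f s = M s * of_bool (Ztot s \<le> N) - \<Lambda> * of_bool (Ztot s < N)" if "valid_state Kb s" for s
    proof -
      note fin = occ_finite[OF that]
      have "gen r f s = (\<Sum>i\<in>UNIV. lam i * r * (- of_bool (Ztot s < N))) + (\<Sum>i\<in>UNIV. mu i * Zi s i * of_bool (Ztot s \<le> N))"
      proof (rule gen_uniform[OF fin])
        show "f (add_cust s l i) - f s = - of_bool (Ztot s < N)" for i l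
          by (simp add: f_def Ztot_add[OF fin])
        show "f (rem_cust s l i) - f s = of_bool (Ztot s \<le> N)" if "0 < s l i" for i l
          using Ztot_rem[of s l i] fin that by (auto simp: f_def)
      qed
      also have "\<dots> = M s * of_bool (Ztot s \<le> N) - \<Lambda> * of_bool (Ztot s < N)"
        by (simp add: M_def \<Lambda>_def sum_negf sum_distrib_right)
      finally show ?thesis .
    qed
    have "integrable \<pi> (\<lambda>s. total_rate r s * f s)"
    proof (rule measure_pmf.integrable_const_bound)
      show "AE s in \<pi>. norm (total_rate r s * f s) \<le> (\<Lambda> + (\<Sum>i\<in>UNIV. mu i) * N) * N"
      proof (intro AE_I2)
        fix s
        show "norm (total_rate r s * f s) \<le> (\<Lambda> + (\<Sum>i\<in>UNIV. mu i) * N) * N"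
        proof (cases "Ztot s \<le> N")
          case True
          have "total_rate r s \<le> \<Lambda> + (\<Sum>i\<in>UNIV. mu i) * Ztot s" unfolding \<Lambda>_def by (rule total_rate_le)
          also have "\<dots> \<le> \<Lambda> + (\<Sum>i\<in>UNIV. mu i) * N"
            using True mu_pos by (intro add_left_mono mult_left_mono sum_nonneg) (auto simp: less_imp_le)
          finally have "total_rate r s * f s \<le> (\<Lambda> + (\<Sum>i\<in>UNIV. mu i) * N) * N"
            using total_rate_nonneg[of r s] r by (intro mult_mono) (auto simp: f_def)
          then show ?thesis using total_rate_nonneg[of r s] r by (simp add: f_def)
        next
          case False
          then show ?thesis using \<Lambda>_nn mu_pos
            by (auto simp: f_def less_imp_le intro!: mult_nonneg_nonneg add_nonneg_nonneg sum_nonneg)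
        qed
      qed
    qed simp
    note gen0 = stationary_gen[OF st less_imp_le[OF r] _ this]
    have fnn: "0 \<le> f s" for s by (simp add: f_def)
    have AE: "AE s in \<pi>. gen r f s + \<Lambda> * of_bool (Ztot s < N) = M s * of_bool (Ztot s \<le> N)"
      using stationary_AE_valid[OF st] by eventually_elim (simp add: gen)
    have ind: "integrable \<pi> (\<lambda>s. \<Lambda> * of_bool (Ztot s < N))"
      using \<Lambda>_nn by (intro measure_pmf.integrable_const_bound[of _ \<Lambda>]) auto
    have sum: "integrable \<pi> (\<lambda>s. gen r f s + \<Lambda> * of_bool (Ztot s < N))"
      using gen0(1)[OF fnn] ind by (rule Bochner_Integration.integrable_add)
    show "integrable \<pi> (\<lambda>s. M s * of_bool (Ztot s \<le> N))"
      using integrable_cong_AE_imp[OF sum _ AE] by simp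
    have "measure_pmf.expectation \<pi> (\<lambda>s. M s * of_bool (Ztot s \<le> N)) =
        measure_pmf.expectation \<pi> (\<lambda>s. gen r f s + \<Lambda> * of_bool (Ztot s < N))"
      using AE by (intro integral_cong_AE) auto
    also have "\<dots> = measure_pmf.expectation \<pi> (\<lambda>s. \<Lambda> * of_bool (Ztot s < N))"
      using gen0[OF fnn] ind by simp
    also have "\<dots> \<le> measure_pmf.expectation \<pi> (\<lambda>s. \<Lambda>)"
      using ind \<Lambda>_nn by (intro integral_mono) auto
    finally show "measure_pmf.expectation \<pi> (\<lambda>s. M s * of_bool (Ztot s \<le> N)) \<le> \<Lambda>" by simp
  qed
  \<comment> \<open>A finite set of states has bounded \<open>Ztot\<close>, so each finite partial
    sum is dominated by one truncated expectation, and the bound \<open>\<Lambda>\<close> is the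
    same for all truncations.\<close>
  have "(\<lambda>s. pmf \<pi> s * M s) summable_on UNIV"
  proof (rule nonneg_bdd_above_summable_on)
    show "0 \<le> pmf \<pi> s * M s" for s using M_nn by simp
    show "bdd_above (sum (\<lambda>s. pmf \<pi> s * M s) ` {F. F \<subseteq> UNIV \<and> finite F})"
    proof (rule bdd_aboveI2)
      fix F assume "F \<in> {F :: (nat \<Rightarrow> 'i \<Rightarrow> nat) set. F \<subseteq> UNIV \<and> finite F}"
      then have F: "finite F" by simp
      define N where "N = (\<Sum>s\<in>F. Ztot s)"
      have le: "Ztot s \<le> N" if "s \<in> F" for s
        unfolding N_def using F that by (intro member_le_sum) auto
      have "(\<Sum>s\<in>F. pmf \<pi> s * M s) = (\<Sum>s\<in>F. pmf \<pi> s * (M s * of_bool (Ztot s \<le> N)))"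
        using le by (intro sum.cong) auto
      also have "\<dots> \<le> measure_pmf.expectation \<pi> (\<lambda>s. M s * of_bool (Ztot s \<le> N))"
        using M_nn F by (intro finite_sum_le_has_sum[OF pmf_has_sum_expectation[OF int]]) auto
      finally show "(\<Sum>s\<in>F. pmf \<pi> s * M s) \<le> \<Lambda>" using bound[of N] by linarith
    qed
  qed
  then have "integrable \<pi> M" by (simp add: pmf_summable_integrable)
  then have "integrable \<pi> (\<lambda>s. \<Lambda> + M s)" by simp
  then show ?thesis by (simp add: total_rate_def[abs_def] M_def \<Lambda>_def)
qed

lemma stationary_gen_bounded:
  assumes st: "stationary Kb lam mu a r \<pi>" and r: "0 < r"
    and f: "\<And>s. 0 \<le> f s" "\<And>s. f s \<le> B"
  shows "integrable \<pi> (gen r f)" "measure_pmf.expectation \<pi> (gen r f) = 0"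
proof -
  have "integrable \<pi> (\<lambda>s. B * total_rate r s)" using total_rate_integrable[OF st r] by simp
  then have "integrable \<pi> (\<lambda>s. total_rate r s * f s)"
    by (rule Bochner_Integration.integrable_bound)
      (use f total_rate_nonneg r in \<open>auto intro!: AE_I2 simp: abs_mult mult.commute intro!: mult_mono order_trans[OF f(2)]\<close>)
  from stationary_gen[OF st less_imp_le[OF r] f(1) this]
  show "integrable \<pi> (gen r f)" "measure_pmf.expectation \<pi> (gen r f) = 0" by auto
qed

text \<open>Seen through one type alone, every placement rule is the same infinite-server queue with
  arrival rate \<open>lam i * r\<close> and service rate \<open>mu i\<close>.\<close>

lemma Zi_poisson:
  assumes st: "stationary Kb lam mu a r \<pi>" and r: "0 < r"
  shows "map_pmf (\<lambda>s. Zi s i) \<pi> = poisson_pmf (rho i * r)"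
proof -
  define p where "p = map_pmf (\<lambda>s. Zi s i) \<pi>"
  define m where "m = rho i * r"
  have m: "0 < m" unfolding m_def by (intro mult_pos_pos rho_pos r)
  have pmf_p: "pmf p n = measure_pmf.expectation \<pi> (\<lambda>s. of_bool (Zi s i = n))" for n
  proof -
    have "pmf p n = measure_pmf.prob \<pi> {s. Zi s i = n}"
      by (simp add: p_def pmf_map vimage_def)
    also have "\<dots> = measure_pmf.expectation \<pi> (indicator {s. Zi s i = n})" by simp
    also have "\<dots> = measure_pmf.expectation \<pi> (\<lambda>s. of_bool (Zi s i = n))"
      by (intro Bochner_Integration.integral_cong) (auto simp: indicator_def)
    finally show ?thesis .
  qed
  have int: "integrable \<pi> (\<lambda>s. of_bool (Zi s i = n) :: real)" for n
    by (intro measure_pmf.integrable_const_bound[of _ 1]) auto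
  have rec: "real (n + 1) * pmf p (n + 1) = m * pmf p n" for n
  proof -
    \<comment> \<open>Only jumps across the cut between \<open>n\<close> and \<open>n + 1\<close>
      change this indicator, so the vanishing expectation is detailed balance across the
      cut.\<close>
    define f where "f s = (of_bool (Zi s i \<le> n) :: real)" for s :: "nat \<Rightarrow> 'i \<Rightarrow> nat"
    let ?h = "\<lambda>s. mu i * real (n + 1) * of_bool (Zi s i = n + 1) - lam i * r * of_bool (Zi s i = n)"
    have gen: "gen r f s = ?h s" if "valid_state Kb s" for s
    proof -
      note fin = occ_finite[OF that]
      have "gen r f s = (\<Sum>j\<in>UNIV. lam j * r * (if j = i then - of_bool (Zi s i = n) else 0))
         + (\<Sum>j\<in>UNIV. mu j * Zi s j * (if j = i then of_bool (Zi s i = n + 1) else 0))"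
      proof (rule gen_uniform[OF fin])
        show "f (add_cust s l j) - f s = (if j = i then - of_bool (Zi s i = n) else 0)" for j l
          by (auto simp: f_def Zi_add[OF fin] unitv_def)
        show "f (rem_cust s l j) - f s = (if j = i then of_bool (Zi s i = n + 1) else 0)" if "0 < s l j" for j l
          using Zi_rem[OF fin that, of i] by (auto simp: f_def unitv_def)
      qed
      also have "\<dots> = ?h s" by (simp add: if_distrib cong: if_cong)
      finally show ?thesis .
    qed
    have f: "0 \<le> f s" "f s \<le> 1" for s by (simp_all add: f_def)
    have "0 = measure_pmf.expectation \<pi> ?h"
      using stationary_gen_bounded(2)[OF st r f]
      by (subst integral_cong_AE[of _ _ "gen r f"]) (use stationary_AE_valid[OF st] gen in \<open>auto elim: eventually_mono\<close>)
    also have "\<dots> = mu i * real (n + 1) * pmf p (n + 1) - lam i * r * pmf p n"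
      unfolding pmf_p using int by simp
    finally show ?thesis using mu_pos[of i] by (simp add: m_def field_simps)
  qed
  have form: "pmf p n = pmf p 0 * m ^ n / fact n" for n
  proof (induction n)
    case (Suc n)
    have "pmf p (Suc n) = m * pmf p n / real (n + 1)"
      using rec[of n] by (simp add: eq_divide_eq mult.commute)
    then show ?case by (simp add: Suc ac_simps)
  qed simp
  define c where "c = pmf p 0 * exp m"
  have peq: "pmf p n = c * pmf (poisson_pmf m) n" for n
    using form[of n] m by (simp add: exp_minus c_def)
  have one: "((\<lambda>n. pmf q n) has_sum 1) UNIV" for q :: "nat pmf"
    using pmf_has_sum_expectation[of q "\<lambda>_. 1"] by simp
  have "((\<lambda>n. pmf p n) has_sum (c * 1)) UNIV"
    unfolding peq by (rule has_sum_cmult_right[OF one])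
  then have "c * 1 = 1"
    using one[of p] by (rule has_sum_unique)
  then have "pmf p n = pmf (poisson_pmf m) n" for n
    using peq by simp
  then show ?thesis unfolding p_def m_def by (rule pmf_eqI)
qed

lemma Zi_exp_moment:
  assumes st: "stationary Kb lam mu a r \<pi>" and r: "0 < r"
  shows "integrable \<pi> (\<lambda>s. exp (\<theta> * real (Zi s i)))"
    and "measure_pmf.expectation \<pi> (\<lambda>s. exp (\<theta> * real (Zi s i))) = exp (rho i * r * (exp \<theta> - 1))"
proof -
  have m: "0 < rho i * r" by (intro mult_pos_pos rho_pos r)
  show "integrable \<pi> (\<lambda>s. exp (\<theta> * real (Zi s i)))"
    using poisson_exp_moment(1)[OF m, of \<theta>] unfolding Zi_poisson[OF assms, symmetric] by simp
  show "measure_pmf.expectation \<pi> (\<lambda>s. exp (\<theta> * real (Zi s i))) = exp (rho i * r * (exp \<theta> - 1))"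
    using poisson_exp_moment(2)[OF m, of \<theta>] unfolding Zi_poisson[OF assms, symmetric] by simp
qed

text \<open>A two-sided Chernoff bound. The cap 1 on \<open>\<theta>\<close> permits the quadratic
  bound on the exponential; \<open>\<theta> * rho i \<le> \<delta> / 2\<close> lets the quadratic
  term consume at most half of the gain \<open>\<theta> * \<delta> * r\<close>.\<close>

lemma Zi_tail:
  fixes i :: 'i
  assumes st: "stationary Kb lam mu a r \<pi>" and r: "0 < r" and \<delta>: "0 < \<delta>"
  defines "\<theta> \<equiv> min 1 (\<delta> / (2 * rho i))"
  shows "measure_pmf.prob \<pi> {s. \<delta> * r \<le> \<bar>real (Zi s i) - rho i * r\<bar>} \<le> 2 * exp (- (\<theta> * \<delta> / 2) * r)"
proof -
  have \<theta>: "0 < \<theta>" "\<theta> \<le> 1" "\<theta> * rho i \<le> \<delta> / 2"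
  proof -
    obtain q where q: "q = rho i" "0 < q" using rho_pos[of i] by blast
    have "0 < \<delta> / (2 * q)" using q(2) \<delta> by simp
    then show "0 < \<theta>" "\<theta> \<le> 1" by (simp_all only: \<theta>_def q(1)[symmetric] min_less_iff_conj) simp_all
    have "\<theta> * q \<le> \<delta> / (2 * q) * q"
      using q(2) unfolding \<theta>_def q(1)[symmetric] by (intro mult_right_mono) auto
    then show "\<theta> * rho i \<le> \<delta> / 2" unfolding q(1)[symmetric] using q(2) by simp
  qed
  define E where "E t s = exp (t * (real (Zi s i) - rho i * r) - \<theta> * \<delta> * r)" for t :: real and s :: "nat \<Rightarrow> 'i \<Rightarrow> nat"
  have E_eq: "E t s = exp (- t * rho i * r - \<theta> * \<delta> * r) * exp (t * real (Zi s i))" for t s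
    unfolding E_def exp_add[symmetric] by (simp add: algebra_simps)
  have E_int: "integrable \<pi> (E t)" for t
    unfolding E_eq[abs_def] using Zi_exp_moment(1)[OF st r] by simp
  have E_exp: "measure_pmf.expectation \<pi> (E t) \<le> exp (- (\<theta> * \<delta> / 2) * r)" if "t = \<theta> \<or> t = - \<theta>" for t
  proof -
    have "measure_pmf.expectation \<pi> (E t) = exp (- t * rho i * r - \<theta> * \<delta> * r + rho i * r * (exp t - 1))"
      unfolding E_eq[abs_def] exp_add using Zi_exp_moment(2)[OF st r, of t i] by simp
    also have "\<dots> \<le> exp (- (\<theta> * \<delta> / 2) * r)"
    proof (subst exp_le_cancel_iff)
      have "exp t \<le> 1 + t + t\<^sup>2" using that \<theta> by (intro exp_quadratic_bound) auto
      then have "rho i * r * (exp t - 1) \<le> rho i * r * (t + t\<^sup>2)"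
        using mult_pos_pos[OF rho_pos[of i] r] by (intro mult_left_mono) auto
      moreover have "t\<^sup>2 = \<theta> * \<theta>" using that by (auto simp: power2_eq_square)
      moreover have "\<theta> * r * (\<theta> * rho i) \<le> \<theta> * r * (\<delta> / 2)" using \<theta> r by (intro mult_left_mono) auto
      moreover define q where "q = rho i"
      ultimately show "- t * rho i * r - \<theta> * \<delta> * r + rho i * r * (exp t - 1) \<le> - (\<theta> * \<delta> / 2) * r"
        unfolding q_def[symmetric] by (simp add: algebra_simps)
    qed
    finally show ?thesis .
  qed
  let ?A = "{s. \<delta> * r \<le> \<bar>real (Zi s i) - rho i * r\<bar>}"
  have "measure_pmf.prob \<pi> ?A = measure_pmf.expectation \<pi> (indicator ?A)" by simp
  also have "\<dots> \<le> measure_pmf.expectation \<pi> (\<lambda>s. E \<theta> s + E (- \<theta>) s)"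
  proof (rule integral_mono)
    fix s
    show "indicator ?A s \<le> E \<theta> s + E (- \<theta>) s"
    proof (cases "s \<in> ?A")
      case True
      then consider "\<delta> * r \<le> real (Zi s i) - rho i * r" | "\<delta> * r \<le> - (real (Zi s i) - rho i * r)" by force
      then have "1 \<le> E \<theta> s \<or> 1 \<le> E (- \<theta>) s"
      proof cases
        case 1
        from mult_left_mono[OF this less_imp_le[OF \<theta>(1)]] show ?thesis by (simp add: E_def mult.assoc)
      next
        case 2
        from mult_left_mono[OF this less_imp_le[OF \<theta>(1)]] show ?thesis by (simp add: E_def mult.assoc right_diff_distrib)
      qed
      moreover have "0 \<le> E \<theta> s" "0 \<le> E (- \<theta>) s" by (simp_all add: E_def)
      ultimately show ?thesis using True by auto
    qed (simp add: E_def)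
  next
    show "integrable \<pi> (indicator ?A :: _ \<Rightarrow> real)"
      by (intro measure_pmf.integrable_const_bound[of _ 1]) auto
    show "integrable \<pi> (\<lambda>s. E \<theta> s + E (- \<theta>) s)"
      by (intro Bochner_Integration.integrable_add E_int)
  qed
  also have "\<dots> = measure_pmf.expectation \<pi> (E \<theta>) + measure_pmf.expectation \<pi> (E (- \<theta>))"
    using E_int by simp
  also have "\<dots> \<le> 2 * exp (- (\<theta> * \<delta> / 2) * r)"
    using E_exp[of \<theta>] E_exp[of "- \<theta>"] by simp
  finally show ?thesis .
qed

text \<open>In \<open>rank_tail\<close> the jump rate and the test function both grow at most
  linearly in \<open>Ztot\<close>, so their product needs a second moment.\<close>

lemma Ztot_sq_integrable:
  assumes st: "stationary Kb lam mu a r \<pi>" and r: "0 < r"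
  shows "integrable \<pi> (\<lambda>s. (real (Ztot s))\<^sup>2)"
proof -
  have "integrable \<pi> (\<lambda>s. \<Sum>i\<in>UNIV. real CARD('i) * (2 * exp (1 * real (Zi s i))))"
    using Zi_exp_moment(1)[OF assms, of 1] by (intro Bochner_Integration.integrable_sum) auto
  then show ?thesis
  proof (rule Bochner_Integration.integrable_bound)
    have "(real (Ztot s))\<^sup>2 \<le> (\<Sum>i\<in>UNIV. real CARD('i) * (2 * exp (1 * real (Zi s i))))" for s :: "nat \<Rightarrow> 'i \<Rightarrow> nat"
    proof -
      have sq: "x\<^sup>2 \<le> 2 * exp x" if "0 \<le> x" for x :: real
        using exp_lower_Taylor_quadratic[OF that] that by simp
      have "(real (Ztot s))\<^sup>2 \<le> real CARD('i) * (\<Sum>i\<in>UNIV. (real (Zi s i))\<^sup>2)"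
        using sum_squared_le_sum_of_squares[of "\<lambda>i. real (Zi s i)" UNIV] by (simp add: Ztot_eq mult.commute)
      also have "\<dots> \<le> real CARD('i) * (\<Sum>i\<in>UNIV. 2 * exp (1 * real (Zi s i)))"
        using sq by (intro mult_left_mono sum_mono) auto
      finally show ?thesis by (simp add: sum_distrib_left)
    qed
    then show "AE s in \<pi>. norm ((real (Ztot s))\<^sup>2) \<le> norm (\<Sum>i\<in>UNIV. real CARD('i) * (2 * exp (1 * real (Zi s i))))"
      by (intro AE_I2) (auto intro: order_trans abs_ge_self)
  qed simp
qed

end

subsection \<open>Stability of the fluid equilibrium\<close>

text \<open>Strong monotonicity of the exponential on a bounded interval; it produces the quadratic
  lower bound in \<open>fluid_gap\<close>.\<close>

lemma mult_expm1_ge: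
  fixes t B :: real
  assumes "\<bar>t\<bar> \<le> B"
  shows "exp (- B) * t\<^sup>2 \<le> t * (exp t - 1)"
proof (cases "0 \<le> t")
  case True
  have "exp (- B) * t\<^sup>2 \<le> 1 * t\<^sup>2" using assms by (intro mult_right_mono) auto
  also have "\<dots> = t * t" by (simp add: power2_eq_square)
  also have "\<dots> \<le> t * (exp t - 1)"
    by (rule mult_left_mono[OF _ True]) (use exp_ge_add_one_self[of t] in linarith)
  finally show ?thesis .
next
  case False
  have "exp (- B) * t\<^sup>2 \<le> exp t * t\<^sup>2" using assms by (intro mult_right_mono) auto
  also have "\<dots> = (- t) * (exp t * (- t))" by (simp add: power2_eq_square)
  also have "\<dots> \<le> (- t) * (exp t * (exp (- t) - 1))"
  proof (rule mult_left_mono)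
    show "exp t * - t \<le> exp t * (exp (- t) - 1)"
      by (rule mult_left_mono) (use exp_ge_add_one_self[of "- t"] in linarith, simp)
  qed (use False in simp)
  also have "\<dots> = t * (exp t - 1)" by (simp add: right_diff_distrib exp_minus)
  finally show ?thesis .
qed

lemma abs_expm1_le: "\<bar>exp t - 1\<bar> \<le> \<bar>t\<bar> * exp \<bar>t\<bar>" for t :: real
proof (cases "0 \<le> t")
  case True
  have "exp t * (1 + - t) \<le> exp t * exp (- t)"
    using exp_ge_add_one_self[of "- t"] by (intro mult_left_mono) auto
  then show ?thesis using True by (simp add: exp_minus algebra_simps)
next
  case False
  have "1 - exp t \<le> - t" using exp_ge_add_one_self[of t] by linarith
  also have "\<dots> \<le> - t * exp (- t)" using False mult_left_mono[of 1 "exp (- t)" "- t"] by simp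
  finally show ?thesis using False by simp
qed

text \<open>The logarithmic mean of \<open>V\<close> and \<open>W\<close> is at most their maximum.
  Thus dissipation controls squared net flows.\<close>

lemma log_mean_upper:
  fixes V W M :: real
  assumes "0 < V" "0 < W" "V \<le> M" "W \<le> M"
  shows "(V - W)\<^sup>2 \<le> M * ((V - W) * (ln V - ln W))"
proof -
  have *: "(V - W)\<^sup>2 \<le> M * ((V - W) * (ln V - ln W))" if "W \<le> V" "0 < W" "V \<le> M" for V W
  proof -
    have "ln (W / V) \<le> W / V - 1" using that by (intro ln_le_minus_one) auto
    then have "V - W \<le> V * (ln V - ln W)" using that by (simp add: ln_div field_simps)
    then have "(V - W) * (V - W) \<le> (V - W) * (V * (ln V - ln W))" using that by (intro mult_left_mono) auto
    also have "\<dots> = V * ((V - W) * (ln V - ln W))" by (simp add: algebra_simps)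
    also have "\<dots> \<le> M * ((V - W) * (ln V - ln W))"
      using that by (intro mult_right_mono mult_nonneg_nonneg) auto
    finally show ?thesis by (simp add: power2_eq_square)
  qed
  show ?thesis
  proof (cases "W \<le> V")
    case False
    with *[of V W] assms have "(W - V)\<^sup>2 \<le> M * ((W - V) * (ln W - ln V))" using *[of V W] by auto
    then show ?thesis by (simp add: power2_commute algebra_simps)
  qed (use * assms in auto)
qed

text \<open>With \<open>t\<close> the log ratio, \<open>V - W \<ge> W * t\<close> when
  \<open>V\<close> is the larger flow, and the part \<open>V - W\<close> of the weight costs one
  more factor \<open>t\<close>. On edges this loses a factor of order \<open>ln r\<close>, which
  fixes the scale of the exponential test function.\<close>

lemma log_sq_le:
  fixes V W L :: real
  assumes "0 < V" "0 < W" "\<bar>ln V - ln W\<bar> \<le> L"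
  shows "(V + W) * (ln V - ln W)\<^sup>2 \<le> 2 * (1 + L) * ((V - W) * (ln V - ln W))"
proof -
  have *: "(V + W) * (ln V - ln W)\<^sup>2 \<le> 2 * (1 + L) * ((V - W) * (ln V - ln W))"
    if "W \<le> V" "0 < W" "ln V - ln W \<le> L" for V W
  proof -
    define t where "t = ln V - ln W"
    have t: "0 \<le> t" using that by (simp add: t_def)
    have V: "V = W * exp t" using that by (simp add: t_def exp_diff)
    have "W * t \<le> V - W" using that mult_left_mono[of t "exp t - 1" W] exp_ge_add_one_self[of t]
      unfolding V right_diff_distrib by linarith
    then have "(V + W) * t \<le> 2 * (1 + t) * (V - W)"
    proof -
      have "(V + W) * t = (V - W) * t + 2 * (W * t)" by (simp add: algebra_simps)
      also have "\<dots> \<le> (V - W) * t + 2 * (V - W)" using \<open>W * t \<le> V - W\<close> by simp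
      also have "\<dots> \<le> 2 * (1 + t) * (V - W)"
        using t that by (simp add: algebra_simps mult_right_mono)
      finally show ?thesis .
    qed
    also have "\<dots> \<le> 2 * (1 + L) * (V - W)"
      using that by (intro mult_right_mono) (auto simp: t_def)
    finally have "(V + W) * t * t \<le> 2 * (1 + L) * (V - W) * t"
      using t by (rule mult_right_mono)
    then show ?thesis by (simp add: t_def power2_eq_square mult.assoc)
  qed
  show ?thesis
  proof (cases "W \<le> V")
    case False
    have "(W + V) * (ln W - ln V)\<^sup>2 \<le> 2 * (1 + L) * ((W - V) * (ln W - ln V))"
      using False assms by (intro *) auto
    then show ?thesis by (simp add: power2_commute algebra_simps)
  qed (use * assms in auto)
qed


text \<open>\<open>D1\<close> and \<open>D2\<close> are the increments of the entropy along an edge, up and down,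
  and \<open>p\<close> and \<open>q\<close> the discretisation errors at its endpoints.\<close>

lemma edge_first_order:
  fixes \<beta> \<gamma> :: real and A B :: nat
  assumes "0 \<le> \<beta>" "0 \<le> \<gamma>" "real A * p \<le> 1" "real B * q \<le> 1"
    and "A \<noteq> 0 \<Longrightarrow> D1 = u + p" "B \<noteq> 0 \<Longrightarrow> D2 = - u + q"
  shows "\<beta> * A * D1 + \<gamma> * B * D2 \<le> (\<beta> * A - \<gamma> * B) * u + (\<beta> + \<gamma>)"
proof -
  have "\<beta> * A * D1 \<le> \<beta> * A * u + \<beta>"
    using assms(1,3,5) mult_left_mono[OF assms(3,1)] by (cases "A = 0") (auto simp: algebra_simps)
  moreover have "\<gamma> * B * D2 \<le> - (\<gamma> * B * u) + \<gamma>"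
    using assms(2,4,6) mult_left_mono[OF assms(4,2)] by (cases "B = 0") (auto simp: algebra_simps)
  ultimately show ?thesis by (simp add: algebra_simps)
qed

lemma sum_sq_le2: "(x + y)\<^sup>2 \<le> 2 * x\<^sup>2 + 2 * y\<^sup>2" for x y :: real
  using zero_le_power2[of "x - y"] by (simp add: power2_eq_square algebra_simps)

lemma edge_second_order:
  fixes \<beta> \<gamma> :: real and A B :: nat
  assumes "0 \<le> \<beta>" "0 \<le> \<gamma>" "real A * p\<^sup>2 \<le> 1" "real B * q\<^sup>2 \<le> 1"
    and "A \<noteq> 0 \<Longrightarrow> D1 = u + p" "B \<noteq> 0 \<Longrightarrow> D2 = - u + q"
  shows "\<beta> * A * D1\<^sup>2 + \<gamma> * B * D2\<^sup>2 \<le> 2 * (\<beta> * A + \<gamma> * B) * u\<^sup>2 + 2 * (\<beta> + \<gamma>)"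
proof -
  have *: "\<beta> * A * D\<^sup>2 \<le> 2 * (\<beta> * A) * u\<^sup>2 + 2 * \<beta>"
    if "0 \<le> \<beta>" "real A * p\<^sup>2 \<le> 1" "A \<noteq> 0 \<Longrightarrow> D = u + p" for \<beta> p D u :: real and A :: nat
  proof (cases "A = 0")
    case False
    have "\<beta> * A * D\<^sup>2 \<le> \<beta> * A * (2 * u\<^sup>2 + 2 * p\<^sup>2)"
      using that False sum_sq_le2[of u p] by (intro mult_left_mono) auto
    also have "\<dots> = 2 * (\<beta> * A) * u\<^sup>2 + 2 * (\<beta> * (A * p\<^sup>2))" by (simp add: algebra_simps)
    also have "\<beta> * (A * p\<^sup>2) \<le> \<beta> * 1" using that by (intro mult_left_mono) auto
    finally show ?thesis by simp
  qed (use that in simp)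
  from *[OF assms(1,3,5)] *[OF assms(2,4,6)] show ?thesis
    by (simp add: algebra_simps)
qed

text \<open>The error of evaluating a logarithm at \<open>A\<close> instead of \<open>A + 1\<close>
  is at most \<open>1 / A\<close>, and the transition rate out of the configuration is proportional
  to \<open>A\<close>; so every edge contributes a bounded error.\<close>

lemma ln_succ_ratio:
  fixes A :: nat
  assumes "A \<noteq> 0"
  shows "0 \<le> ln ((real A + 1) / A)" "real A * ln ((real A + 1) / A) \<le> 1" "real A * (ln ((real A + 1) / A))\<^sup>2 \<le> 1"
proof -
  define p where "p = ln ((real A + 1) / A)"
  have A: "1 \<le> real A" using assms by simp
  have p: "0 \<le> p" using A by (simp add: p_def)
  have "p \<le> (real A + 1) / A - 1" unfolding p_def using A by (intro ln_le_minus_one) auto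
  then have Ap: "real A * p \<le> 1" using A by (simp add: field_simps)
  have "p \<le> real A * p" using A p mult_right_mono[of 1 "real A" p] by simp
  then have "p \<le> 1" using Ap by simp
  then have "(real A * p) * p \<le> 1 * 1" using Ap p A by (intro mult_mono) auto
  then show "0 \<le> ln ((real A + 1) / A)" "real A * ln ((real A + 1) / A) \<le> 1" "real A * (ln ((real A + 1) / A))\<^sup>2 \<le> 1"
    using p Ap by (auto simp: p_def power2_eq_square mult.assoc)
qed

text \<open>Induction on the number of customers: a customer of some type that is present is
  removed, and downward closedness keeps the path inside \<open>A\<close>.\<close>

lemma config_induct [consumes 1, case_names down zero add]:
  fixes k :: "'i::finite \<Rightarrow> nat"
  assumes "k \<in> A" "\<And>k k'. k \<in> A \<Longrightarrow> (\<And>i. k' i \<le> k i) \<Longrightarrow> k' \<in> A"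
    and "P 0" "\<And>k i. k \<in> A \<Longrightarrow> k + unitv i \<in> A \<Longrightarrow> P k \<Longrightarrow> P (k + unitv i)"
  shows "P k"
  using assms(1)
proof (induction "\<Sum>i\<in>UNIV. k i" arbitrary: k)
  case 0
  then have "k = 0" by (auto simp: fun_eq_iff)
  show ?case unfolding \<open>k = 0\<close> by (rule assms(3))
next
  case (Suc n)
  have "\<exists>i. k i \<noteq> 0"
  proof (rule ccontr)
    assume "\<not> (\<exists>i. k i \<noteq> 0)"
    then have "(\<Sum>i\<in>UNIV. k i) = 0" by simp
    with Suc(2) show False by simp
  qed
  then obtain i where i: "k i \<noteq> 0" by blast
  define k' where "k' = k - unitv i"
  have k: "k = k' + unitv i" using i by (auto simp: k'_def unitv_def fun_eq_iff)
  have "(\<Sum>j\<in>UNIV. k j) = (\<Sum>j\<in>UNIV. k' j) + (\<Sum>j\<in>UNIV. unitv i j)"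
    unfolding k by (simp add: sum.distrib)
  also have "(\<Sum>j\<in>UNIV. unitv i j) = 1" by (simp add: unitv_def)
  finally have "(\<Sum>j\<in>UNIV. k' j) = n" using Suc(2) by simp
  moreover have k': "k' \<in> A" using assms(2)[OF Suc(3), of k'] by (simp add: k'_def)
  ultimately have "P k'" using Suc(1) by blast
  then show ?case using assms(4)[OF k', of i] Suc(3) k by metis
qed

section \<open>Edges between configurations\<close>

context packing
begin

text \<open>The lower endpoints of the type-\<open>i\<close> edges. The configuration 0 is included,
  so opening an empty server is an edge like the others.\<close>

definition Admit :: "'i \<Rightarrow> ('i \<Rightarrow> nat) set" where
  "Admit i = {k \<in> Kb. k + unitv i \<in> Kb}"

lemma finite_Admit [simp]: "finite (Admit i)" by (simp add: Admit_def)

lemma zero_in_Admit [simp]: "0 \<in> Admit i" by (simp add: Admit_def)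

lemma add_unitv_neq_0 [simp]: "k + unitv i \<noteq> 0"
proof
  assume "k + unitv i = 0"
  then have "(k + unitv i) i = 0" by simp
  then show False by (simp add: unitv_def)
qed

lemma AdmitD: "k \<in> Admit i \<Longrightarrow> k \<in> Kb" "k \<in> Admit i \<Longrightarrow> k + unitv i \<in> K"
  by (auto simp: Admit_def Kset_def)

text \<open>Adding a customer maps \<open>Admit i\<close> bijectively onto the configurations in
  \<open>K\<close> that hold type \<open>i\<close>; surjectivity uses that \<open>Kb\<close> is
  downward closed.\<close>

lemma sum_K_reindex:
  "(\<Sum>k\<in>K. if k i = 0 then 0 else f k) = (\<Sum>k\<in>Admit i. f (k + unitv i))" for f :: "_ \<Rightarrow> real"
proof -
  have "(\<Sum>k\<in>K. if k i = 0 then 0 else f k) = (\<Sum>k\<in>{k\<in>K. k i \<noteq> 0}. f k)"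
    by (intro sum.mono_neutral_cong_right) auto
  also have "\<dots> = (\<Sum>k\<in>(\<lambda>k. k + unitv i) ` Admit i. f k)"
  proof (intro sum.cong refl set_eqI iffI)
    fix k assume k: "k \<in> {k \<in> K. k i \<noteq> 0}"
    then have "k = (k - unitv i) + unitv i" by (auto simp: unitv_def fun_eq_iff)
    moreover have "k - unitv i \<in> Kb" using k Kb_down[of k "k - unitv i"] by (auto simp: Kset_def)
    ultimately have "k - unitv i \<in> Admit i" using k by (simp add: Admit_def Kset_def)
    with \<open>k = _\<close> show "k \<in> (\<lambda>k. k + unitv i) ` Admit i" by (rule image_eqI)
  next
    fix k assume "k \<in> (\<lambda>k. k + unitv i) ` Admit i"
    then show "k \<in> {k \<in> K. k i \<noteq> 0}" using AdmitD(2) by (auto simp: unitv_def)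
  qed
  also have "\<dots> = (\<Sum>k\<in>Admit i. f (k + unitv i))"
    by (subst sum.reindex) (auto intro: inj_onI)
  finally show ?thesis .
qed

lemma sum_K_weight:
  "(\<Sum>k\<in>K. real (k i) * f k) = (\<Sum>k\<in>Admit i. real (k i + 1) * f (k + unitv i))"
proof -
  have "(\<Sum>k\<in>K. real (k i) * f k) = (\<Sum>k\<in>K. if k i = 0 then 0 else real (k i) * f k)"
    by (intro sum.cong) auto
  also have "\<dots> = (\<Sum>k\<in>Admit i. real (k i + 1) * f (k + unitv i))"
    unfolding sum_K_reindex by (simp add: unitv_def)
  finally show ?thesis .
qed

end

context packing_eq
begin

text \<open>Here \<open>y\<close> stands for the counts relative to equilibrium.  Small edge imbalances make \<open>y k\<close> close to
  \<open>exp (\<theta> \<cdot> k)\<close>, by induction along the edges; pairing the load equations with \<open>\<theta>\<close> then bounds the positive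
  quantity \<open>\<Sum> x\<^sub>k (\<theta> \<cdot> k) (exp (\<theta> \<cdot> k) - 1)\<close>, and hence \<open>\<theta>\<close>.\<close>

lemma fluid_gap:
  assumes B: "1 \<le> B"
  obtains C where "0 < C"
    "\<And>y \<theta> \<zeta> h S. (\<And>i. \<bar>\<theta> i\<bar> \<le> B) \<Longrightarrow> 0 \<le> h \<Longrightarrow>
      (\<And>i. \<bar>(\<Sum>k\<in>K. real (k i) * (xst k * (y k - 1))) - \<zeta> i\<bar> \<le> B * h) \<Longrightarrow>
      \<bar>y 0 - 1\<bar> \<le> B * ((\<Sum>i\<in>UNIV. \<bar>\<zeta> i\<bar>) + h) \<Longrightarrow>
      S = (\<Sum>i\<in>UNIV. \<bar>\<zeta> i\<bar>) + (\<Sum>i\<in>UNIV. \<Sum>k\<in>Admit i. \<bar>exp (\<theta> i) * y k - y (k + unitv i)\<bar>) + h \<Longrightarrow>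
      (\<forall>k\<in>Kb. \<bar>y k - 1\<bar> \<le> C * S) \<and> (\<forall>i. \<bar>\<theta> i\<bar> \<le> C * S)"
proof -
  define M where "M = (\<Sum>k\<in>Kb. \<Sum>i\<in>UNIV. k i)"
  have M: "(\<Sum>i\<in>UNIV. k i) \<le> M" if "k \<in> Kb" for k
    unfolding M_def using that by (intro member_le_sum) auto
  \<comment> \<open>A path from 0 has at most \<open>M\<close> edges. Each multiplies the error by
    at most \<open>exp B\<close> and adds at most \<open>S\<close>; the factor
    \<open>exp B + 1\<close> covers both. The prefactor \<open>B + 1\<close> is the error at
    0.\<close>
  define C1 where "C1 = (B + 1) * (exp B + 1) ^ M"
  define c where "c = Min (range (\<lambda>i. xst (unitv i))) * exp (- B)"
  \<comment> \<open>\<open>1 + B\<close> comes from the load equations, the remaining term from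
    replacing \<open>y k\<close> by \<open>exp (\<theta> \<cdot> k)\<close>.\<close>
  define C2 where "C2 = 1 + B + real M * (\<Sum>k\<in>K. xst k) * C1"
  define N where "N = real CARD('i)"
  define C3 where "C3 = C2 * N / c"
  define C where "C = C1 + C3 + real M * C3 * exp (real M * N * B)"
  have N: "0 < N" by (simp add: N_def)
  have c: "0 < c" unfolding c_def using xst_pos by (intro mult_pos_pos) (auto simp: Min_gr_iff)
  have C1: "0 < C1" using B by (simp add: C1_def add_pos_pos)
  have sx: "0 \<le> (\<Sum>k\<in>K. xst k)" using xst_pos by (intro sum_nonneg) (auto simp: less_imp_le)
  have C2: "0 < C2" using B sx C1 by (simp add: C2_def add_pos_nonneg)
  have C3: "0 < C3" using C2 N c by (simp add: C3_def)
  have C: "0 < C" using C1 C3 by (simp add: C_def add_pos_nonneg)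
  show thesis
  proof (rule that[OF C])
    fix y :: "('i \<Rightarrow> nat) \<Rightarrow> real" and \<theta> \<zeta> :: "'i \<Rightarrow> real" and h S :: real
    assume th: "\<And>i. \<bar>\<theta> i\<bar> \<le> B" and h: "0 \<le> h"
      and z: "\<And>i. \<bar>(\<Sum>k\<in>K. real (k i) * (xst k * (y k - 1))) - \<zeta> i\<bar> \<le> B * h"
      and y0: "\<bar>y 0 - 1\<bar> \<le> B * ((\<Sum>i\<in>UNIV. \<bar>\<zeta> i\<bar>) + h)"
      and S: "S = (\<Sum>i\<in>UNIV. \<bar>\<zeta> i\<bar>) + (\<Sum>i\<in>UNIV. \<Sum>k\<in>Admit i. \<bar>exp (\<theta> i) * y k - y (k + unitv i)\<bar>) + h"
    define D where "D = (\<Sum>i\<in>UNIV. \<Sum>k\<in>Admit i. \<bar>exp (\<theta> i) * y k - y (k + unitv i)\<bar>)"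
    define Zs where "Zs = (\<Sum>i\<in>UNIV. \<bar>\<zeta> i\<bar>)"
    have nn: "0 \<le> Zs" "0 \<le> D" by (auto simp: Zs_def D_def intro!: sum_nonneg)
    have SD: "S = Zs + D + h" by (simp add: S Zs_def D_def)
    have S0: "0 \<le> S" "Zs \<le> S" "D \<le> S" "h \<le> S" using nn h by (auto simp: SD)
    have d: "\<bar>exp (\<theta> i) * y k - y (k + unitv i)\<bar> \<le> S" if "k \<in> Admit i" for i k
    proof -
      have "\<bar>exp (\<theta> i) * y k - y (k + unitv i)\<bar> \<le> (\<Sum>k\<in>Admit i. \<bar>exp (\<theta> i) * y k - y (k + unitv i)\<bar>)"
        using that by (intro member_le_sum) auto
      also have "\<dots> \<le> D"
        unfolding D_def by (rule member_le_sum[of i UNIV "\<lambda>i. \<Sum>k\<in>Admit i. \<bar>exp (\<theta> i) * y k - y (k + unitv i)\<bar>"]) (auto intro: sum_nonneg)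
      finally show ?thesis using S0 by simp
    qed
    define e where "e k = exp (\<Sum>i\<in>UNIV. \<theta> i * real (k i))" for k
    have step1: "\<bar>y k - e k\<bar> \<le> C1 * S" if k: "k \<in> Kb" for k
    proof -
      have "\<bar>y k - e k\<bar> \<le> (B + 1) * (exp B + 1) ^ (\<Sum>i\<in>UNIV. k i) * S"
        using k
      proof (induction rule: config_induct)
        case (down k k')
        then show ?case by (rule Kb_down)
      next
        case zero
        have "B * (Zs + h) \<le> B * S" using nn B by (intro mult_left_mono) (auto simp: SD)
        then have "\<bar>y 0 - 1\<bar> \<le> B * S" using y0[folded Zs_def] by linarith
        also have "\<dots> \<le> (B + 1) * S" using S0 by (intro mult_right_mono) auto
        finally have *: "\<bar>y 0 - 1\<bar> \<le> (B + 1) * S" .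
        have "(\<Sum>i\<in>UNIV. (0 :: 'i \<Rightarrow> nat) i) = 0" "e 0 = 1" by (simp_all add: e_def)
        with * show ?case by (simp only: power_0 mult_1_right)
      next
        case (add k i)
        define n where "n = (\<Sum>i\<in>UNIV. k i)"
        have n: "(\<Sum>j\<in>UNIV. (k + unitv i) j) = Suc n"
          by (simp add: n_def sum.distrib) (simp add: unitv_def)
        have "(\<Sum>j\<in>UNIV. \<theta> j * real ((k + unitv i) j)) = (\<Sum>j\<in>UNIV. \<theta> j * real (k j)) + \<theta> i"
          using sum_unitv[of i \<theta>] by (simp add: algebra_simps sum.distrib)
        then have e: "e (k + unitv i) = exp (\<theta> i) * e k"
          by (simp add: e_def exp_add)
        have p1: "1 \<le> (B + 1) * (exp B + 1) ^ n"
          using B by (intro mult_ge1_I one_le_power) auto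
        have "\<bar>y (k + unitv i) - e (k + unitv i)\<bar> \<le> \<bar>exp (\<theta> i) * y k - y (k + unitv i)\<bar> + exp (\<theta> i) * \<bar>y k - e k\<bar>"
        proof -
          have "y (k + unitv i) - e (k + unitv i) = - (exp (\<theta> i) * y k - y (k + unitv i)) + exp (\<theta> i) * (y k - e k)"
            by (simp add: e algebra_simps)
          also have "\<bar>\<dots>\<bar> \<le> \<bar>exp (\<theta> i) * y k - y (k + unitv i)\<bar> + \<bar>exp (\<theta> i) * (y k - e k)\<bar>" by linarith
          finally show ?thesis unfolding abs_mult abs_exp_cancel .
        qed
        also have "\<dots> \<le> S + exp B * ((B + 1) * (exp B + 1) ^ n * S)"
          using d[of k i] add th[of i] S0 B by (intro add_mono mult_mono) (auto simp: Admit_def n_def abs_le_iff)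
        also have "\<dots> \<le> ((B + 1) * (exp B + 1) ^ n) * S + exp B * ((B + 1) * (exp B + 1) ^ n * S)"
          using p1 S0 mult_right_mono[OF p1, of S] by simp
        also have "\<dots> = (B + 1) * (exp B + 1) ^ Suc n * S" by (simp add: algebra_simps)
        finally show ?case unfolding n .
      qed
      also have "\<dots> \<le> C1 * S"
        unfolding C1_def using M[OF k] B S0 by (intro mult_right_mono mult_left_mono power_increasing) auto
      finally show ?thesis .
    qed
    define T where "T = (\<Sum>i\<in>UNIV. \<bar>\<theta> i\<bar>)"
    have T: "0 \<le> T" "\<bar>\<theta> i\<bar> \<le> T" for i by (auto simp: T_def intro!: sum_nonneg member_le_sum)
    have TN: "T \<le> N * B" unfolding T_def N_def using sum_bounded_above[of UNIV "\<lambda>i. \<bar>\<theta> i\<bar>" B] th by simp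
    have thk: "\<bar>\<Sum>i\<in>UNIV. \<theta> i * real (k i)\<bar> \<le> T * real M" if k: "k \<in> Kb" for k
    proof -
      have "\<bar>\<Sum>i\<in>UNIV. \<theta> i * real (k i)\<bar> \<le> (\<Sum>i\<in>UNIV. T * real (k i))"
        using T by (intro order_trans[OF sum_abs] sum_mono) (auto simp: abs_mult intro!: mult_right_mono)
      also have "\<dots> = T * real (\<Sum>i\<in>UNIV. k i)" by (simp add: sum_distrib_left)
      also have "\<dots> \<le> T * real M" using M[OF k] T(1) by (intro mult_left_mono of_nat_mono)
      finally show ?thesis .
    qed
    define t where "t k = (\<Sum>i\<in>UNIV. \<theta> i * real (k i))" for k
    have ek: "e k = exp (t k)" for k by (simp add: e_def t_def)
    have sum1: "(\<Sum>i\<in>UNIV. \<theta> i * (\<Sum>k\<in>K. real (k i) * (xst k * (y k - 1)))) = (\<Sum>k\<in>K. xst k * t k * (y k - 1))"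
    proof -
      have "(\<Sum>i\<in>UNIV. \<theta> i * (\<Sum>k\<in>K. real (k i) * (xst k * (y k - 1)))) = (\<Sum>k\<in>K. \<Sum>i\<in>UNIV. \<theta> i * (real (k i) * (xst k * (y k - 1))))"
        unfolding sum_distrib_left by (rule sum.swap)
      also have "\<dots> = (\<Sum>k\<in>K. xst k * t k * (y k - 1))"
        unfolding t_def sum_distrib_left sum_distrib_right by (intro sum.cong) (auto simp: algebra_simps)
      finally show ?thesis .
    qed
    have up: "(\<Sum>i\<in>UNIV. \<theta> i * (\<Sum>k\<in>K. real (k i) * (xst k * (y k - 1)))) \<le> T * ((1 + B) * S)"
    proof -
      have "(\<Sum>i\<in>UNIV. \<theta> i * (\<Sum>k\<in>K. real (k i) * (xst k * (y k - 1)))) \<le> (\<Sum>i\<in>UNIV. \<bar>\<theta> i\<bar> * ((1 + B) * S))"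
      proof (rule sum_mono)
        fix i
        let ?x = "(\<Sum>k\<in>K. real (k i) * (xst k * (y k - 1)))"
        have "\<bar>\<zeta> i\<bar> \<le> Zs" unfolding Zs_def by (rule member_le_sum) auto
        then have "\<bar>?x\<bar> \<le> S + B * h" using z[of i] S0 by linarith
        also have "\<dots> \<le> (1 + B) * S" using S0 B mult_left_mono[of h S B] by (simp add: algebra_simps)
        finally have "\<bar>\<theta> i\<bar> * \<bar>?x\<bar> \<le> \<bar>\<theta> i\<bar> * ((1 + B) * S)" by (intro mult_left_mono) auto
        moreover have "\<theta> i * ?x \<le> \<bar>\<theta> i\<bar> * \<bar>?x\<bar>" unfolding abs_mult[symmetric] by (rule abs_ge_self)
        ultimately show "\<theta> i * ?x \<le> \<bar>\<theta> i\<bar> * ((1 + B) * S)" by linarith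
      qed
      then show ?thesis by (simp add: T_def sum_distrib_right)
    qed
    have low: "(\<Sum>k\<in>K. xst k * t k * (exp (t k) - 1)) - T * (real M * (\<Sum>k\<in>K. xst k) * C1 * S) \<le> (\<Sum>k\<in>K. xst k * t k * (y k - 1))"
    proof -
      have "xst k * t k * (exp (t k) - 1) - xst k * (T * real M * (C1 * S)) \<le> xst k * t k * (y k - 1)" if "k \<in> K" for k
      proof -
        have kb: "k \<in> Kb" using that by (simp add: Kset_def)
        have "\<bar>t k * (y k - exp (t k))\<bar> \<le> T * real M * (C1 * S)"
          unfolding abs_mult using thk[OF kb] step1[OF kb] T by (intro mult_mono) (auto simp: t_def ek[unfolded t_def])
        then have "xst k * (- (T * real M * (C1 * S))) \<le> xst k * (t k * (y k - exp (t k)))"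
          using xst_pos[of k] by (intro mult_left_mono) auto
        then show ?thesis by (simp add: algebra_simps)
      qed
      then have "(\<Sum>k\<in>K. xst k * t k * (exp (t k) - 1) - xst k * (T * real M * (C1 * S))) \<le> (\<Sum>k\<in>K. xst k * t k * (y k - 1))"
        by (rule sum_mono)
      moreover have "(\<Sum>k\<in>K. xst k * (T * real M * (C1 * S))) = T * (real M * (\<Sum>k\<in>K. xst k) * C1 * S)"
        unfolding sum_distrib_right[symmetric] by (simp add: ac_simps)
      ultimately show ?thesis unfolding sum_subtractf by simp
    qed
    \<comment> \<open>The numbers \<open>t k\<close> and \<open>exp (t k) - 1\<close> have equal
      signs, so all summands are nonnegative and the unit configurations, where \<open>t k\<close>
      is a single coordinate of \<open>\<theta>\<close>, may be kept alone.\<close>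
    have quad: "c * (\<Sum>i\<in>UNIV. (\<theta> i)\<^sup>2) \<le> (\<Sum>k\<in>K. xst k * t k * (exp (t k) - 1))"
    proof -
      have "c * (\<Sum>i\<in>UNIV. (\<theta> i)\<^sup>2) \<le> (\<Sum>i\<in>UNIV. xst (unitv i) * (\<theta> i * (exp (\<theta> i) - 1)))"
        unfolding sum_distrib_left
      proof (rule sum_mono)
        fix i
        have "c * (\<theta> i)\<^sup>2 \<le> xst (unitv i) * (exp (- B) * (\<theta> i)\<^sup>2)"
          unfolding c_def mult.assoc by (intro mult_right_mono) auto
        also have "\<dots> \<le> xst (unitv i) * (\<theta> i * (exp (\<theta> i) - 1))"
          using xst_pos th by (intro mult_left_mono mult_expm1_ge) (auto simp: less_imp_le)
        finally show "c * (\<theta> i)\<^sup>2 \<le> xst (unitv i) * (\<theta> i * (exp (\<theta> i) - 1))" .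
      qed
      also have "\<dots> = (\<Sum>k\<in>range unitv. xst k * t k * (exp (t k) - 1))"
        using sum_unitv[of _ \<theta>] by (subst sum.reindex[OF unitv_inj]) (simp add: t_def mult.commute[of "\<theta> _"] mult.assoc)
      also have "\<dots> \<le> (\<Sum>k\<in>K. xst k * t k * (exp (t k) - 1))"
      proof (rule sum_mono2)
        fix k
        have "0 \<le> t k * (exp (t k) - 1)" using mult_expm1_ge[of "t k" "\<bar>t k\<bar>"]
          by (metis exp_ge_zero mult_nonneg_nonneg order.refl order.trans zero_le_power2)
        then show "0 \<le> xst k * t k * (exp (t k) - 1)" using xst_pos[of k] by (simp add: mult.assoc)
      qed auto
      finally show ?thesis .
    qed
    have "T * T \<le> N * (\<Sum>i\<in>UNIV. (\<theta> i)\<^sup>2)"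
      using sum_squared_le_sum_of_squares[of "\<lambda>i. \<bar>\<theta> i\<bar>" UNIV] by (simp add: T_def N_def power2_eq_square mult.commute)
    then have "c * (T * T) \<le> N * (c * (\<Sum>i\<in>UNIV. (\<theta> i)\<^sup>2))"
      using c mult_left_mono[of "T * T" "N * (\<Sum>i\<in>UNIV. (\<theta> i)\<^sup>2)" c] by (simp add: algebra_simps)
    also have "\<dots> \<le> N * (T * (C2 * S))"
    proof -
      have "c * (\<Sum>i\<in>UNIV. (\<theta> i)\<^sup>2) \<le> T * ((1 + B) * S) + T * (real M * (\<Sum>k\<in>K. xst k) * C1 * S)"
        using quad low up sum1 by linarith
      also have "\<dots> = T * (C2 * S)" by (simp add: C2_def algebra_simps)
      finally show ?thesis using N by (intro mult_left_mono) auto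
    qed
    \<comment> \<open>The left side is quadratic in \<open>T\<close> and the right side linear;
      cancelling one factor bounds \<open>\<theta>\<close> linearly by \<open>S\<close>.\<close>
    finally have "T * (c * T) \<le> T * (N * C2 * S)" by (simp add: algebra_simps)
    then have "c * T \<le> N * C2 * S"
      using T(1) C2 N S0 by (cases "T = 0") auto
    then have TS: "T \<le> C3 * S"
      using c by (simp add: C3_def field_simps)
    have C3C: "C3 * S \<le> C * S" unfolding C_def using S0 C1 C3 by (intro mult_right_mono) auto
    have "\<bar>y k - 1\<bar> \<le> C * S" if k: "k \<in> Kb" for k
    proof -
      have "\<bar>e k - 1\<bar> \<le> \<bar>t k\<bar> * exp \<bar>t k\<bar>" unfolding ek by (rule abs_expm1_le)
      also have "\<dots> \<le> (C3 * S * real M) * exp (real M * N * B)"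
      proof (intro mult_mono)
        show "\<bar>t k\<bar> \<le> C3 * S * real M" using thk[OF k] TS mult_right_mono[OF TS, of "real M"] by (simp add: t_def)
        have "T * real M \<le> N * B * real M" using TN by (intro mult_right_mono) auto
        then show "exp \<bar>t k\<bar> \<le> exp (real M * N * B)" using thk[OF k] by (simp add: t_def algebra_simps)
      qed (use C3 S0 in auto)
      finally have "\<bar>y k - 1\<bar> \<le> C1 * S + (C3 * S * real M) * exp (real M * N * B)"
        using step1[OF k] by linarith
      also have "\<dots> \<le> C * S" unfolding C_def using C3 S0 by (simp add: algebra_simps)
      finally show ?thesis .
    qed
    moreover have "\<bar>\<theta> i\<bar> \<le> C * S" for i
      using T(2)[of i] TS C3C by linarith
    ultimately show "(\<forall>k\<in>Kb. \<bar>y k - 1\<bar> \<le> C * S) \<and> (\<forall>i. \<bar>\<theta> i\<bar> \<le> C * S)" by blast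
  qed
qed


subsection \<open>Drift of the Lyapunov function\<close>

definition type_load :: "(('i \<Rightarrow> nat) \<Rightarrow> nat) \<Rightarrow> 'i \<Rightarrow> nat" where
  "type_load X i = (\<Sum>k\<in>K. k i * X k)"

text \<open>The summand at 0 is the artificial number of empty servers, so this is the denominator
  of the placement probabilities; see \<open>Xi_counts\<close>.\<close>

definition admit_count :: "(('i \<Rightarrow> nat) \<Rightarrow> nat) \<Rightarrow> 'i \<Rightarrow> nat" where
  "admit_count X i = (\<Sum>k\<in>Admit i. X k)"

definition load_dev :: "real \<Rightarrow> (('i \<Rightarrow> nat) \<Rightarrow> nat) \<Rightarrow> 'i \<Rightarrow> real" where
  "load_dev r X i = real (type_load X i) / r - rho i"

text \<open>The arrival rate at one candidate server. It is the same for all admissible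
  configurations, which gives the flows their product structure.\<close>

definition up_rate :: "real \<Rightarrow> (('i \<Rightarrow> nat) \<Rightarrow> nat) \<Rightarrow> 'i \<Rightarrow> real" where
  "up_rate r X i = lam i * r / real (admit_count X i)"

definition down_rate :: "'i \<Rightarrow> ('i \<Rightarrow> nat) \<Rightarrow> real" where
  "down_rate i k = mu i * real (k i + 1)"

text \<open>In equilibrium the arrival rate at a server is \<open>mu i * exp (\<nu> i)\<close>, which makes \<open>tilt\<close> vanish.\<close>

definition tilt :: "real \<Rightarrow> (('i \<Rightarrow> nat) \<Rightarrow> nat) \<Rightarrow> 'i \<Rightarrow> real" where
  "tilt r X i = ln (up_rate r X i) - ln (mu i) - \<nu> i"

text \<open>The shift by one keeps logarithms finite, and \<open>X k + 1\<close> is the count after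
  a server has been added, where the entropy increment is evaluated.\<close>

definition rel_count :: "real \<Rightarrow> (('i \<Rightarrow> nat) \<Rightarrow> nat) \<Rightarrow> ('i \<Rightarrow> nat) \<Rightarrow> real" where
  "rel_count r X k = (real (X k) + 1) / (r * xst k)"

text \<open>The increment of the entropy when the number of servers in configuration \<open>k\<close> grows to \<open>x\<close>.
  Empty servers carry no entropy, so that with \<open>phi r 0 = 0\<close> the edges at \<open>0\<close> need no special treatment.\<close>

definition phi :: "real \<Rightarrow> ('i \<Rightarrow> nat) \<Rightarrow> real \<Rightarrow> real" where
  "phi r k x = (if k = 0 then 0 else ln (x / (r * xst k)))"

definition up_flow :: "real \<Rightarrow> (('i \<Rightarrow> nat) \<Rightarrow> nat) \<Rightarrow> 'i \<Rightarrow> ('i \<Rightarrow> nat) \<Rightarrow> real" where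
  "up_flow r X i k = up_rate r X i * (real (X k) + 1)"

definition down_flow :: "(('i \<Rightarrow> nat) \<Rightarrow> nat) \<Rightarrow> 'i \<Rightarrow> ('i \<Rightarrow> nat) \<Rightarrow> real" where
  "down_flow X i k = down_rate i k * (real (X (k + unitv i)) + 1)"

definition load_dev_sum :: "real \<Rightarrow> (('i \<Rightarrow> nat) \<Rightarrow> nat) \<Rightarrow> real" where
  "load_dev_sum r X = (\<Sum>i\<in>UNIV. \<bar>load_dev r X i\<bar>)"

text \<open>The bounds on the single types add up to a total deviation of at most 1/2, so the number
  of customers is between \<open>r / 2\<close> and \<open>3 / 2 * r\<close>. The condition
  \<open>exp 1 \<le> r\<close> gives \<open>ln r \<ge> 1\<close>, so that constants can be absorbed
  into \<open>ln r\<close>.\<close>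

definition region :: "real \<Rightarrow> (('i \<Rightarrow> nat) \<Rightarrow> nat) \<Rightarrow> bool" where
  "region r X \<longleftrightarrow> exp 1 \<le> r \<and> X 0 = nat \<lceil>a * real (\<Sum>i\<in>UNIV. type_load X i)\<rceil> \<and>
     (\<forall>i. \<bar>load_dev r X i\<bar> \<le> 1 / (2 * real CARD('i)))"

lemma down_rate_xst: "down_rate i k * xst (k + unitv i) = mu i * exp (\<nu> i) * xst k"
  using xst_add_unitv[of k i] by (simp add: down_rate_def mult.assoc)

lemma down_rate_pos: "0 < down_rate i k"
  using mu_pos[of i] by (simp add: down_rate_def)

lemma sum_rho: "(\<Sum>i\<in>UNIV. rho i) = 1" by (rule load)

text \<open>All scales follow from the loads: an occupied server holds at least one customer, so no
  count exceeds the number of customers, and \<open>X 0\<close> alone keeps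
  \<open>admit_count\<close> of order \<open>r\<close>.\<close>

lemma region_bounds:
  assumes "region r X"
  shows "1 < r" "1 \<le> ln r"
    and "real (\<Sum>i\<in>UNIV. type_load X i) = r * (1 + (\<Sum>i\<in>UNIV. load_dev r X i))"
    and "r / 2 \<le> real (\<Sum>i\<in>UNIV. type_load X i)" "real (\<Sum>i\<in>UNIV. type_load X i) \<le> 3 / 2 * r"
    and "a * real (\<Sum>i\<in>UNIV. type_load X i) \<le> real (X 0)" "real (X 0) \<le> a * real (\<Sum>i\<in>UNIV. type_load X i) + 1"
    and "\<And>k. k \<in> Kb \<Longrightarrow> real (X k) + 1 \<le> (2 * a + 3) * r"
    and "\<And>i. a / 2 * r \<le> real (admit_count X i)" "\<And>i. real (admit_count X i) \<le> real (card Kb) * (2 * a + 3) * r"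
proof -
  define Z where "Z = real (\<Sum>i\<in>UNIV. type_load X i)"
  have "exp 1 > (1::real)" by simp
  then show r: "1 < r" using assms unfolding region_def by linarith
  show "1 \<le> ln r" using assms r by (simp add: region_def ln_ge_iff)
  have Zi: "real (type_load X i) = r * (load_dev r X i + rho i)" for i
    using r by (simp add: load_dev_def)
  have "Z = (\<Sum>i\<in>UNIV. r * (load_dev r X i + rho i))"
    unfolding Z_def of_nat_sum Zi ..
  also have "\<dots> = r * ((\<Sum>i\<in>UNIV. load_dev r X i) + 1)"
    unfolding sum_distrib_left[symmetric] sum.distrib sum_rho ..
  finally show Z: "real (\<Sum>i\<in>UNIV. type_load X i) = r * (1 + (\<Sum>i\<in>UNIV. load_dev r X i))"
    by (simp add: Z_def add.commute)
  have "\<bar>\<Sum>i\<in>UNIV. load_dev r X i\<bar> \<le> (\<Sum>i\<in>(UNIV::'i set). 1 / (2 * real CARD('i)))"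
    using assms by (intro order_trans[OF sum_abs] sum_mono) (auto simp: region_def)
  also have "\<dots> = 1 / 2" by simp
  finally have half: "\<bar>\<Sum>i\<in>UNIV. load_dev r X i\<bar> \<le> 1 / 2" .
  have "r * (1 / 2) \<le> r * (1 + (\<Sum>i\<in>UNIV. load_dev r X i))" "r * (1 + (\<Sum>i\<in>UNIV. load_dev r X i)) \<le> r * (3 / 2)"
    using half r by (intro mult_left_mono; linarith)+
  then show Zl: "r / 2 \<le> real (\<Sum>i\<in>UNIV. type_load X i)" and Zu: "real (\<Sum>i\<in>UNIV. type_load X i) \<le> 3 / 2 * r"
    unfolding Z by auto
  have X0: "X 0 = nat \<lceil>a * real (\<Sum>i\<in>UNIV. type_load X i)\<rceil>" using assms by (simp add: region_def)
  show x0: "a * real (\<Sum>i\<in>UNIV. type_load X i) \<le> real (X 0)"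
    unfolding X0 by (rule real_nat_ceiling_ge)
  have "0 \<le> a * real (\<Sum>i\<in>UNIV. type_load X i)" by (rule mult_nonneg_nonneg[OF less_imp_le[OF a_pos] of_nat_0_le_iff])
  then show x0': "real (X 0) \<le> a * real (\<Sum>i\<in>UNIV. type_load X i) + 1"
    unfolding X0 by linarith
  show Xk: "real (X k) + 1 \<le> (2 * a + 3) * r" if "k \<in> Kb" for k
  proof (cases "k = 0")
    case True
    have "a * real (\<Sum>i\<in>UNIV. type_load X i) \<le> a * (3 / 2 * r)" using Zu a_pos by (intro mult_left_mono) auto
    moreover have "0 \<le> a * r" using a_pos r by simp
    ultimately show ?thesis unfolding True using x0' r by (simp add: distrib_right)
  next
    case False
    then have k: "k \<in> K" using that by (simp add: Kset_def)
    from False obtain i where i: "k i \<noteq> 0" by (auto simp: fun_eq_iff)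
    have "X k \<le> k i * X k" using i by simp
    also have "\<dots> \<le> type_load X i" unfolding type_load_def by (rule member_le_sum[OF k]) auto
    also have "\<dots> \<le> (\<Sum>i\<in>UNIV. type_load X i)" by (rule member_le_sum) auto
    finally have "real (X k) \<le> real (\<Sum>i\<in>UNIV. type_load X i)" by (rule of_nat_mono)
    moreover have "0 \<le> a * r" using a_pos r by simp
    ultimately show ?thesis using Zu r by (simp add: distrib_right)
  qed
  show "a / 2 * r \<le> real (admit_count X i)" for i
  proof -
    have "a / 2 * r \<le> a * real (\<Sum>i\<in>UNIV. type_load X i)" using mult_left_mono[OF Zl, of a] a_pos by simp
    also have "\<dots> \<le> real (X 0)" by (rule x0)
    also have "X 0 \<le> admit_count X i" unfolding admit_count_def by (rule member_le_sum[OF zero_in_Admit]) auto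
    finally show ?thesis by simp
  qed
  show "real (admit_count X i) \<le> real (card Kb) * (2 * a + 3) * r" for i
  proof -
    have "real (admit_count X i) \<le> (\<Sum>k\<in>Kb. real (X k))"
      unfolding admit_count_def of_nat_sum by (rule sum_mono2) (auto dest: AdmitD)
    also have "\<dots> \<le> real (card Kb) * ((2 * a + 3) * r)"
      using Xk by (intro sum_bounded_above) (smt (verit))
    finally show ?thesis by (simp add: mult.assoc)
  qed
qed

text \<open>The upper bound is due to the artificial empty servers, of which there are at least
  \<open>a / 2 * r\<close>; the lower bound to the finiteness of \<open>Kb\<close>.\<close>

lemma up_rate_bounds:
  obtains B where "1 \<le> B" "\<And>r X i. region r X \<Longrightarrow> up_rate r X i \<le> B" "\<And>r X i. region r X \<Longrightarrow> 1 / B \<le> up_rate r X i"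
proof -
  define B1 where "B1 = (\<Sum>i\<in>UNIV. 2 * lam i / a)"
  define B2 where "B2 = (\<Sum>i\<in>UNIV. real (card Kb) * (2 * a + 3) / lam i)"
  have nn: "0 \<le> 2 * lam i / a" "0 \<le> real (card Kb) * (2 * a + 3) / lam i" for i
    using lam_pos[of i] a_pos by auto
  have B12: "0 \<le> B1" "0 \<le> B2" unfolding B1_def B2_def using nn by (auto intro!: sum_nonneg)
  show thesis
  proof (rule that[of "1 + B1 + B2"])
    show "1 \<le> 1 + B1 + B2" using B12 by simp
    fix r X i assume reg: "region r X"
    note b = region_bounds[OF reg]
    have XIpos: "0 < real (admit_count X i)" using b(9)[of i] b(1) a_pos mult_pos_pos[of "a / 2" r] by linarith
    have "up_rate r X i \<le> 2 * lam i / a"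
    proof -
      have "lam i * r * a \<le> 2 * lam i * real (admit_count X i)"
        using mult_left_mono[OF b(9)[of i], of "2 * lam i"] lam_pos[of i] by (simp add: algebra_simps)
      then show ?thesis unfolding up_rate_def using XIpos a_pos by (simp add: field_simps)
    qed
    also have "\<dots> \<le> B1" unfolding B1_def using nn by (intro member_le_sum) auto
    finally show "up_rate r X i \<le> 1 + B1 + B2" using B12 by simp
    have "1 / up_rate r X i = real (admit_count X i) / (lam i * r)" by (simp add: up_rate_def)
    also have "\<dots> \<le> real (card Kb) * (2 * a + 3) / lam i"
      using b(10)[of i] b(1) lam_pos[of i] by (simp add: field_simps)
    also have "\<dots> \<le> B2" unfolding B2_def using nn by (intro member_le_sum) auto
    finally have "1 / up_rate r X i \<le> 1 + B1 + B2" using B12 by simp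
    moreover have "0 < up_rate r X i" using XIpos b(1) lam_pos[of i] by (simp add: up_rate_def)
    ultimately show "1 / (1 + B1 + B2) \<le> up_rate r X i" using B12 by (simp add: field_simps)
  qed
qed

lemma up_rate_pos: "region r X \<Longrightarrow> 0 < up_rate r X i"
  using up_rate_bounds by (metis less_le_trans zero_less_divide_1_iff zero_less_one)

lemma up_rate_admit_count: "region r X \<Longrightarrow> up_rate r X i * real (admit_count X i) = lam i * r"
  using up_rate_pos[of r X i] by (auto simp: up_rate_def)

text \<open>A positive count may be as small as 1 while its equilibrium value is of order
  \<open>r\<close>; this is the origin of the scale \<open>ln r\<close>.\<close>

lemma phi_bound:
  obtains B where "1 \<le> B"
    "\<And>r X k x. region r X \<Longrightarrow> k \<in> Kb \<Longrightarrow> 1 \<le> x \<Longrightarrow> x \<le> (2 * a + 3) * r \<Longrightarrow> \<bar>phi r k x\<bar> \<le> B * ln r"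
proof -
  define B where "B = 1 + ln (2 * a + 3) + (\<Sum>k\<in>Kb. \<bar>ln (xst k)\<bar>)"
  have la: "0 \<le> ln (2 * a + 3)" using a_pos by simp
  have sn: "0 \<le> (\<Sum>k\<in>Kb. \<bar>ln (xst k)\<bar>)" by (rule sum_nonneg) auto
  show thesis
  proof (rule that[of B])
    show "1 \<le> B" using la sn by (simp add: B_def)
    fix r X k x
    assume reg: "region r X" and k: "k \<in> Kb" and x: "1 \<le> x" "x \<le> (2 * a + 3) * r"
    note b = region_bounds[OF reg]
    have "\<bar>ln (xst k)\<bar> \<le> (\<Sum>k\<in>Kb. \<bar>ln (xst k)\<bar>)" using k by (intro member_le_sum) auto
    moreover have "0 \<le> ln x" "ln x \<le> ln (2 * a + 3) + ln r"
    proof -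
      show "0 \<le> ln x" using x by simp
      have "ln x \<le> ln ((2 * a + 3) * r)" using x a_pos b(1) by simp
      then show "ln x \<le> ln (2 * a + 3) + ln r" using a_pos b(1) by (simp add: ln_mult)
    qed
    moreover have "ln (x / (r * xst k)) = ln x - ln r - ln (xst k)"
      using x b(1) xst_pos[of k] by (simp add: ln_div ln_mult)
    ultimately have "\<bar>ln (x / (r * xst k))\<bar> \<le> ln r + (B - 1)" using b(2) la unfolding B_def by linarith
    also have "\<dots> \<le> ln r + (B - 1) * ln r" using b(2) \<open>1 \<le> B\<close> mult_left_mono[OF b(2), of "B - 1"] by simp
    also have "\<dots> = B * ln r" by (simp add: algebra_simps)
    finally show "\<bar>phi r k x\<bar> \<le> B * ln r" using \<open>1 \<le> B\<close> b(2) by (auto simp: phi_def)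
  qed
qed

lemma rel_count_pos: "region r X \<Longrightarrow> 0 < rel_count r X k"
  using region_bounds(1)[of r X] xst_pos[of k] by (simp add: rel_count_def)

lemma exp_tilt: "region r X \<Longrightarrow> exp (tilt r X i) = up_rate r X i / (mu i * exp (\<nu> i))"
  using up_rate_pos[of r X i] mu_pos[of i] by (simp add: tilt_def exp_diff)

lemma up_flow_eq:
  assumes "region r X"
  shows "up_flow r X i k = r * (mu i * exp (\<nu> i) * xst k) * (exp (tilt r X i) * rel_count r X k)"
  using region_bounds(1)[OF assms] mu_pos[of i] xst_pos[of k]
  by (simp add: up_flow_def rel_count_def exp_tilt[OF assms])

lemma down_flow_eq:
  assumes "region r X"
  shows "down_flow X i k = r * (mu i * exp (\<nu> i) * xst k) * rel_count r X (k + unitv i)"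
  unfolding down_rate_xst[symmetric] using region_bounds(1)[OF assms] xst_pos[of "k + unitv i"]
  by (simp add: down_flow_def rel_count_def)

lemma up_flow_pos: "region r X \<Longrightarrow> 0 < up_flow r X i k"
  using up_rate_pos by (auto simp: up_flow_def intro!: mult_pos_pos)

lemma down_flow_pos: "0 < down_flow X i k"
  using down_rate_pos by (auto simp: down_flow_def intro!: mult_pos_pos)

text \<open>\<open>X 0\<close> is a function of the number of customers, hence its relative value is
  1 plus the total load deviation up to rounding. It serves as base case for the induction in
  \<open>fluid_gap\<close>.\<close>

lemma rel_count_zero_bound:
  obtains B where "1 \<le> B"
    "\<And>r X. region r X \<Longrightarrow> \<bar>rel_count r X 0 - 1\<bar> \<le> B * (load_dev_sum r X + 1 / r)"
    "\<And>r X. region r X \<Longrightarrow> \<bar>ln (rel_count r X 0)\<bar> \<le> B * (load_dev_sum r X + 1 / r)"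
proof -
  define B where "B = 1 + 2 / a"
  have B: "1 \<le> B" using a_pos by (simp add: B_def)
  have *: "\<bar>rel_count r X 0 - 1\<bar> \<le> B * (load_dev_sum r X + 1 / r)" "1 / 2 \<le> rel_count r X 0" if reg: "region r X" for r X
  proof -
    note b = region_bounds[OF reg]
    define q where "q = (\<Sum>i\<in>UNIV. load_dev r X i)"
    have q: "\<bar>q\<bar> \<le> load_dev_sum r X" unfolding q_def load_dev_sum_def by (rule sum_abs)
    have y: "rel_count r X 0 = (real (X 0) + 1) / (r * a)" by (simp add: rel_count_def)
    have ar: "0 < r * a" using b(1) a_pos by simp
    have lo: "1 + q \<le> rel_count r X 0"
      unfolding y using ar b(6) b(3) by (simp add: pos_le_divide_eq q_def[symmetric] algebra_simps)
    have hi: "rel_count r X 0 \<le> 1 + q + 2 / (r * a)"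
    proof -
      have "real (X 0) + 1 \<le> a * (r * (1 + q)) + 2" using b(7) b(3) by (simp add: q_def[symmetric])
      then have "rel_count r X 0 \<le> (a * (r * (1 + q)) + 2) / (r * a)"
        unfolding y using ar by (intro divide_right_mono) auto
      also have "\<dots> = 1 + q + 2 / (r * a)" using a_pos b(1) by (simp add: field_simps)
      finally show ?thesis .
    qed
    have "\<bar>rel_count r X 0 - 1\<bar> \<le> load_dev_sum r X + 2 / (r * a)"
      using lo hi q ar divide_pos_pos[of 2 "r * a"] by linarith
    also have "\<dots> \<le> B * (load_dev_sum r X + 1 / r)"
    proof -
      have "0 \<le> load_dev_sum r X * (2 / a)" "0 \<le> 1 / r" using q a_pos b(1) by auto
      then show ?thesis by (simp add: B_def algebra_simps)
    qed
    finally show "\<bar>rel_count r X 0 - 1\<bar> \<le> B * (load_dev_sum r X + 1 / r)" .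
    have "r / 2 \<le> r * (1 + q)" using b(3,4) by (simp add: q_def)
    then have "1 / 2 \<le> 1 + q" using b(1) mult_le_cancel_left_pos[of r "1 / 2" "1 + q"] by simp
    then show "1 / 2 \<le> rel_count r X 0" using lo by simp
  qed
  \<comment> \<open>On \<open>[1/2, \<infinity>)\<close> the logarithm is Lipschitz with constant 2,
    and the relative count at 0 stays in this range.\<close>
  have ln_b: "\<bar>ln y\<bar> \<le> 2 * \<bar>y - 1\<bar>" if "1 / 2 \<le> y" for y :: real
  proof -
    have "ln y \<le> y - 1" using that by (intro ln_le_minus_one) auto
    moreover have "- ln y \<le> 1 / y - 1" using that ln_le_minus_one[of "1 / y"] by (simp add: ln_div)
    moreover have "1 / y - 1 \<le> 2 * \<bar>y - 1\<bar>"
    proof -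
      have "1 / y - 1 = (1 - y) * (1 / y)" using that by (simp add: field_simps)
      also have "\<dots> \<le> \<bar>y - 1\<bar> * 2" using that by (intro mult_mono) (auto simp: field_simps)
      finally show ?thesis by simp
    qed
    moreover have "y - 1 \<le> 2 * \<bar>y - 1\<bar>" using abs_ge_self[of "y - 1"] abs_ge_zero[of "y - 1"] by argo
    ultimately show ?thesis by (intro abs_leI) argo+
  qed
  show thesis
  proof (rule that[of "2 * B"])
    show "1 \<le> 2 * B" using B by simp
    fix r X assume reg: "region r X"
    have "0 \<le> B * (load_dev_sum r X + 1 / r)" using *(1)[OF reg] by linarith
    then show "\<bar>rel_count r X 0 - 1\<bar> \<le> 2 * B * (load_dev_sum r X + 1 / r)" using *(1)[OF reg] by linarith
    show "\<bar>ln (rel_count r X 0)\<bar> \<le> 2 * B * (load_dev_sum r X + 1 / r)" 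
      using order_trans[OF ln_b[OF *(2)[OF reg]] mult_left_mono[OF *(1)[OF reg], of 2]] by (simp add: mult.assoc)
  qed
qed

lemma Zi_excess: "(\<Sum>k\<in>Admit i. down_rate i k * real (X (k + unitv i))) = mu i * real (type_load X i)"
  using sum_K_weight[of i "\<lambda>k. real (X k)"]
  by (simp add: down_rate_def type_load_def sum_distrib_left mult.assoc)

text \<open>Summed over the edges of one type, up flows give the arrival rate
  \<open>lam i * r\<close> and down flows the departure rate \<open>mu i\<close> times the load; the
  shifts by one leave bounded errors. So net flow per type is governed by the load
  deviation.\<close>

lemma flow_balance:
  obtains B where "1 \<le> B"
    "\<And>r X i. region r X \<Longrightarrow> \<bar>(\<Sum>k\<in>Admit i. up_flow r X i k - down_flow X i k) + r * mu i * load_dev r X i\<bar> \<le> B"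
    "\<And>r X i. region r X \<Longrightarrow> \<bar>(\<Sum>k\<in>K. real (k i) * (xst k * (rel_count r X k - 1))) - load_dev r X i\<bar> \<le> B * (1 / r)"
proof -
  obtain Bb where Bb: "1 \<le> Bb" "\<And>r X i. region r X \<Longrightarrow> up_rate r X i \<le> Bb" using up_rate_bounds by metis
  define G where "G i = (\<Sum>k\<in>Admit i. down_rate i k)" for i
  define M where "M i = (\<Sum>k\<in>K. real (k i))" for i
  define B where "B = 1 + Bb * real (card Kb) + (\<Sum>i\<in>UNIV. G i) + (\<Sum>i\<in>UNIV. M i)"
  have nn: "0 \<le> G i" "0 \<le> M i" for i
    unfolding G_def M_def using down_rate_pos by (auto intro!: sum_nonneg simp: less_imp_le)
  have le: "G i \<le> (\<Sum>i\<in>UNIV. G i)" "M i \<le> (\<Sum>i\<in>UNIV. M i)" for i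
    using nn by (auto intro!: member_le_sum)
  have nn': "0 \<le> (\<Sum>i\<in>UNIV. G i)" "0 \<le> (\<Sum>i\<in>UNIV. M i)" "0 \<le> Bb * real (card Kb)"
    using nn Bb by (auto intro!: sum_nonneg)
  show thesis
  proof (rule that[of B])
    show "1 \<le> B" using nn' by (simp add: B_def)
    fix r X i assume reg: "region r X"
    note b = region_bounds[OF reg]
    have "(\<Sum>k\<in>Admit i. up_flow r X i k - down_flow X i k) =
        up_rate r X i * real (admit_count X i) + up_rate r X i * real (card (Admit i)) - mu i * real (type_load X i) - G i"
      unfolding up_flow_def down_flow_def sum_subtractf distrib_left sum.distrib Zi_excess G_def
      by (simp add: admit_count_def sum_distrib_left)
    also have "\<dots> = - (r * mu i * load_dev r X i) + (up_rate r X i * real (card (Admit i)) - G i)"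
      unfolding up_rate_admit_count[OF reg] load_dev_def using b(1) mu_pos[of i] by (simp add: field_simps)
    finally have "(\<Sum>k\<in>Admit i. up_flow r X i k - down_flow X i k) + r * mu i * load_dev r X i = up_rate r X i * real (card (Admit i)) - G i"
      by simp
    moreover have "0 \<le> up_rate r X i * real (card (Admit i))" using up_rate_pos[OF reg, of i] by simp
    moreover have "up_rate r X i * real (card (Admit i)) \<le> Bb * real (card Kb)"
      using Bb(1) Bb(2)[OF reg] up_rate_pos[OF reg, of i] by (intro mult_mono) (auto simp: Admit_def intro!: card_mono)
    ultimately show "\<bar>(\<Sum>k\<in>Admit i. up_flow r X i k - down_flow X i k) + r * mu i * load_dev r X i\<bar> \<le> B"
      using nn nn' le(1)[of i] nn(1)[of i] unfolding B_def by linarith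
    have "(\<Sum>k\<in>K. real (k i) * (xst k * (rel_count r X k - 1))) = (\<Sum>k\<in>K. real (k i) * real (X k) / r + real (k i) * (1 / r) - real (k i) * xst k)"
      using b(1) xst_pos by (intro sum.cong refl) (simp add: rel_count_def field_simps less_imp_neq[symmetric])
    also have "\<dots> = real (type_load X i) / r + M i * (1 / r) - rho i"
      unfolding sum_subtractf sum.distrib sum_xst sum_distrib_right[symmetric] M_def
      by (simp add: type_load_def sum_divide_distrib)
    finally have eq: "(\<Sum>k\<in>K. real (k i) * (xst k * (rel_count r X k - 1))) - load_dev r X i = M i * (1 / r)"
      by (simp add: load_dev_def)
    have "0 \<le> M i * (1 / r)" "M i * (1 / r) \<le> B * (1 / r)"
      using nn(2)[of i] b(1) le(2)[of i] nn' by (auto simp: B_def intro!: divide_right_mono)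
    then show "\<bar>(\<Sum>k\<in>K. real (k i) * (xst k * (rel_count r X k - 1))) - load_dev r X i\<bar> \<le> B * (1 / r)"
      unfolding eq by simp
  qed
qed


text \<open>The net flow along the edge divided by its equilibrium flow; see
  \<open>flow_diff\<close>.\<close>

definition imbalance :: "real \<Rightarrow> (('i \<Rightarrow> nat) \<Rightarrow> nat) \<Rightarrow> 'i \<Rightarrow> ('i \<Rightarrow> nat) \<Rightarrow> real" where
  "imbalance r X i k = exp (tilt r X i) * rel_count r X k - rel_count r X (k + unitv i)"

text \<open>The quantity \<open>S\<close> of \<open>fluid_gap\<close> for
  \<open>\<theta> = tilt r X\<close>, \<open>\<zeta> = load_dev r X\<close> and
  \<open>h = 1 / r\<close>.\<close>

definition discrepancy :: "real \<Rightarrow> (('i \<Rightarrow> nat) \<Rightarrow> nat) \<Rightarrow> real" where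
  "discrepancy r X = load_dev_sum r X + (\<Sum>i\<in>UNIV. \<Sum>k\<in>Admit i. \<bar>imbalance r X i k\<bar>) + 1 / r"

definition dissipation :: "real \<Rightarrow> (('i \<Rightarrow> nat) \<Rightarrow> nat) \<Rightarrow> real" where
  "dissipation r X = (\<Sum>i\<in>UNIV. \<Sum>k\<in>Admit i. (up_flow r X i k - down_flow X i k) * (ln (up_flow r X i k) - ln (down_flow X i k)))"

definition load_dev_sq :: "real \<Rightarrow> (('i \<Rightarrow> nat) \<Rightarrow> nat) \<Rightarrow> real" where
  "load_dev_sq r X = (\<Sum>i\<in>UNIV. (load_dev r X i)\<^sup>2)"

definition jump_up :: "real \<Rightarrow> (('i \<Rightarrow> nat) \<Rightarrow> nat) \<Rightarrow> 'i \<Rightarrow> ('i \<Rightarrow> nat) \<Rightarrow> real" where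
  "jump_up r X i k = phi r (k + unitv i) (real (X (k + unitv i)) + 1) - phi r k (real (X k))"

definition jump_down :: "real \<Rightarrow> (('i \<Rightarrow> nat) \<Rightarrow> nat) \<Rightarrow> 'i \<Rightarrow> ('i \<Rightarrow> nat) \<Rightarrow> real" where
  "jump_down r X i k = phi r k (real (X k) + 1) - phi r (k + unitv i) (real (X (k + unitv i)))"

text \<open>With \<open>X + 1\<close> at both ends the same number describes both directions of an
  edge: \<open>jump_up\<close> is this difference and \<open>jump_down\<close> its negative, each up
  to a \<open>succ_log\<close> error.\<close>

definition potential_diff :: "real \<Rightarrow> (('i \<Rightarrow> nat) \<Rightarrow> nat) \<Rightarrow> 'i \<Rightarrow> ('i \<Rightarrow> nat) \<Rightarrow> real" where
  "potential_diff r X i k = phi r (k + unitv i) (real (X (k + unitv i)) + 1) - phi r k (real (X k) + 1)"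

lemma load_dev_sum_nonneg: "0 \<le> load_dev_sum r X" unfolding load_dev_sum_def by (rule sum_nonneg) auto

lemma load_dev_sq_nonneg: "0 \<le> load_dev_sq r X" unfolding load_dev_sq_def by (rule sum_nonneg) auto

lemma load_dev_le_load_dev_sum: "\<bar>load_dev r X i\<bar> \<le> load_dev_sum r X" unfolding load_dev_sum_def by (rule member_le_sum) auto

lemma load_dev_sum_sq: "(load_dev_sum r X)\<^sup>2 \<le> real CARD('i) * load_dev_sq r X"
  using sum_squared_le_sum_of_squares[of "\<lambda>i. \<bar>load_dev r X i\<bar>" UNIV]
  by (simp add: load_dev_sum_def load_dev_sq_def mult.commute)

lemma tilt_bound:
  obtains B where "1 \<le> B" "\<And>r X i. region r X \<Longrightarrow> \<bar>tilt r X i\<bar> \<le> B"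
proof -
  obtain Bb where Bb: "1 \<le> Bb" "\<And>r X i. region r X \<Longrightarrow> up_rate r X i \<le> Bb" "\<And>r X i. region r X \<Longrightarrow> 1 / Bb \<le> up_rate r X i"
    using up_rate_bounds by metis
  define S where "S = (\<Sum>i\<in>UNIV. \<bar>ln (mu i)\<bar> + \<bar>\<nu> i\<bar>)"
  have S: "\<bar>ln (mu i)\<bar> + \<bar>\<nu> i\<bar> \<le> S" for i
    unfolding S_def by (rule member_le_sum[of i UNIV "\<lambda>i. \<bar>ln (mu i)\<bar> + \<bar>\<nu> i\<bar>"]) auto
  have S0: "0 \<le> S" unfolding S_def by (rule sum_nonneg) auto
  have lB: "0 \<le> ln Bb" using Bb by simp
  show thesis
  proof (rule that[of "1 + ln Bb + S"])
    show "1 \<le> 1 + ln Bb + S" using S0 lB by simp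
    fix r X i assume reg: "region r X"
    have pos: "0 < up_rate r X i" by (rule up_rate_pos[OF reg])
    have "ln (up_rate r X i) \<le> ln Bb" using pos Bb(1) Bb(2)[OF reg, of i] by simp
    moreover have "ln (1 / Bb) \<le> ln (up_rate r X i)" using pos Bb(1) Bb(3)[OF reg, of i] by (subst ln_le_cancel_iff) auto
    then have "- ln Bb \<le> ln (up_rate r X i)" using Bb(1) by (simp add: ln_div)
    ultimately show "\<bar>tilt r X i\<bar> \<le> 1 + ln Bb + S"
      using S[of i] unfolding tilt_def by linarith
  qed
qed

text \<open>This is \<open>fluid_gap\<close> applied to the counts. The a priori bound on
  \<open>\<theta>\<close> that it requires is \<open>tilt_bound\<close>.\<close>

lemma equilibrium_gap:
  obtains C where "0 < C"
    "\<And>r X k. region r X \<Longrightarrow> k \<in> Kb \<Longrightarrow> \<bar>rel_count r X k - 1\<bar> \<le> C * discrepancy r X"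
    "\<And>r X i. region r X \<Longrightarrow> \<bar>tilt r X i\<bar> \<le> C * discrepancy r X"
proof -
  obtain B1 where B1: "1 \<le> B1" "\<And>r X i. region r X \<Longrightarrow> \<bar>tilt r X i\<bar> \<le> B1" using tilt_bound by metis
  obtain B2 where B2: "1 \<le> B2" "\<And>r X. region r X \<Longrightarrow> \<bar>rel_count r X 0 - 1\<bar> \<le> B2 * (load_dev_sum r X + 1 / r)" using rel_count_zero_bound by metis
  obtain B3 where B3: "1 \<le> B3"
    "\<And>r X i. region r X \<Longrightarrow> \<bar>(\<Sum>k\<in>Admit i. up_flow r X i k - down_flow X i k) + r * mu i * load_dev r X i\<bar> \<le> B3"
    "\<And>r X i. region r X \<Longrightarrow> \<bar>(\<Sum>k\<in>K. real (k i) * (xst k * (rel_count r X k - 1))) - load_dev r X i\<bar> \<le> B3 * (1 / r)"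
    by (rule flow_balance, rule that)
  define B where "B = B1 + B2 + B3"
  have B: "1 \<le> B" "B1 \<le> B" "B2 \<le> B" "B3 \<le> B" using B1 B2 B3 by (auto simp: B_def)
  show thesis
  proof (rule fluid_gap[OF B(1)], goal_cases)
    case (1 C)
    note C = 1(1) and gapC = 1(2)
    have *: "(\<forall>k\<in>Kb. \<bar>rel_count r X k - 1\<bar> \<le> C * discrepancy r X) \<and> (\<forall>i. \<bar>tilt r X i\<bar> \<le> C * discrepancy r X)" if reg: "region r X" for r X
    proof (rule gapC[where \<zeta> = "load_dev r X" and h = "1 / r"])
      have r: "0 < r" using region_bounds(1)[OF reg] by simp
      then show "0 \<le> 1 / r" by simp
      show "\<bar>tilt r X i\<bar> \<le> B" for i using B1(2)[OF reg, of i] B(2) by linarith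
      have "B3 * (1 / r) \<le> B * (1 / r)" using B r by (intro mult_right_mono) auto
      then show "\<bar>(\<Sum>k\<in>K. real (k i) * (xst k * (rel_count r X k - 1))) - load_dev r X i\<bar> \<le> B * (1 / r)" for i
        using B3(3)[OF reg, of i] by (rule order_trans[rotated])
      have "B2 * (load_dev_sum r X + 1 / r) \<le> B * (load_dev_sum r X + 1 / r)" using B r load_dev_sum_nonneg[of r X] by (intro mult_right_mono add_nonneg_nonneg) auto
      then show "\<bar>rel_count r X 0 - 1\<bar> \<le> B * ((\<Sum>i\<in>UNIV. \<bar>load_dev r X i\<bar>) + 1 / r)"
        unfolding load_dev_sum_def[symmetric] using B2(2)[OF reg] by (rule order_trans[rotated])
      show "discrepancy r X = (\<Sum>i\<in>UNIV. \<bar>load_dev r X i\<bar>) + (\<Sum>i\<in>UNIV. \<Sum>k\<in>Admit i. \<bar>exp (tilt r X i) * rel_count r X k - rel_count r X (k + unitv i)\<bar>) + 1 / r"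
        unfolding discrepancy_def load_dev_sum_def imbalance_def ..
    qed
    show thesis using * by (intro that[OF C]) blast+
  qed
qed

lemma edge_bounds:
  obtains B where "1 \<le> B"
    "\<And>r X i k. region r X \<Longrightarrow> k \<in> Admit i \<Longrightarrow> up_flow r X i k \<le> B * r"
    "\<And>r X i k. region r X \<Longrightarrow> k \<in> Admit i \<Longrightarrow> down_flow X i k \<le> B * r"
    "\<And>r X i k. region r X \<Longrightarrow> k \<in> Admit i \<Longrightarrow> \<bar>ln (up_flow r X i k) - ln (down_flow X i k)\<bar> \<le> B * ln r"
    "\<And>r X i k. region r X \<Longrightarrow> k \<in> Admit i \<Longrightarrow> up_rate r X i + down_rate i k \<le> B"
    "\<And>r X i k. region r X \<Longrightarrow> k \<in> Admit i \<Longrightarrow> \<bar>potential_diff r X i k\<bar> \<le> B * ln r"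
proof -
  obtain Bb where Bb: "1 \<le> Bb" "\<And>r X i. region r X \<Longrightarrow> up_rate r X i \<le> Bb" "\<And>r X i. region r X \<Longrightarrow> 1 / Bb \<le> up_rate r X i"
    using up_rate_bounds by metis
  obtain Bp where Bp: "1 \<le> Bp"
    "\<And>r X k x. region r X \<Longrightarrow> k \<in> Kb \<Longrightarrow> 1 \<le> x \<Longrightarrow> x \<le> (2 * a + 3) * r \<Longrightarrow> \<bar>phi r k x\<bar> \<le> Bp * ln r"
    using phi_bound by metis
  obtain Bt where Bt: "1 \<le> Bt" "\<And>r X i. region r X \<Longrightarrow> \<bar>tilt r X i\<bar> \<le> Bt" using tilt_bound by metis
  obtain B0 where B0: "1 \<le> B0" "\<And>r X. region r X \<Longrightarrow> \<bar>ln (rel_count r X 0)\<bar> \<le> B0 * (load_dev_sum r X + 1 / r)" using rel_count_zero_bound by metis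
  define G where "G = (\<Sum>i\<in>UNIV. \<Sum>k\<in>Admit i. down_rate i k)"
  have gnn: "0 \<le> down_rate i k" for i k using down_rate_pos[of i k] by simp
  have G: "down_rate i k \<le> G" if "k \<in> Admit i" for i k
  proof -
    have "down_rate i k \<le> (\<Sum>k\<in>Admit i. down_rate i k)" using that gnn by (intro member_le_sum) auto
    also have "\<dots> \<le> G" unfolding G_def
      by (rule member_le_sum[of i UNIV "\<lambda>i. \<Sum>k\<in>Admit i. down_rate i k"]) (auto intro!: sum_nonneg gnn)
    finally show ?thesis .
  qed
  have G0: "0 \<le> G" unfolding G_def by (intro sum_nonneg gnn)
  define c where "c = 2 * a + 3"
  have c: "1 \<le> c" using a_pos by (simp add: c_def)
  define L where "L = ln Bb + (\<Sum>i\<in>UNIV. \<Sum>k\<in>Admit i. \<bar>ln (down_rate i k)\<bar>) + ln c + 1"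
  have lg: "\<bar>ln (down_rate i k)\<bar> \<le> (\<Sum>i\<in>UNIV. \<Sum>k\<in>Admit i. \<bar>ln (down_rate i k)\<bar>)" if "k \<in> Admit i" for i k
  proof -
    have "\<bar>ln (down_rate i k)\<bar> \<le> (\<Sum>k\<in>Admit i. \<bar>ln (down_rate i k)\<bar>)" using that by (intro member_le_sum) auto
    also have "\<dots> \<le> (\<Sum>i\<in>UNIV. \<Sum>k\<in>Admit i. \<bar>ln (down_rate i k)\<bar>)"
      by (rule member_le_sum[of i UNIV "\<lambda>i. \<Sum>k\<in>Admit i. \<bar>ln (down_rate i k)\<bar>"]) (auto intro!: sum_nonneg)
    finally show ?thesis .
  qed
  have L: "1 \<le> L" using Bb c by (auto simp: L_def intro!: add_nonneg_nonneg sum_nonneg)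
  define B where "B = (Bb + G) * c + L + 2 * Bp"
  have BG: "1 \<le> Bb + G" using Bb(1) G0 by simp
  have p: "0 \<le> (Bb + G) * c" "Bb + G \<le> (Bb + G) * c" using BG c mult_left_mono[OF c, of "Bb + G"] by auto
  have B: "1 \<le> B" "(Bb + G) * c \<le> B" "L \<le> B" "2 * Bp \<le> B" "Bb + G \<le> B"
    using p L Bp(1) by (auto simp: B_def)
  show thesis
  proof (rule that[OF B(1)])
    fix r X i k assume reg: "region r X" and k: "k \<in> Admit i"
    note b = region_bounds[OF reg]
    have kk: "k \<in> Kb" "k + unitv i \<in> Kb" using k by (auto simp: Admit_def)
    have x1: "real (X k) + 1 \<le> c * r" "real (X (k + unitv i)) + 1 \<le> c * r"
      using b(8)[OF kk(1)] b(8)[OF kk(2)] by (auto simp: c_def)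
    have bp: "0 < up_rate r X i" "up_rate r X i \<le> Bb" using up_rate_pos[OF reg] Bb(2)[OF reg] by auto
    have gp: "0 < down_rate i k" "down_rate i k \<le> G" using down_rate_pos G[OF k] by auto
    have cr: "0 \<le> c * r" using c b(1) by simp
    have "up_flow r X i k \<le> (Bb + G) * (c * r)" "down_flow X i k \<le> (Bb + G) * (c * r)"
      unfolding up_flow_def down_flow_def using x1 bp gp cr Bb(1) G0 by (auto intro!: mult_mono)
    moreover have "(Bb + G) * (c * r) \<le> B * r"
      unfolding mult.assoc[symmetric] using B b(1) by (intro mult_right_mono) auto
    ultimately show "up_flow r X i k \<le> B * r" "down_flow X i k \<le> B * r" by auto
    show "up_rate r X i + down_rate i k \<le> B" using bp gp B(5) by linarith
    have lnx: "0 \<le> ln (real (X k') + 1)" "ln (real (X k') + 1) \<le> ln c + ln r" if "real (X k') + 1 \<le> c * r" for k'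
    proof -
      show "0 \<le> ln (real (X k') + 1)" by simp
      have "ln (real (X k') + 1) \<le> ln (c * r)" using that by (subst ln_le_cancel_iff) auto
      then show "ln (real (X k') + 1) \<le> ln c + ln r" using c b(1) by (simp add: ln_mult)
    qed
    have lb: "\<bar>ln (up_rate r X i)\<bar> \<le> ln Bb"
    proof -
      have "ln (up_rate r X i) \<le> ln Bb" using bp by simp
      moreover have "ln (1 / Bb) \<le> ln (up_rate r X i)" using bp Bb(1) Bb(3)[OF reg, of i] by (subst ln_le_cancel_iff) auto
      then have "- ln Bb \<le> ln (up_rate r X i)" using Bb(1) by (simp add: ln_div)
      ultimately show ?thesis by linarith
    qed
    have "ln (up_flow r X i k) - ln (down_flow X i k) = ln (up_rate r X i) - ln (down_rate i k) + ln (real (X k) + 1) - ln (real (X (k + unitv i)) + 1)"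
      using bp gp by (simp add: up_flow_def down_flow_def ln_mult add_pos_nonneg)
    then have "\<bar>ln (up_flow r X i k) - ln (down_flow X i k)\<bar> \<le> (L - 1) + ln r"
      using lb lg[OF k] lnx[OF x1(1)] lnx[OF x1(2)] unfolding L_def by linarith
    also have "\<dots> \<le> L * ln r" using b(2) L mult_left_mono[OF b(2), of "L - 1"] by (simp add: algebra_simps)
    also have "\<dots> \<le> B * ln r" using B(3) b(2) by (intro mult_right_mono) auto
    finally show "\<bar>ln (up_flow r X i k) - ln (down_flow X i k)\<bar> \<le> B * ln r" .
    have "\<bar>potential_diff r X i k\<bar> \<le> Bp * ln r + Bp * ln r"
      unfolding potential_diff_def using Bp(2)[OF reg kk(1), of "real (X k) + 1"] Bp(2)[OF reg kk(2), of "real (X (k + unitv i)) + 1"] x1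
      by (auto simp: c_def)
    also have "\<dots> = (2 * Bp) * ln r" by simp
    also have "\<dots> \<le> B * ln r" using B(4) b(2) by (intro mult_right_mono) auto
    finally show "\<bar>potential_diff r X i k\<bar> \<le> B * ln r" .
  qed
qed

lemma flow_diff:
  assumes "region r X"
  shows "up_flow r X i k - down_flow X i k = r * (mu i * exp (\<nu> i) * xst k) * imbalance r X i k"
  unfolding up_flow_eq[OF assms] down_flow_eq[OF assms] imbalance_def by (simp add: right_diff_distrib)

text \<open>The entropy difference is minus the log ratio of the flows, corrected by the tilt. Edges
  leaving 0 carry one more correction because \<open>phi\<close> vanishes there.\<close>

lemma potential_diff_eq:
  assumes "region r X"
  shows "potential_diff r X i k = - (ln (up_flow r X i k) - ln (down_flow X i k)) + tilt r X i + (if k = 0 then ln (rel_count r X 0) else 0)"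
proof -
  have r: "0 < r" using region_bounds(1)[OF assms] by simp
  have m: "0 < mu i * exp (\<nu> i) * xst k" using mu_pos xst_pos by simp
  have y: "0 < rel_count r X k" "0 < rel_count r X (k + unitv i)" using rel_count_pos[OF assms] by auto
  have "ln (up_flow r X i k) - ln (down_flow X i k) = tilt r X i + ln (rel_count r X k) - ln (rel_count r X (k + unitv i))"
    unfolding up_flow_eq[OF assms] down_flow_eq[OF assms] using r m y mu_pos[of i] xst_pos[of k] by (simp add: ln_mult)
  then show ?thesis by (auto simp: potential_diff_def phi_def rel_count_def)
qed

lemma dissipation_term_nonneg: "region r X \<Longrightarrow> 0 \<le> (up_flow r X i k - down_flow X i k) * (ln (up_flow r X i k) - ln (down_flow X i k))"
  using up_flow_pos[of r X i k] down_flow_pos[of X i k] by (auto simp: zero_le_mult_iff)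

lemma dissipation_nonneg: "region r X \<Longrightarrow> 0 \<le> dissipation r X"
  unfolding dissipation_def by (intro sum_nonneg dissipation_term_nonneg)

lemma discrepancy_nonneg: "region r X \<Longrightarrow> 0 \<le> discrepancy r X"
  unfolding discrepancy_def using load_dev_sum_nonneg[of r X] region_bounds(1)[of r X]
  by (intro add_nonneg_nonneg sum_nonneg) auto

text \<open>Flows are at most of order \<open>r\<close>, so \<open>log_mean_upper\<close> bounds
  \<open>r\<close> times a squared imbalance by the dissipation of its edge. The three terms on the
  right match the three summands of the discrepancy, combined by Cauchy-Schwarz.\<close>

lemma discrepancy_sq:
  obtains C where "1 \<le> C" "\<And>r X. region r X \<Longrightarrow> r * (discrepancy r X)\<^sup>2 \<le> C * (dissipation r X + r * load_dev_sq r X + 1)"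
proof -
  obtain B where B: "1 \<le> B"
    "\<And>r X i k. region r X \<Longrightarrow> k \<in> Admit i \<Longrightarrow> up_flow r X i k \<le> B * r"
    "\<And>r X i k. region r X \<Longrightarrow> k \<in> Admit i \<Longrightarrow> down_flow X i k \<le> B * r"
    using edge_bounds by metis
  define P where "P = Sigma (UNIV :: 'i set) Admit"
  have finP: "finite P" by (simp add: P_def)
  define m where "m e = mu (fst e) * exp (\<nu> (fst e)) * xst (snd e)" for e
  have m: "0 < m e" for e using mu_pos xst_pos by (simp add: m_def)
  define m0 where "m0 = Min (m ` P)"
  have Pne: "P \<noteq> {}" using zero_in_Admit[of undefined] unfolding P_def by blast
  have m0: "0 < m0" unfolding m0_def using finP Pne m by (subst Min_gr_iff) auto
  have m0_le: "m0 \<le> m e" if "e \<in> P" for e unfolding m0_def using finP that by auto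
  define N where "N = real CARD('i)"
  define C where "C = 3 * N + 3 * real (card P) * B / m0\<^sup>2 + 3"
  have C: "3 * N \<le> C" "3 * real (card P) * B / m0\<^sup>2 \<le> C" "3 \<le> C"
    using B(1) m0 by (auto simp: C_def N_def)
  show thesis
  proof (rule that[of C])
    show "1 \<le> C" using C(3) by simp
    fix r X assume reg: "region r X"
    have r: "1 < r" using region_bounds(1)[OF reg] .
    define D where "D = (\<Sum>i\<in>UNIV. \<Sum>k\<in>Admit i. \<bar>imbalance r X i k\<bar>)"
    have DP: "D = (\<Sum>(i, k)\<in>P. \<bar>imbalance r X i k\<bar>)" unfolding D_def P_def by (rule sum.Sigma) auto
    have "D\<^sup>2 \<le> (\<Sum>(i, k)\<in>P. (imbalance r X i k)\<^sup>2) * real (card P)"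
      unfolding DP using sum_squared_le_sum_of_squares[of "\<lambda>(i, k). \<bar>imbalance r X i k\<bar>" P] by (simp add: case_prod_unfold)
    moreover have "r * (m0\<^sup>2 * (\<Sum>(i, k)\<in>P. (imbalance r X i k)\<^sup>2)) \<le> B * dissipation r X"
    proof -
      have "dissipation r X = (\<Sum>(i, k)\<in>P. (up_flow r X i k - down_flow X i k) * (ln (up_flow r X i k) - ln (down_flow X i k)))"
        unfolding dissipation_def P_def by (rule sum.Sigma) auto
      moreover have "r * (m0\<^sup>2 * (imbalance r X i k)\<^sup>2) \<le> B * ((up_flow r X i k - down_flow X i k) * (ln (up_flow r X i k) - ln (down_flow X i k)))"
        if e: "(i, k) \<in> P" for i k
      proof -
        have k: "k \<in> Admit i" using e by (simp add: P_def)
        have "(r * m (i, k) * imbalance r X i k)\<^sup>2 \<le> B * r * ((up_flow r X i k - down_flow X i k) * (ln (up_flow r X i k) - ln (down_flow X i k)))"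
          using log_mean_upper[OF up_flow_pos[OF reg] down_flow_pos B(2)[OF reg k] B(3)[OF reg k]] flow_diff[OF reg, of i k]
          by (simp add: m_def)
        then have "r * (r * ((m (i, k))\<^sup>2 * (imbalance r X i k)\<^sup>2)) \<le> r * (B * ((up_flow r X i k - down_flow X i k) * (ln (up_flow r X i k) - ln (down_flow X i k))))"
          by (simp add: power_mult_distrib power2_eq_square[of r] ac_simps)
        then have "r * ((m (i, k))\<^sup>2 * (imbalance r X i k)\<^sup>2) \<le> B * ((up_flow r X i k - down_flow X i k) * (ln (up_flow r X i k) - ln (down_flow X i k)))"
          using r by simp
        moreover have "r * (m0\<^sup>2 * (imbalance r X i k)\<^sup>2) \<le> r * ((m (i, k))\<^sup>2 * (imbalance r X i k)\<^sup>2)"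
          using r m0 m0_le[OF e] by (intro mult_left_mono mult_right_mono power_mono) auto
        ultimately show ?thesis by linarith
      qed
      ultimately have D: "dissipation r X = (\<Sum>(i, k)\<in>P. (up_flow r X i k - down_flow X i k) * (ln (up_flow r X i k) - ln (down_flow X i k)))"
        and T: "\<And>i k. (i, k) \<in> P \<Longrightarrow> r * (m0\<^sup>2 * (imbalance r X i k)\<^sup>2) \<le> B * ((up_flow r X i k - down_flow X i k) * (ln (up_flow r X i k) - ln (down_flow X i k)))"
        by auto
      have "r * (m0\<^sup>2 * (\<Sum>(i, k)\<in>P. (imbalance r X i k)\<^sup>2)) = (\<Sum>(i, k)\<in>P. r * (m0\<^sup>2 * (imbalance r X i k)\<^sup>2))"
        by (simp add: sum_distrib_left case_prod_unfold)
      also have "\<dots> \<le> (\<Sum>(i, k)\<in>P. B * ((up_flow r X i k - down_flow X i k) * (ln (up_flow r X i k) - ln (down_flow X i k))))"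
        by (intro sum_mono) (use T in auto)
      also have "\<dots> = B * dissipation r X"
        unfolding D by (simp add: sum_distrib_left case_prod_unfold)
      finally show ?thesis .
    qed
    ultimately have "r * (m0\<^sup>2 * D\<^sup>2) \<le> real (card P) * (B * dissipation r X)"
    proof -
      assume 1: "D\<^sup>2 \<le> (\<Sum>(i, k)\<in>P. (imbalance r X i k)\<^sup>2) * real (card P)"
        and 2: "r * (m0\<^sup>2 * (\<Sum>(i, k)\<in>P. (imbalance r X i k)\<^sup>2)) \<le> B * dissipation r X"
      have "r * (m0\<^sup>2 * D\<^sup>2) \<le> r * (m0\<^sup>2 * ((\<Sum>(i, k)\<in>P. (imbalance r X i k)\<^sup>2) * real (card P)))"
        using 1 r by (intro mult_left_mono) auto
      also have "\<dots> = real (card P) * (r * (m0\<^sup>2 * (\<Sum>(i, k)\<in>P. (imbalance r X i k)\<^sup>2)))" by (simp add: ac_simps)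
      also have "\<dots> \<le> real (card P) * (B * dissipation r X)" using 2 by (intro mult_left_mono) auto
      finally show ?thesis .
    qed
    then have D2: "r * D\<^sup>2 \<le> real (card P) * B / m0\<^sup>2 * dissipation r X"
      using m0 by (simp add: field_simps)
    have "(discrepancy r X)\<^sup>2 \<le> 3 * (load_dev_sum r X)\<^sup>2 + 3 * D\<^sup>2 + 3 * (1 / r)\<^sup>2"
    proof -
      have "(x + y + z)\<^sup>2 \<le> 3 * x\<^sup>2 + 3 * y\<^sup>2 + 3 * z\<^sup>2" for x y z :: real
        using zero_le_power2[of "x - y"] zero_le_power2[of "x - z"] zero_le_power2[of "y - z"]
        by (simp add: power2_eq_square algebra_simps)
      then show ?thesis unfolding discrepancy_def D_def[symmetric] .
    qed
    then have "r * (discrepancy r X)\<^sup>2 \<le> r * (3 * (load_dev_sum r X)\<^sup>2 + 3 * D\<^sup>2 + 3 * (1 / r)\<^sup>2)"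
      using r by (intro mult_left_mono) auto
    also have "\<dots> = 3 * (r * (load_dev_sum r X)\<^sup>2) + 3 * (r * D\<^sup>2) + 3 * (1 / r)"
      using r by (simp add: field_simps power2_eq_square)
    also have "\<dots> \<le> 3 * (r * (N * load_dev_sq r X)) + 3 * (real (card P) * B / m0\<^sup>2 * dissipation r X) + 3 * 1"
      using D2 load_dev_sum_sq[of r X] r by (intro add_mono mult_left_mono) (auto simp: N_def)
    also have "\<dots> = (3 * N) * (r * load_dev_sq r X) + (3 * real (card P) * B / m0\<^sup>2) * dissipation r X + 3" by simp
    also have "\<dots> \<le> C * (r * load_dev_sq r X) + C * dissipation r X + C"
      using C r load_dev_sq_nonneg[of r X] dissipation_nonneg[OF reg] by (intro add_mono mult_right_mono) auto
    finally show "r * (discrepancy r X)\<^sup>2 \<le> C * (dissipation r X + r * load_dev_sq r X + 1)" by (simp add: algebra_simps)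
  qed
qed

end

section \<open>Stirling-type bounds for the logarithm of the factorial\<close>

lemma ln_fact_ge: "real n * ln (real n) - real n \<le> ln (fact n)"
proof (induction n)
  case (Suc n)
  show ?case
  proof (cases "n = 0")
    case False
    have "ln ((real n + 1) / real n) \<le> (real n + 1) / real n - 1"
      using False by (intro ln_le_minus_one) auto
    then have "real n * ln ((real n + 1) / real n) \<le> real n * ((real n + 1) / real n - 1)"
      by (intro mult_left_mono) auto
    also have "\<dots> = 1" using False by (simp add: field_simps)
    finally have "real n * ln (real n + 1) - real n * ln (real n) \<le> 1"
      using False by (simp add: ln_div right_diff_distrib)
    moreover have "ln (fact (Suc n)) = ln (real n + 1) + ln (fact n)"
      by (simp add: ln_mult add.commute)
    ultimately show ?thesis using Suc by (simp add: algebra_simps)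
  qed simp
qed simp

lemma ln_fact_le: "ln (fact n) \<le> (real n + 1) * ln (real n + 1) - real n"
proof (induction n)
  case (Suc n)
  have "ln ((real n + 1) / (real n + 2)) \<le> (real n + 1) / (real n + 2) - 1"
    by (intro ln_le_minus_one) auto
  then have "(real n + 2) * ln ((real n + 1) / (real n + 2)) \<le> (real n + 2) * ((real n + 1) / (real n + 2) - 1)"
    by (intro mult_left_mono) auto
  also have "\<dots> = - 1" by (simp add: field_simps)
  finally have "(real n + 2) * ln (real n + 1) + 1 \<le> (real n + 2) * ln (real n + 2)"
    by (simp add: ln_div right_diff_distrib)
  moreover have "ln (fact (Suc n)) = ln (real n + 1) + ln (fact n)"
    by (simp add: ln_mult add.commute)
  ultimately show ?case using Suc by (simp add: algebra_simps)
qed simp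

context packing_eq
begin

text \<open>The discretisation error between \<open>phi\<close> at \<open>X k + 1\<close> and at
  \<open>X k\<close>; it is 0 at the empty configuration, where \<open>phi\<close> vanishes.\<close>

definition succ_log :: "(('i \<Rightarrow> nat) \<Rightarrow> nat) \<Rightarrow> ('i \<Rightarrow> nat) \<Rightarrow> real" where
  "succ_log X k = (if k = 0 \<or> X k = 0 then 0 else ln ((real (X k) + 1) / real (X k)))"

lemma phi_step:
  assumes "0 < r" "X k \<noteq> 0"
  shows "phi r k (real (X k) + 1) = phi r k (real (X k)) + succ_log X k"
  using assms xst_pos[of k] by (simp add: phi_def succ_log_def ln_div ln_mult)

lemma succ_log_bounds: "real (X k) * succ_log X k \<le> 1" "real (X k) * (succ_log X k)\<^sup>2 \<le> 1"
  using ln_succ_ratio[of "X k"] by (auto simp: succ_log_def)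

lemma jump_up_eq: "0 < r \<Longrightarrow> X k \<noteq> 0 \<Longrightarrow> jump_up r X i k = potential_diff r X i k + succ_log X k"
  using phi_step[of r X k] by (simp add: jump_up_def potential_diff_def)

lemma jump_down_eq: "0 < r \<Longrightarrow> X (k + unitv i) \<noteq> 0 \<Longrightarrow> jump_down r X i k = - potential_diff r X i k + succ_log X (k + unitv i)"
  using phi_step[of r X "k + unitv i"] by (simp add: jump_down_def potential_diff_def)

lemma load_dev_sum_le_discrepancy: "region r X \<Longrightarrow> load_dev_sum r X + 1 / r \<le> discrepancy r X"
  unfolding discrepancy_def by (simp add: sum_nonneg)

lemma imbalance_le_discrepancy:
  assumes "region r X" "k \<in> Admit i"
  shows "\<bar>imbalance r X i k\<bar> \<le> discrepancy r X"
proof -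
  have "\<bar>imbalance r X i k\<bar> \<le> (\<Sum>k\<in>Admit i. \<bar>imbalance r X i k\<bar>)" using assms by (intro member_le_sum) auto
  also have "\<dots> \<le> (\<Sum>i\<in>UNIV. \<Sum>k\<in>Admit i. \<bar>imbalance r X i k\<bar>)"
    by (rule member_le_sum[of i UNIV "\<lambda>i. \<Sum>k\<in>Admit i. \<bar>imbalance r X i k\<bar>"]) (auto intro!: sum_nonneg)
  also have "\<dots> \<le> discrepancy r X" using load_dev_sum_nonneg[of r X] region_bounds(1)[OF assms(1)] by (simp add: discrepancy_def)
  finally show ?thesis .
qed

section \<open>First and second order drift of the entropy part\<close>

definition entropy_drift :: "real \<Rightarrow> (('i \<Rightarrow> nat) \<Rightarrow> nat) \<Rightarrow> real" where
  "entropy_drift r X = (\<Sum>i\<in>UNIV. \<Sum>k\<in>Admit i. up_rate r X i * real (X k) * jump_up r X i k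
     + down_rate i k * real (X (k + unitv i)) * jump_down r X i k)"

definition entropy_sq_drift :: "real \<Rightarrow> (('i \<Rightarrow> nat) \<Rightarrow> nat) \<Rightarrow> real" where
  "entropy_sq_drift r X = (\<Sum>i\<in>UNIV. \<Sum>k\<in>Admit i. up_rate r X i * real (X k) * (jump_up r X i k)\<^sup>2
     + down_rate i k * real (X (k + unitv i)) * (jump_down r X i k)\<^sup>2)"

text \<open>Inserting \<open>potential_diff_eq\<close> gives minus the dissipation and two
  corrections. The tilt is the same for all edges of one type, so it multiplies only the net flow of
  the type, which is of the size of the load deviation; on edges at 0 the imbalance multiplies a
  logarithm that is itself of the size of the load deviation. Hence every error contains one factor
  controlled by the loads.\<close>

lemma first_order:
  obtains C where "1 \<le> C"
    "\<And>r X. region r X \<Longrightarrow> entropy_drift r X \<le> - dissipation r X + C * (r * (discrepancy r X * (load_dev_sum r X + 1 / r))) + C * ln r"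
proof -
  obtain B where B: "1 \<le> B"
    "\<And>r X i k. region r X \<Longrightarrow> k \<in> Admit i \<Longrightarrow> up_rate r X i + down_rate i k \<le> B"
    "\<And>r X i k. region r X \<Longrightarrow> k \<in> Admit i \<Longrightarrow> \<bar>potential_diff r X i k\<bar> \<le> B * ln r"
    using edge_bounds by metis
  obtain B0 where B0: "1 \<le> B0" "\<And>r X. region r X \<Longrightarrow> \<bar>ln (rel_count r X 0)\<bar> \<le> B0 * (load_dev_sum r X + 1 / r)" using rel_count_zero_bound by metis
  obtain C1 where C1: "0 < C1" "\<And>r X i. region r X \<Longrightarrow> \<bar>tilt r X i\<bar> \<le> C1 * discrepancy r X" using equilibrium_gap by metis
  obtain B3 where B3: "1 \<le> B3"
    "\<And>r X i. region r X \<Longrightarrow> \<bar>(\<Sum>k\<in>Admit i. up_flow r X i k - down_flow X i k) + r * mu i * load_dev r X i\<bar> \<le> B3"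
    "\<And>r X i. region r X \<Longrightarrow> \<bar>(\<Sum>k\<in>K. real (k i) * (xst k * (rel_count r X k - 1))) - load_dev r X i\<bar> \<le> B3 * (1 / r)"
    by (rule flow_balance, rule that)
  define c1 where "c1 i = C1 * (mu i + B3) + mu i * exp (\<nu> i) * a * B0" for i
  define c2 where "c2 = (\<Sum>i\<in>UNIV. real (card (Admit i)) * (B * B + B))"
  have c1: "0 \<le> c1 i" for i using C1 B3 B0 mu_pos[of i] a_pos by (simp add: c1_def)
  have c2: "0 \<le> c2" unfolding c2_def using B by (intro sum_nonneg mult_nonneg_nonneg) auto
  have c1s: "0 \<le> (\<Sum>i\<in>UNIV. c1 i)" using c1 by (intro sum_nonneg)
  show thesis
  proof (rule that[of "1 + (\<Sum>i\<in>UNIV. c1 i) + c2"])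
    show "1 \<le> 1 + (\<Sum>i\<in>UNIV. c1 i) + c2" using c1s c2 by simp
    fix r X assume reg: "region r X"
    note b = region_bounds[OF reg]
    have r: "0 < r" using b(1) by simp
    define D where "D i k = (up_flow r X i k - down_flow X i k) * (ln (up_flow r X i k) - ln (down_flow X i k))" for i k
    define y0 where "y0 = ln (rel_count r X 0)"
    define T where "T = r * (discrepancy r X * (load_dev_sum r X + 1 / r))"
    have Snn: "0 \<le> discrepancy r X" "0 \<le> load_dev_sum r X + 1 / r" using discrepancy_nonneg[OF reg] load_dev_sum_nonneg[of r X] r by auto
    have T0: "0 \<le> T" unfolding T_def using r Snn by (intro mult_nonneg_nonneg) auto
    have edge: "up_rate r X i * real (X k) * jump_up r X i k + down_rate i k * real (X (k + unitv i)) * jump_down r X i k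
        \<le> - D i k + (up_flow r X i k - down_flow X i k) * tilt r X i + (if k = 0 then (up_flow r X i k - down_flow X i k) * y0 else 0) + (B * B + B) * ln r"
      if k: "k \<in> Admit i" for i k
    proof -
      have nn: "0 \<le> up_rate r X i" "0 \<le> down_rate i k" using up_rate_pos[OF reg, of i] down_rate_pos[of i k] by auto
      have "up_rate r X i * real (X k) * jump_up r X i k + down_rate i k * real (X (k + unitv i)) * jump_down r X i k
        \<le> (up_rate r X i * real (X k) - down_rate i k * real (X (k + unitv i))) * potential_diff r X i k + (up_rate r X i + down_rate i k)"
        by (rule edge_first_order[OF nn succ_log_bounds(1) succ_log_bounds(1) jump_up_eq[OF r] jump_down_eq[OF r]])
      \<comment> \<open>Passing from \<open>X\<close> to \<open>X + 1\<close> turns jump rates into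
        flows. The difference costs \<open>ln r\<close> per edge, one source of the additive
        \<open>C * ln r\<close>.\<close>
      also have "(up_rate r X i * real (X k) - down_rate i k * real (X (k + unitv i))) * potential_diff r X i k =
          (up_flow r X i k - down_flow X i k) * potential_diff r X i k - (up_rate r X i - down_rate i k) * potential_diff r X i k"
        by (simp add: up_flow_def down_flow_def algebra_simps)
      also have "(up_flow r X i k - down_flow X i k) * potential_diff r X i k =
          - D i k + (up_flow r X i k - down_flow X i k) * tilt r X i + (if k = 0 then (up_flow r X i k - down_flow X i k) * y0 else 0)"
        unfolding potential_diff_eq[OF reg] D_def y0_def by (simp add: algebra_simps)
      also have "- ((up_rate r X i - down_rate i k) * potential_diff r X i k) \<le> B * (B * ln r)"
      proof -
        have "- ((up_rate r X i - down_rate i k) * potential_diff r X i k) \<le> \<bar>up_rate r X i - down_rate i k\<bar> * \<bar>potential_diff r X i k\<bar>"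
          unfolding abs_mult[symmetric] by (rule abs_ge_minus_self)
        also have "\<dots> \<le> B * (B * ln r)"
          using B(2)[OF reg k] B(3)[OF reg k] nn B(1) by (intro mult_mono) auto
        finally show ?thesis .
      qed
      then have "(- D i k + (up_flow r X i k - down_flow X i k) * tilt r X i + (if k = 0 then (up_flow r X i k - down_flow X i k) * y0 else 0))
          - (up_rate r X i - down_rate i k) * potential_diff r X i k + (up_rate r X i + down_rate i k)
        \<le> (- D i k + (up_flow r X i k - down_flow X i k) * tilt r X i + (if k = 0 then (up_flow r X i k - down_flow X i k) * y0 else 0)) + B * (B * ln r) + B * ln r"
        using B(2)[OF reg k] mult_left_mono[OF b(2), of B] B(1) by linarith
      finally show ?thesis by (simp only: distrib_right mult.assoc add.assoc)
    qed
    have "entropy_drift r X \<le> (\<Sum>i\<in>UNIV. \<Sum>k\<in>Admit i. - D i k + (up_flow r X i k - down_flow X i k) * tilt r X i + (if k = 0 then (up_flow r X i k - down_flow X i k) * y0 else 0) + (B * B + B) * ln r)"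
      unfolding entropy_drift_def by (intro sum_mono edge)
    also have "\<dots> = (\<Sum>i\<in>UNIV. - (\<Sum>k\<in>Admit i. D i k) + ((\<Sum>k\<in>Admit i. up_flow r X i k - down_flow X i k) * tilt r X i + (up_flow r X i 0 - down_flow X i 0) * y0)
        + real (card (Admit i)) * ((B * B + B) * ln r))"
    proof (intro sum.cong refl)
      fix i
      have "(\<Sum>k\<in>Admit i. if k = 0 then (up_flow r X i k - down_flow X i k) * y0 else 0) = (up_flow r X i 0 - down_flow X i 0) * y0"
        by (subst sum.delta) auto
      then show "(\<Sum>k\<in>Admit i. - D i k + (up_flow r X i k - down_flow X i k) * tilt r X i + (if k = 0 then (up_flow r X i k - down_flow X i k) * y0 else 0) + (B * B + B) * ln r)
        = - (\<Sum>k\<in>Admit i. D i k) + ((\<Sum>k\<in>Admit i. up_flow r X i k - down_flow X i k) * tilt r X i + (up_flow r X i 0 - down_flow X i 0) * y0)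
        + real (card (Admit i)) * ((B * B + B) * ln r)"
        unfolding sum.distrib sum_negf sum_distrib_right by simp
    qed
    also have "\<dots> \<le> (\<Sum>i\<in>UNIV. - (\<Sum>k\<in>Admit i. D i k) + c1 i * T + real (card (Admit i)) * ((B * B + B) * ln r))"
    proof (rule sum_mono)
      fix i
      have "(\<Sum>k\<in>Admit i. up_flow r X i k - down_flow X i k) * tilt r X i \<le> C1 * (mu i + B3) * T"
      proof -
        have m: "0 < mu i" by (rule mu_pos)
        have "\<bar>r * mu i * load_dev r X i\<bar> \<le> r * mu i * load_dev_sum r X"
          using r m load_dev_le_load_dev_sum[of r X i] by (simp add: abs_mult)
        then have "\<bar>\<Sum>k\<in>Admit i. up_flow r X i k - down_flow X i k\<bar> \<le> r * mu i * load_dev_sum r X + B3"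
          using B3(2)[OF reg, of i] by linarith
        also have "\<dots> \<le> (mu i + B3) * (r * (load_dev_sum r X + 1 / r))"
        proof -
          have "0 \<le> B3 * (r * load_dev_sum r X)" using B3(1) r load_dev_sum_nonneg[of r X] by simp
          then show ?thesis using r m by (simp add: algebra_simps)
        qed
        finally have s: "\<bar>\<Sum>k\<in>Admit i. up_flow r X i k - down_flow X i k\<bar> \<le> (mu i + B3) * (r * (load_dev_sum r X + 1 / r))" .
        have "(\<Sum>k\<in>Admit i. up_flow r X i k - down_flow X i k) * tilt r X i \<le> \<bar>\<Sum>k\<in>Admit i. up_flow r X i k - down_flow X i k\<bar> * \<bar>tilt r X i\<bar>"
          unfolding abs_mult[symmetric] by (rule abs_ge_self)
        also have "\<dots> \<le> ((mu i + B3) * (r * (load_dev_sum r X + 1 / r))) * (C1 * discrepancy r X)"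
          using s C1(2)[OF reg, of i] Snn B3(1) m r by (intro mult_mono) auto
        also have "\<dots> = C1 * (mu i + B3) * T" by (simp add: T_def ac_simps)
        finally show ?thesis .
      qed
      moreover have "(up_flow r X i 0 - down_flow X i 0) * y0 \<le> mu i * exp (\<nu> i) * a * B0 * T"
      proof -
        have "(up_flow r X i 0 - down_flow X i 0) * y0 \<le> \<bar>up_flow r X i 0 - down_flow X i 0\<bar> * \<bar>y0\<bar>"
          unfolding abs_mult[symmetric] by (rule abs_ge_self)
        also have "\<bar>up_flow r X i 0 - down_flow X i 0\<bar> = r * (mu i * exp (\<nu> i) * a) * \<bar>imbalance r X i 0\<bar>"
          unfolding flow_diff[OF reg] using r mu_pos[of i] a_pos by (simp add: abs_mult)
        also have "\<dots> * \<bar>y0\<bar> \<le> (r * (mu i * exp (\<nu> i) * a) * discrepancy r X) * (B0 * (load_dev_sum r X + 1 / r))"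
          using imbalance_le_discrepancy[OF reg zero_in_Admit, of i] B0(2)[OF reg] r mu_pos[of i] a_pos Snn unfolding y0_def
          by (intro mult_mono mult_left_mono) auto
        also have "\<dots> = mu i * exp (\<nu> i) * a * B0 * T" by (simp add: T_def ac_simps)
        finally show ?thesis .
      qed
      ultimately have "(\<Sum>k\<in>Admit i. up_flow r X i k - down_flow X i k) * tilt r X i + (up_flow r X i 0 - down_flow X i 0) * y0 \<le> c1 i * T"
        unfolding c1_def distrib_right[of "C1 * (mu i + B3)"] by (rule add_mono)
      then show "- (\<Sum>k\<in>Admit i. D i k) + ((\<Sum>k\<in>Admit i. up_flow r X i k - down_flow X i k) * tilt r X i + (up_flow r X i 0 - down_flow X i 0) * y0)
        + real (card (Admit i)) * ((B * B + B) * ln r) \<le> - (\<Sum>k\<in>Admit i. D i k) + c1 i * T + real (card (Admit i)) * ((B * B + B) * ln r)"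
        by simp
    qed
    also have "\<dots> = - dissipation r X + (\<Sum>i\<in>UNIV. c1 i) * T + c2 * ln r"
      unfolding sum.distrib dissipation_def D_def c2_def sum_negf sum_distrib_right by (simp add: mult.assoc)
    also have "\<dots> \<le> - dissipation r X + (1 + (\<Sum>i\<in>UNIV. c1 i) + c2) * T + (1 + (\<Sum>i\<in>UNIV. c1 i) + c2) * ln r"
      using T0 b(2) c1s c2 by (intro add_mono mult_right_mono) auto
    finally show "entropy_drift r X \<le> - dissipation r X + (1 + (\<Sum>i\<in>UNIV. c1 i) + c2) * (r * (discrepancy r X * (load_dev_sum r X + 1 / r))) + (1 + (\<Sum>i\<in>UNIV. c1 i) + c2) * ln r"
      unfolding T_def .
  qed
qed

text \<open>The squared entropy difference splits into the squared log ratio of the flows, handled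
  by \<open>log_sq_le\<close> at the price \<open>ln r\<close>, and the squared corrections, bounded
  by the squared discrepancy.\<close>

lemma second_order:
  obtains C where "1 \<le> C"
    "\<And>r X. region r X \<Longrightarrow> entropy_sq_drift r X \<le> C * (ln r * dissipation r X + r * (discrepancy r X)\<^sup>2 + 1)"
proof -
  obtain B where B: "1 \<le> B"
    "\<And>r X i k. region r X \<Longrightarrow> k \<in> Admit i \<Longrightarrow> up_flow r X i k \<le> B * r"
    "\<And>r X i k. region r X \<Longrightarrow> k \<in> Admit i \<Longrightarrow> down_flow X i k \<le> B * r"
    "\<And>r X i k. region r X \<Longrightarrow> k \<in> Admit i \<Longrightarrow> \<bar>ln (up_flow r X i k) - ln (down_flow X i k)\<bar> \<le> B * ln r"
    "\<And>r X i k. region r X \<Longrightarrow> k \<in> Admit i \<Longrightarrow> up_rate r X i + down_rate i k \<le> B"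
    "\<And>r X i k. region r X \<Longrightarrow> k \<in> Admit i \<Longrightarrow> \<bar>potential_diff r X i k\<bar> \<le> B * ln r"
    by (rule edge_bounds, rule that)
  obtain B0 where B0: "1 \<le> B0" "\<And>r X. region r X \<Longrightarrow> \<bar>ln (rel_count r X 0)\<bar> \<le> B0 * (load_dev_sum r X + 1 / r)" using rel_count_zero_bound by metis
  obtain C1 where C1: "0 < C1" "\<And>r X i. region r X \<Longrightarrow> \<bar>tilt r X i\<bar> \<le> C1 * discrepancy r X" using equilibrium_gap by metis
  define n where "n = (\<Sum>i\<in>(UNIV::'i set). real (card (Admit i)))"
  have n: "0 \<le> n" unfolding n_def by (intro sum_nonneg) auto
  define E where "E = 8 * B * (C1 + B0)\<^sup>2"
  have E: "0 \<le> E" using B(1) by (simp add: E_def)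
  define C where "C = 16 * B + n * E + n * (2 * B)"
  have C: "16 * B \<le> C" "n * E \<le> C" "n * (2 * B) \<le> C" using B(1) n E by (auto simp: C_def)
  show thesis
  proof (rule that[of C])
    show "1 \<le> C" using C(1) B(1) by simp
    fix r X assume reg: "region r X"
    note b = region_bounds[OF reg]
    have r: "0 < r" using b(1) by simp
    define D where "D i k = (up_flow r X i k - down_flow X i k) * (ln (up_flow r X i k) - ln (down_flow X i k))" for i k
    have Snn: "0 \<le> discrepancy r X" using discrepancy_nonneg[OF reg] .
    have edge: "up_rate r X i * real (X k) * (jump_up r X i k)\<^sup>2 + down_rate i k * real (X (k + unitv i)) * (jump_down r X i k)\<^sup>2
        \<le> 16 * B * (ln r * D i k) + (E * (r * (discrepancy r X)\<^sup>2) + 2 * B)"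
      if k: "k \<in> Admit i" for i k
    proof -
      have nn: "0 \<le> up_rate r X i" "0 \<le> down_rate i k" using up_rate_pos[OF reg, of i] down_rate_pos[of i k] by auto
      have V: "0 < up_flow r X i k" "0 < down_flow X i k" using up_flow_pos[OF reg] down_flow_pos by auto
      define w where "w = tilt r X i + (if k = 0 then ln (rel_count r X 0) else 0)"
      define l where "l = ln (up_flow r X i k) - ln (down_flow X i k)"
      have D: "0 \<le> D i k" unfolding D_def by (rule dissipation_term_nonneg[OF reg])
      have "\<bar>ln (rel_count r X 0)\<bar> \<le> B0 * discrepancy r X"
        using order_trans[OF B0(2)[OF reg] mult_left_mono[OF load_dev_sum_le_discrepancy[OF reg], of B0]] B0(1) by simp
      moreover have "0 \<le> B0 * discrepancy r X" using B0(1) Snn by simp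
      ultimately have "\<bar>w\<bar> \<le> (C1 + B0) * discrepancy r X"
        using C1(2)[OF reg, of i] unfolding w_def distrib_right by (auto split: if_splits)
      then have "\<bar>w\<bar>\<^sup>2 \<le> ((C1 + B0) * discrepancy r X)\<^sup>2" by (intro power_mono) auto
      then have w2: "w\<^sup>2 \<le> (C1 + B0)\<^sup>2 * (discrepancy r X)\<^sup>2" by (simp add: power_mult_distrib)
      have VW2: "up_flow r X i k + down_flow X i k \<le> 2 * B * r" using B(2)[OF reg k] B(3)[OF reg k] by simp
      have "up_rate r X i * real (X k) * (jump_up r X i k)\<^sup>2 + down_rate i k * real (X (k + unitv i)) * (jump_down r X i k)\<^sup>2
        \<le> 2 * (up_rate r X i * real (X k) + down_rate i k * real (X (k + unitv i))) * (potential_diff r X i k)\<^sup>2 + 2 * (up_rate r X i + down_rate i k)"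
        by (rule edge_second_order[OF nn succ_log_bounds(2) succ_log_bounds(2) jump_up_eq[OF r] jump_down_eq[OF r]])
      also have "\<dots> \<le> 2 * (up_flow r X i k + down_flow X i k) * (2 * l\<^sup>2 + 2 * w\<^sup>2) + 2 * B"
      proof (intro add_mono mult_mono)
        have "potential_diff r X i k = - l + w" unfolding potential_diff_eq[OF reg] l_def w_def by simp
        then show "(potential_diff r X i k)\<^sup>2 \<le> 2 * l\<^sup>2 + 2 * w\<^sup>2" using sum_sq_le2[of "- l" w] by simp
        show "up_rate r X i * real (X k) \<le> up_flow r X i k" "down_rate i k * real (X (k + unitv i)) \<le> down_flow X i k"
          using nn by (auto simp: up_flow_def down_flow_def intro!: mult_left_mono)
        show "up_rate r X i + down_rate i k \<le> B" by (rule B(5)[OF reg k])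
      qed (use V nn in auto)
      also have "\<dots> = 4 * ((up_flow r X i k + down_flow X i k) * l\<^sup>2) + 4 * ((up_flow r X i k + down_flow X i k) * w\<^sup>2) + 2 * B"
        by (simp add: algebra_simps)
      also have "\<dots> \<le> 4 * (2 * (1 + B * ln r) * D i k) + 4 * (2 * B * r * ((C1 + B0)\<^sup>2 * (discrepancy r X)\<^sup>2)) + 2 * B"
      proof (intro add_mono mult_left_mono)
        show "(up_flow r X i k + down_flow X i k) * l\<^sup>2 \<le> 2 * (1 + B * ln r) * D i k"
          unfolding l_def D_def by (rule log_sq_le[OF V B(4)[OF reg k]])
        show "(up_flow r X i k + down_flow X i k) * w\<^sup>2 \<le> 2 * B * r * ((C1 + B0)\<^sup>2 * (discrepancy r X)\<^sup>2)"
          using VW2 w2 V by (intro mult_mono) auto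
      qed auto
      also have "2 * (1 + B * ln r) * D i k \<le> 4 * B * ln r * D i k"
      proof (rule mult_right_mono[OF _ D])
        have "1 \<le> B * ln r" using mult_mono[OF B(1) b(2)] B(1) by simp
        then show "2 * (1 + B * ln r) \<le> 4 * B * ln r" by simp
      qed
      finally show ?thesis by (simp add: E_def algebra_simps)
    qed
    have "entropy_sq_drift r X \<le> (\<Sum>i\<in>UNIV. \<Sum>k\<in>Admit i. 16 * B * (ln r * D i k) + (E * (r * (discrepancy r X)\<^sup>2) + 2 * B))"
      unfolding entropy_sq_drift_def by (intro sum_mono edge)
    also have "\<dots> = 16 * B * (ln r * dissipation r X) + n * (E * (r * (discrepancy r X)\<^sup>2) + 2 * B)"
      unfolding dissipation_def D_def n_def by (simp add: sum.distrib sum_distrib_left sum_distrib_right)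
    also have "\<dots> = 16 * B * (ln r * dissipation r X) + (n * E) * (r * (discrepancy r X)\<^sup>2) + n * (2 * B)"
      by (simp add: algebra_simps)
    also have "\<dots> \<le> C * (ln r * dissipation r X) + C * (r * (discrepancy r X)\<^sup>2) + C"
      using C b(1,2) dissipation_nonneg[OF reg] r by (intro add_mono mult_right_mono mult_nonneg_nonneg) auto
    finally show "entropy_sq_drift r X \<le> C * (ln r * dissipation r X + r * (discrepancy r X)\<^sup>2 + 1)" by (simp add: algebra_simps)
  qed
qed

text \<open>With a factorial in place of \<open>n * ln n - n\<close> the increments of the entropy are exactly the values of \<open>phi\<close>.\<close>

definition Phi :: "real \<Rightarrow> ('i \<Rightarrow> nat) \<Rightarrow> nat \<Rightarrow> real" where
  "Phi r k n = ln (fact n) - real n * ln (r * xst k) + r * xst k"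

definition lyap :: "real \<Rightarrow> (('i \<Rightarrow> nat) \<Rightarrow> nat) \<Rightarrow> real" where
  "lyap r X = (\<Sum>k\<in>K. Phi r k (X k)) + ln r * (r * load_dev_sq r X)"

text \<open>\<open>ln (fact n) \<ge> n * ln n - n\<close> reduces this to \<open>entropy_ge\<close>.
  In \<open>good_occ\<close> it turns a bound on \<open>lyap\<close> into one for square roots of
  counts.\<close>

lemma Phi_lower:
  assumes "0 < r"
  shows "(sqrt (real n) - sqrt (r * xst k))\<^sup>2 \<le> Phi r k n"
proof -
  have p: "0 < r * xst k" using assms xst_pos by simp
  have "(sqrt (real n) - sqrt (r * xst k))\<^sup>2 \<le> real n * ln (real n / (r * xst k)) - real n + r * xst k"
    by (rule entropy_ge) (use p in auto)
  also have "real n * ln (real n / (r * xst k)) = real n * ln (real n) - real n * ln (r * xst k)"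
    using p by (cases "n = 0") (auto simp: ln_div right_diff_distrib)
  finally show ?thesis using ln_fact_ge[of n] by (simp add: Phi_def)
qed

lemma Phi_nonneg: "0 < r \<Longrightarrow> 0 \<le> Phi r k n"
  using Phi_lower[of r n k] zero_le_power2[of "sqrt (real n) - sqrt (r * xst k)"] by linarith

lemma Phi_upper:
  assumes "0 < r"
  shows "Phi r k n \<le> (real n + 1 - r * xst k)\<^sup>2 / (r * xst k) + 1 + ln (r * xst k)"
proof -
  have p: "0 < r * xst k" using assms xst_pos by simp
  have "Phi r k n \<le> (real n + 1) * ln (real n + 1) - real n - real n * ln (r * xst k) + r * xst k"
    using ln_fact_le[of n] by (simp add: Phi_def)
  also have "\<dots> = ((real n + 1) * ln ((real n + 1) / (r * xst k)) - (real n + 1) + r * xst k) + 1 + ln (r * xst k)"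
  proof -
    have "(real n + 1) * ln (real n + 1) - real n - real n * ln q + q
        = ((real n + 1) * ln ((real n + 1) / q) - (real n + 1) + q) + 1 + ln q" if "0 < q" for q
      using that by (simp add: ln_div algebra_simps)
    from this[OF p] show ?thesis .
  qed
  also have "(real n + 1) * ln ((real n + 1) / (r * xst k)) - (real n + 1) + r * xst k \<le> (real n + 1 - r * xst k)\<^sup>2 / (r * xst k)"
    by (rule entropy_le) (use p in auto)
  finally show ?thesis by simp
qed

text \<open>The converse comparison: since relative counts are within a multiple of the discrepancy
  from 1, the entropy is at most quadratic in it. Decay in terms of dissipation thereby becomes
  decay proportional to \<open>lyap\<close>.\<close>

lemma lyap_upper:
  obtains C where "1 \<le> C" "\<And>r X. region r X \<Longrightarrow> lyap r X \<le> C * (r * (discrepancy r X)\<^sup>2) + C * ln r + ln r * (r * load_dev_sq r X)"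
proof -
  obtain C1 where C1: "0 < C1" "\<And>r X k. region r X \<Longrightarrow> k \<in> Kb \<Longrightarrow> \<bar>rel_count r X k - 1\<bar> \<le> C1 * discrepancy r X" using equilibrium_gap by metis
  define c where "c = (\<Sum>k\<in>K. xst k * C1\<^sup>2)"
  define d where "d = (\<Sum>k\<in>K. 2 + \<bar>ln (xst k)\<bar>)"
  have cd: "0 \<le> c" "0 \<le> d" unfolding c_def d_def using xst_pos by (auto intro!: sum_nonneg simp: less_imp_le)
  show thesis
  proof (rule that[of "1 + c + d"])
    show "1 \<le> 1 + c + d" using cd by simp
    fix r X assume reg: "region r X"
    note b = region_bounds[OF reg]
    have r: "0 < r" using b(1) by simp
    have "(\<Sum>k\<in>K. Phi r k (X k)) \<le> (\<Sum>k\<in>K. xst k * C1\<^sup>2 * (r * (discrepancy r X)\<^sup>2) + (2 + \<bar>ln (xst k)\<bar>) * ln r)"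
    proof (rule sum_mono)
      fix k assume "k \<in> K"
      then have kb: "k \<in> Kb" by (simp add: Kset_def)
      have x: "0 < xst k" by (rule xst_pos)
      have "\<bar>rel_count r X k - 1\<bar>\<^sup>2 \<le> (C1 * discrepancy r X)\<^sup>2" using C1(2)[OF reg kb] by (intro power_mono) auto
      then have y2: "(rel_count r X k - 1)\<^sup>2 \<le> C1\<^sup>2 * (discrepancy r X)\<^sup>2" by (simp add: power_mult_distrib)
      have "real (X k) + 1 - r * xst k = r * xst k * (rel_count r X k - 1)"
        using r x by (simp add: rel_count_def right_diff_distrib)
      then have "(real (X k) + 1 - r * xst k)\<^sup>2 / (r * xst k) = r * xst k * (rel_count r X k - 1)\<^sup>2"
        using r x by (simp add: power2_eq_square)
      also have "\<dots> \<le> r * xst k * (C1\<^sup>2 * (discrepancy r X)\<^sup>2)" using y2 r x by (intro mult_left_mono) auto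
      finally have 1: "(real (X k) + 1 - r * xst k)\<^sup>2 / (r * xst k) \<le> xst k * C1\<^sup>2 * (r * (discrepancy r X)\<^sup>2)"
        by (simp add: ac_simps)
      have "1 + ln (r * xst k) \<le> 1 + ln r + \<bar>ln (xst k)\<bar>" using r x by (simp add: ln_mult)
      also have "\<dots> \<le> (2 + \<bar>ln (xst k)\<bar>) * ln r"
        using b(2) mult_left_mono[OF b(2), of "\<bar>ln (xst k)\<bar>"] by (simp add: distrib_right)
      finally show "Phi r k (X k) \<le> xst k * C1\<^sup>2 * (r * (discrepancy r X)\<^sup>2) + (2 + \<bar>ln (xst k)\<bar>) * ln r"
        using Phi_upper[OF r, of k "X k"] 1 by linarith
    qed
    also have "\<dots> = c * (r * (discrepancy r X)\<^sup>2) + d * ln r"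
      unfolding c_def d_def sum_distrib_right by (rule sum.distrib)
    also have "\<dots> \<le> (1 + c + d) * (r * (discrepancy r X)\<^sup>2) + (1 + c + d) * ln r"
      using cd r b(1,2) by (intro add_mono mult_right_mono) auto
    finally show "lyap r X \<le> (1 + c + d) * (r * (discrepancy r X)\<^sup>2) + (1 + c + d) * ln r + ln r * (r * load_dev_sq r X)"
      by (simp add: lyap_def)
  qed
qed


text \<open>The exact change of \<open>ln r * (r * load_dev_sq r X)\<close> when the load of type
  \<open>i\<close> grows by one; \<open>quad_jump_down\<close> is the change when it falls by
  one.\<close>

definition quad_jump_up :: "real \<Rightarrow> (('i \<Rightarrow> nat) \<Rightarrow> nat) \<Rightarrow> 'i \<Rightarrow> real" where
  "quad_jump_up r X i = ln r * (2 * load_dev r X i + 1 / r)"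

definition quad_jump_down :: "real \<Rightarrow> (('i \<Rightarrow> nat) \<Rightarrow> nat) \<Rightarrow> 'i \<Rightarrow> real" where
  "quad_jump_down r X i = ln r * (- 2 * load_dev r X i + 1 / r)"

text \<open>By \<open>exp x \<le> 1 + x + x\<^sup>2\<close> this bounds the generator on
  \<open>exp (\<eta> * lyap)\<close> divided by \<open>\<eta> * exp (\<eta> * lyap)\<close>.\<close>

definition drift :: "real \<Rightarrow> real \<Rightarrow> (('i \<Rightarrow> nat) \<Rightarrow> nat) \<Rightarrow> real" where
  "drift \<eta> r X = (\<Sum>i\<in>UNIV. \<Sum>k\<in>Admit i.
     up_rate r X i * real (X k) * ((jump_up r X i k + quad_jump_up r X i) + \<eta> * (jump_up r X i k + quad_jump_up r X i)\<^sup>2)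
     + down_rate i k * real (X (k + unitv i)) * ((jump_down r X i k + quad_jump_down r X i) + \<eta> * (jump_down r X i k + quad_jump_down r X i)\<^sup>2))"

definition quad_drift :: "real \<Rightarrow> (('i \<Rightarrow> nat) \<Rightarrow> nat) \<Rightarrow> real" where
  "quad_drift r X = (\<Sum>i\<in>UNIV. lam i * r * quad_jump_up r X i + mu i * real (type_load X i) * quad_jump_down r X i)"

definition quad_sq_drift :: "real \<Rightarrow> (('i \<Rightarrow> nat) \<Rightarrow> nat) \<Rightarrow> real" where
  "quad_sq_drift r X = (\<Sum>i\<in>UNIV. lam i * r * (quad_jump_up r X i)\<^sup>2 + mu i * real (type_load X i) * (quad_jump_down r X i)\<^sup>2)"

lemma edge_sum:
  assumes "region r X"
  shows "(\<Sum>k\<in>Admit i. up_rate r X i * real (X k) * p + down_rate i k * real (X (k + unitv i)) * q)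
    = lam i * r * p + mu i * real (type_load X i) * q"
proof -
  have "(\<Sum>k\<in>Admit i. up_rate r X i * real (X k) * p) = up_rate r X i * real (admit_count X i) * p"
    by (simp add: admit_count_def sum_distrib_left sum_distrib_right)
  then show ?thesis
    unfolding sum.distrib up_rate_admit_count[OF assms] Zi_excess[symmetric] by (simp add: sum_distrib_right)
qed

lemma drift_split:
  assumes reg: "region r X" and "0 \<le> \<eta>"
  shows "drift \<eta> r X \<le> entropy_drift r X + quad_drift r X + 2 * \<eta> * entropy_sq_drift r X + 2 * \<eta> * quad_sq_drift r X"
proof -
  have "drift \<eta> r X \<le> (\<Sum>i\<in>UNIV. \<Sum>k\<in>Admit i.
      (up_rate r X i * real (X k) * jump_up r X i k + down_rate i k * real (X (k + unitv i)) * jump_down r X i k)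
    + (up_rate r X i * real (X k) * quad_jump_up r X i + down_rate i k * real (X (k + unitv i)) * quad_jump_down r X i)
    + 2 * \<eta> * (up_rate r X i * real (X k) * (jump_up r X i k)\<^sup>2 + down_rate i k * real (X (k + unitv i)) * (jump_down r X i k)\<^sup>2)
    + 2 * \<eta> * (up_rate r X i * real (X k) * (quad_jump_up r X i)\<^sup>2 + down_rate i k * real (X (k + unitv i)) * (quad_jump_down r X i)\<^sup>2))"
    unfolding drift_def
  proof (intro sum_mono)
    fix i k
    have 1: "c * ((d + p) + \<eta> * (d + p)\<^sup>2) \<le> c * d + c * p + 2 * \<eta> * (c * d\<^sup>2) + 2 * \<eta> * (c * p\<^sup>2)"
      if "0 \<le> c" for c d p :: real
    proof -
      have "c * (\<eta> * (d + p)\<^sup>2) \<le> c * (\<eta> * (2 * d\<^sup>2 + 2 * p\<^sup>2))"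
        using that assms(2) sum_sq_le2 by (intro mult_left_mono) auto
      then show ?thesis by (simp add: algebra_simps)
    qed
    have "0 \<le> up_rate r X i * real (X k)" "0 \<le> down_rate i k * real (X (k + unitv i))"
      using up_rate_pos[OF reg, of i] down_rate_pos[of i k] by auto
    from 1[OF this(1), of "jump_up r X i k" "quad_jump_up r X i"] 1[OF this(2), of "jump_down r X i k" "quad_jump_down r X i"]
    show "up_rate r X i * real (X k) * ((jump_up r X i k + quad_jump_up r X i) + \<eta> * (jump_up r X i k + quad_jump_up r X i)\<^sup>2)
     + down_rate i k * real (X (k + unitv i)) * ((jump_down r X i k + quad_jump_down r X i) + \<eta> * (jump_down r X i k + quad_jump_down r X i)\<^sup>2)
     \<le> (up_rate r X i * real (X k) * jump_up r X i k + down_rate i k * real (X (k + unitv i)) * jump_down r X i k)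
    + (up_rate r X i * real (X k) * quad_jump_up r X i + down_rate i k * real (X (k + unitv i)) * quad_jump_down r X i)
    + 2 * \<eta> * (up_rate r X i * real (X k) * (jump_up r X i k)\<^sup>2 + down_rate i k * real (X (k + unitv i)) * (jump_down r X i k)\<^sup>2)
    + 2 * \<eta> * (up_rate r X i * real (X k) * (quad_jump_up r X i)\<^sup>2 + down_rate i k * real (X (k + unitv i)) * (quad_jump_down r X i)\<^sup>2)"
      unfolding distrib_left[of "2 * \<eta>"] by linarith
  qed
  also have "\<dots> = entropy_drift r X + quad_drift r X + 2 * \<eta> * entropy_sq_drift r X + 2 * \<eta> * quad_sq_drift r X"
  proof -
    have "quad_drift r X = (\<Sum>i\<in>UNIV. \<Sum>k\<in>Admit i. up_rate r X i * real (X k) * quad_jump_up r X i + down_rate i k * real (X (k + unitv i)) * quad_jump_down r X i)"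
      "quad_sq_drift r X = (\<Sum>i\<in>UNIV. \<Sum>k\<in>Admit i. up_rate r X i * real (X k) * (quad_jump_up r X i)\<^sup>2 + down_rate i k * real (X (k + unitv i)) * (quad_jump_down r X i)\<^sup>2)"
      unfolding quad_drift_def quad_sq_drift_def edge_sum[OF reg] by simp_all
    moreover have split: "(\<Sum>i\<in>(UNIV::'i set). \<Sum>k\<in>Admit i. f1 i k + f2 i k + 2 * \<eta> * f3 i k + 2 * \<eta> * f4 i k)
       = (\<Sum>i\<in>UNIV. \<Sum>k\<in>Admit i. f1 i k) + (\<Sum>i\<in>UNIV. \<Sum>k\<in>Admit i. f2 i k)
         + 2 * \<eta> * (\<Sum>i\<in>UNIV. \<Sum>k\<in>Admit i. f3 i k) + 2 * \<eta> * (\<Sum>i\<in>UNIV. \<Sum>k\<in>Admit i. f4 i k)" for f1 f2 f3 f4 :: "'i \<Rightarrow> ('i \<Rightarrow> nat) \<Rightarrow> real"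
      unfolding sum.distrib sum_distrib_left ..
    ultimately show ?thesis by (simp only: entropy_drift_def entropy_sq_drift_def split)
  qed
  finally show ?thesis .
qed

lemma load_dev_le_1: "region r X \<Longrightarrow> \<bar>load_dev r X i\<bar> \<le> 1"
proof -
  assume "region r X"
  then have "\<bar>load_dev r X i\<bar> \<le> 1 / (2 * real CARD('i))" by (simp add: region_def)
  also have "\<dots> \<le> 1"
  proof -
    have "1 / (2 * c) \<le> 1" if "1 \<le> c" for c :: real using that by (simp add: field_simps)
    moreover have "1 \<le> real CARD('i)" using one_le_card_finite[where 'a='i] by linarith
    ultimately show ?thesis .
  qed
  finally show ?thesis .
qed

lemma type_load_eq: "region r X \<Longrightarrow> real (type_load X i) = r * (load_dev r X i + rho i)"
  using region_bounds(1)[of r X] by (simp add: load_dev_def)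

text \<open>Mean reversion: arrivals minus departures of type \<open>i\<close> amount to
  \<open>- r * mu i\<close> times the load deviation. The additive term comes from the summand
  \<open>1 / r\<close> of the jumps, incurred at a total rate of order \<open>r\<close>.\<close>

lemma quad_drift_bound:
  obtains m C where "0 < m" "0 \<le> C" "\<And>r X. region r X \<Longrightarrow> quad_drift r X \<le> - 2 * m * (ln r * (r * load_dev_sq r X)) + C * ln r"
proof -
  define m where "m = Min (range mu)"
  have m: "0 < m" and m_le: "m \<le> mu i" for i unfolding m_def using mu_pos by (auto simp: Min_gr_iff)
  define C where "C = (\<Sum>i\<in>UNIV. 2 * lam i + mu i)"
  show thesis
  proof (rule that[OF m])
    show "0 \<le> C" unfolding C_def using lam_pos mu_pos by (intro sum_nonneg add_nonneg_nonneg) (auto simp: less_imp_le)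
    fix r X assume reg: "region r X"
    note b = region_bounds[OF reg]
    have r: "0 < r" using b(1) by simp
    have "quad_drift r X \<le> (\<Sum>i\<in>UNIV. - 2 * m * (ln r * (r * (load_dev r X i)\<^sup>2)) + (2 * lam i + mu i) * ln r)"
      unfolding quad_drift_def
    proof (rule sum_mono)
      fix i
      define z where "z = load_dev r X i"
      have z: "z \<le> 1" using load_dev_le_1[OF reg, of i] by (simp add: z_def)
      have ml: "mu i * rho i = lam i" using mu_pos[of i] by simp
      have Z: "mu i * real (type_load X i) = r * (mu i * z + lam i)"
      proof -
        have "m * (r * (z + q)) = r * (m * z + m * q)" for m q :: real by (simp add: algebra_simps)
        from this[of "mu i" "rho i"] show ?thesis unfolding type_load_eq[OF reg] z_def[symmetric] ml .
      qed
      have "lam i * r * quad_jump_up r X i + mu i * real (type_load X i) * quad_jump_down r X i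
          = ln r * (- 2 * (mu i * (r * z\<^sup>2)) + (2 * lam i + mu i * z))"
        unfolding Z quad_jump_up_def quad_jump_down_def z_def[symmetric] using r by (simp add: field_simps power2_eq_square)
      also have "\<dots> \<le> ln r * (- 2 * (m * (r * z\<^sup>2)) + (2 * lam i + mu i * 1))"
      proof (rule mult_left_mono)
        have "m * (r * z\<^sup>2) \<le> mu i * (r * z\<^sup>2)" using m_le r by (intro mult_right_mono) auto
        moreover have "mu i * z \<le> mu i * 1" using z mu_pos[of i] by (intro mult_left_mono) auto
        ultimately show "- 2 * (mu i * (r * z\<^sup>2)) + (2 * lam i + mu i * z) \<le> - 2 * (m * (r * z\<^sup>2)) + (2 * lam i + mu i * 1)"
          by linarith
      qed (use b(2) in simp)
      finally show "lam i * r * quad_jump_up r X i + mu i * real (type_load X i) * quad_jump_down r X i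
          \<le> - 2 * m * (ln r * (r * (load_dev r X i)\<^sup>2)) + (2 * lam i + mu i) * ln r"
        unfolding z_def by (simp add: algebra_simps)
    qed
    also have "\<dots> = - 2 * m * (ln r * (r * load_dev_sq r X)) + C * ln r"
    proof -
      have "(\<Sum>i\<in>UNIV. - 2 * m * (ln r * (r * (load_dev r X i)\<^sup>2))) = - 2 * m * (ln r * (r * load_dev_sq r X))"
        unfolding load_dev_sq_def sum_distrib_left ..
      moreover have "(\<Sum>i\<in>UNIV. (2 * lam i + mu i) * ln r) = C * ln r"
        unfolding C_def sum_distrib_right ..
      ultimately show ?thesis unfolding sum.distrib by simp
    qed
    finally show "quad_drift r X \<le> - 2 * m * (ln r * (r * load_dev_sq r X)) + C * ln r" .
  qed
qed

text \<open>One of the factors \<open>ln r\<close> on the right is cancelled later by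
  \<open>\<eta> = \<kappa> / ln r\<close>.\<close>

lemma quad_sq_drift_bound:
  obtains C where "1 \<le> C" "\<And>r X. region r X \<Longrightarrow> quad_sq_drift r X \<le> C * (ln r * (ln r * (r * load_dev_sq r X) + ln r))"
proof -
  define c where "c i = lam i + (mu i + lam i)" for i
  have c: "0 \<le> c i" for i using lam_pos[of i] mu_pos[of i] by (simp add: c_def)
  have c_le: "c i \<le> (\<Sum>i\<in>UNIV. c i)" for i using c by (intro member_le_sum) auto
  define s where "s = (\<Sum>i\<in>UNIV. c i)"
  have s: "0 \<le> s" unfolding s_def using c by (intro sum_nonneg)
  define N where "N = real CARD('i)"
  have N: "0 \<le> N" by (simp add: N_def)
  show thesis
  proof (rule that[of "1 + 8 * s + 2 * N * s"])
    show "1 \<le> 1 + 8 * s + 2 * N * s" using s N by simp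
    fix r X assume reg: "region r X"
    note b = region_bounds[OF reg]
    have r: "0 < r" using b(1) by simp
    have l: "0 \<le> ln r" using b(2) by simp
    have "quad_sq_drift r X \<le> (\<Sum>i\<in>UNIV. 8 * s * ((ln r)\<^sup>2 * (r * (load_dev r X i)\<^sup>2)) + 2 * s * (ln r)\<^sup>2)"
      unfolding quad_sq_drift_def
    proof (rule sum_mono)
      fix i
      define z where "z = load_dev r X i"
      have z: "\<bar>z\<bar> \<le> 1" using load_dev_le_1[OF reg, of i] by (simp add: z_def)
      have ml: "mu i * rho i = lam i" using mu_pos[of i] by simp
      have "mu i * z \<le> mu i * 1" using z mu_pos[of i] by (intro mult_left_mono) auto
      then have "r * (mu i * z + lam i) \<le> r * (mu i + lam i)" using r by (intro mult_left_mono) auto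
      moreover have "mu i * real (type_load X i) = r * (mu i * z + lam i)"
      proof -
        have "m * (r * (z + q)) = r * (m * z + m * q)" for m q :: real by (simp add: algebra_simps)
        from this[of "mu i" "rho i"] show ?thesis unfolding type_load_eq[OF reg] z_def[symmetric] ml .
      qed
      ultimately have Z: "mu i * real (type_load X i) \<le> r * (mu i + lam i)" by simp
      have P: "(ln r * (\<sigma> * 2 * z + 1 / r))\<^sup>2 \<le> (ln r)\<^sup>2 * (8 * z\<^sup>2 + 2 / r)" if "\<sigma> = 1 \<or> \<sigma> = -1" for \<sigma> :: real
      proof -
        have "(\<sigma> * 2 * z + 1 / r)\<^sup>2 \<le> 2 * (\<sigma> * 2 * z)\<^sup>2 + 2 * (1 / r)\<^sup>2" by (rule sum_sq_le2)
        also have "(\<sigma> * 2 * z)\<^sup>2 = 4 * z\<^sup>2" using that by auto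
        also have "(1 / r)\<^sup>2 \<le> 1 / r" using b(1) by (simp add: power2_eq_square field_simps)
        finally show ?thesis unfolding power_mult_distrib by (intro mult_left_mono) auto
      qed
      have "lam i * r * (quad_jump_up r X i)\<^sup>2 + mu i * real (type_load X i) * (quad_jump_down r X i)\<^sup>2
        \<le> lam i * r * ((ln r)\<^sup>2 * (8 * z\<^sup>2 + 2 / r)) + r * (mu i + lam i) * ((ln r)\<^sup>2 * (8 * z\<^sup>2 + 2 / r))"
      proof (rule add_mono)
        show "lam i * r * (quad_jump_up r X i)\<^sup>2 \<le> lam i * r * ((ln r)\<^sup>2 * (8 * z\<^sup>2 + 2 / r))"
          using P[of 1] lam_pos[of i] r unfolding quad_jump_up_def z_def by (intro mult_left_mono) auto
        show "mu i * real (type_load X i) * (quad_jump_down r X i)\<^sup>2 \<le> r * (mu i + lam i) * ((ln r)\<^sup>2 * (8 * z\<^sup>2 + 2 / r))"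
          using P[of "-1"] unfolding quad_jump_down_def z_def by (intro mult_mono[OF Z]) (use r mu_pos[of i] lam_pos[of i] in auto)
      qed
      also have "\<dots> = c i * (r * ((ln r)\<^sup>2 * (8 * z\<^sup>2 + 2 / r)))"
      proof -
        have "x * r * q + r * y * q = (x + y) * (r * q)" for x y q :: real by (simp add: algebra_simps)
        then show ?thesis unfolding c_def .
      qed
      also have "\<dots> \<le> s * (r * ((ln r)\<^sup>2 * (8 * z\<^sup>2 + 2 / r)))"
        using c_le[of i] r by (intro mult_right_mono) (auto simp: s_def)
      also have "\<dots> = 8 * s * ((ln r)\<^sup>2 * (r * z\<^sup>2)) + 2 * s * (ln r)\<^sup>2"
        using r by (simp add: field_simps)
      finally show "lam i * r * (quad_jump_up r X i)\<^sup>2 + mu i * real (type_load X i) * (quad_jump_down r X i)\<^sup>2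
        \<le> 8 * s * ((ln r)\<^sup>2 * (r * (load_dev r X i)\<^sup>2)) + 2 * s * (ln r)\<^sup>2" by (simp add: z_def)
    qed
    also have "\<dots> = 8 * s * ((ln r)\<^sup>2 * (r * load_dev_sq r X)) + 2 * N * s * (ln r)\<^sup>2"
      unfolding sum.distrib load_dev_sq_def sum_distrib_left by (simp add: N_def)
    also have "\<dots> \<le> (1 + 8 * s + 2 * N * s) * ((ln r)\<^sup>2 * (r * load_dev_sq r X)) + (1 + 8 * s + 2 * N * s) * (ln r)\<^sup>2"
      using s N r load_dev_sq_nonneg[of r X] by (intro add_mono mult_right_mono) auto
    also have "\<dots> = (1 + 8 * s + 2 * N * s) * (ln r * (ln r * (r * load_dev_sq r X) + ln r))"
      by (simp add: power2_eq_square algebra_simps)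
    finally show "quad_sq_drift r X \<le> (1 + 8 * s + 2 * N * s) * (ln r * (ln r * (r * load_dev_sq r X) + ln r))" .
  qed
qed

text \<open>The cross term of discrepancy and load deviation is split so that the discrepancy part
  costs an eighth of the dissipation; the load part is of order \<open>r * load_dev_sq\<close> and
  is absorbed by the weight \<open>ln r\<close> once \<open>r\<close> is large.\<close>

lemma drift_bound:
  assumes "0 < \<kappa>0"
  obtains \<kappa> c C r0 where "0 < \<kappa>" "\<kappa> \<le> \<kappa>0" "0 < c" "0 < C"
    "\<And>r X. r0 \<le> r \<Longrightarrow> region r X \<Longrightarrow> drift (\<kappa> / ln r) r X \<le> - c * lyap r X + C * ln r"
proof -
  obtain Ca where Ca: "1 \<le> Ca" "\<And>r X. region r X \<Longrightarrow> entropy_drift r X \<le> - dissipation r X + Ca * (r * (discrepancy r X * (load_dev_sum r X + 1 / r))) + Ca * ln r"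
    using first_order by metis
  obtain Cg where Cg: "1 \<le> Cg" "\<And>r X. region r X \<Longrightarrow> entropy_sq_drift r X \<le> Cg * (ln r * dissipation r X + r * (discrepancy r X)\<^sup>2 + 1)"
    using second_order by metis
  obtain Cs where Cs: "1 \<le> Cs" "\<And>r X. region r X \<Longrightarrow> r * (discrepancy r X)\<^sup>2 \<le> Cs * (dissipation r X + r * load_dev_sq r X + 1)"
    using discrepancy_sq by metis
  obtain m Cl where Cl: "0 < m" "0 \<le> Cl" "\<And>r X. region r X \<Longrightarrow> quad_drift r X \<le> - 2 * m * (ln r * (r * load_dev_sq r X)) + Cl * ln r"
    using quad_drift_bound by metis
  obtain Cm where Cm: "1 \<le> Cm" "\<And>r X. region r X \<Longrightarrow> quad_sq_drift r X \<le> Cm * (ln r * (ln r * (r * load_dev_sq r X) + ln r))"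
    using quad_sq_drift_bound by metis
  obtain Ch where Ch: "1 \<le> Ch" "\<And>r X. region r X \<Longrightarrow> lyap r X \<le> Ch * (r * (discrepancy r X)\<^sup>2) + Ch * ln r + ln r * (r * load_dev_sq r X)"
    using lyap_upper by metis
  define N where "N = real CARD('i)"
  have N: "1 \<le> N" unfolding N_def using one_le_card_finite[where 'a='i] by linarith
  \<comment> \<open>The second bound makes the quadratic contribution of the entropy at most an
    eighth of \<open>D + z + 1\<close>; the third lets that of the load part use at most half of its
    mean reversion.\<close>
  define \<kappa> where "\<kappa> = min \<kappa>0 (min (1 / (32 * Cg * Cs)) (m / (2 * Cm)))"
  define Ce where "Ce = 4 * Ca\<^sup>2 * Cs * N"
  define C5 where "C5 = 1 / 4 + Ce + Ca + Cl + m"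
  define Cq where "Cq = 2 * Ch * Cs + 1"
  \<comment> \<open>\<open>lyap\<close> is at most \<open>Cq\<close> times
    \<open>D + l * z + l\<close>, so this \<open>c\<close> spends exactly the dissipation and mean
    reversion that remain.\<close>
  define c where "c = min (3 / 4) (m / 2) / Cq"
  have pos: "0 < 32 * Cg * Cs" "0 < 2 * Cm" using Cg(1) Cs(1) Cm(1) by auto
  have \<kappa>: "0 < \<kappa>" "\<kappa> \<le> \<kappa>0" using assms Cl(1) pos by (auto simp: \<kappa>_def)
  have \<kappa>1: "\<kappa> * (32 * Cg * Cs) \<le> 1"
  proof -
    have "\<kappa> \<le> 1 / (32 * Cg * Cs)" by (simp add: \<kappa>_def)
    then show ?thesis unfolding pos_le_divide_eq[OF pos(1)] .
  qed
  have \<kappa>2: "\<kappa> * (2 * Cm) \<le> m"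
  proof -
    have "\<kappa> \<le> m / (2 * Cm)" by (simp add: \<kappa>_def)
    then show ?thesis unfolding pos_le_divide_eq[OF pos(2)] .
  qed
  have Ce: "0 \<le> Ce" using Cs(1) N by (simp add: Ce_def)
  have Cq: "1 \<le> Cq" using Ch(1) Cs(1) by (simp add: Cq_def)
  have c: "0 < c" using Cl(1) Cq by (simp add: c_def)
  have cq: "c * Cq \<le> 3 / 4" "c * Cq \<le> m / 2" using Cq by (auto simp: c_def)
  have C5: "0 < C5" using Ce Ca(1) Cl(1,2) by (simp add: C5_def)
  define C where "C = c * Cq + C5"
  have C: "0 < C" using c Cq C5 by (simp add: C_def add_nonneg_pos)
  \<comment> \<open>From here on \<open>m * ln r \<ge> 2 * (1 / 4 + Ce)\<close>, so all errors
    proportional to \<open>z\<close> fit into \<open>m / 2 * (l * z)\<close>.\<close>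
  define r0 where "r0 = exp (2 * (1 / 4 + Ce) / m)"
  show thesis
  proof (rule that[OF \<kappa> c C])
    fix r X assume r0: "r0 \<le> r" and reg: "region r X"
    note b = region_bounds[OF reg]
    have r: "0 < r" using b(1) by simp
    define l where "l = ln r"
    have l: "1 \<le> l" using b(2) by (simp add: l_def)
    have l0: "2 * (1 / 4 + Ce) \<le> m * l"
    proof -
      have "2 * (1 / 4 + Ce) / m \<le> l"
        unfolding l_def using r r0 by (simp add: r0_def ln_ge_iff)
      then show ?thesis using Cl(1) by (simp add: field_simps)
    qed
    define D where "D = dissipation r X"
    define z where "z = r * load_dev_sq r X"
    define s where "s = r * (discrepancy r X)\<^sup>2"
    have D: "0 \<le> D" using dissipation_nonneg[OF reg] by (simp add: D_def)
    have z: "0 \<le> z" using load_dev_sq_nonneg[of r X] r by (simp add: z_def)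
    have s: "0 \<le> s" using r by (simp add: s_def)
    have s_le: "s \<le> Cs * (D + z + 1)" using Cs(2)[OF reg] by (simp add: s_def D_def z_def)
    have zl: "z \<le> l * z" using l z mult_right_mono[OF l z] by simp
    have g1: "entropy_drift r X \<le> - D + (D + z + 1) / 8 + Ce * (z + 1) + Ca * l"
    proof -
      define u where "u = load_dev_sum r X + 1 / r"
      have "r * u\<^sup>2 \<le> 2 * N * z + 2"
      proof -
        have "u\<^sup>2 \<le> 2 * (load_dev_sum r X)\<^sup>2 + 2 * (1 / r)\<^sup>2" unfolding u_def by (rule sum_sq_le2)
        then have "r * u\<^sup>2 \<le> r * (2 * (load_dev_sum r X)\<^sup>2 + 2 * (1 / r)\<^sup>2)" using r by (intro mult_left_mono) auto
        also have "\<dots> = 2 * (r * (load_dev_sum r X)\<^sup>2) + 2 * (1 / r)" using r by (simp add: field_simps power2_eq_square)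
        also have "\<dots> \<le> 2 * (r * (N * load_dev_sq r X)) + 2 * 1"
          using load_dev_sum_sq[of r X] b(1) by (intro add_mono mult_left_mono) (auto simp: N_def)
        finally show ?thesis by (simp add: z_def ac_simps)
      qed
      moreover have "2 * N * z + 2 \<le> 2 * N * (z + 1)" using N by (simp add: algebra_simps)
      ultimately have u2: "r * u\<^sup>2 \<le> 2 * N * (z + 1)" by linarith
      \<comment> \<open>Chosen so that \<open>Ca * \<epsilon> * Cs = 1 / 8\<close>; the
        complementary term then has the constant \<open>Ce\<close>.\<close>
      define \<epsilon> where "\<epsilon> = 1 / (8 * Ca * Cs)"
      have \<epsilon>: "0 < \<epsilon>" using Ca(1) Cs(1) by (simp add: \<epsilon>_def)
      have "discrepancy r X * u \<le> \<epsilon> * (discrepancy r X)\<^sup>2 + 1 / (4 * \<epsilon>) * u\<^sup>2"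
      proof -
        have "0 \<le> (2 * \<epsilon> * discrepancy r X - u)\<^sup>2 / (4 * \<epsilon>)" using \<epsilon> by simp
        also have "\<dots> = \<epsilon> * (discrepancy r X)\<^sup>2 + 1 / (4 * \<epsilon>) * u\<^sup>2 - discrepancy r X * u"
          using \<epsilon> by (simp add: field_simps power2_eq_square)
        finally show ?thesis by simp
      qed
      then have "r * (discrepancy r X * u) \<le> r * (\<epsilon> * (discrepancy r X)\<^sup>2 + 1 / (4 * \<epsilon>) * u\<^sup>2)"
        using r by (intro mult_left_mono) auto
      also have "\<dots> = \<epsilon> * s + 1 / (4 * \<epsilon>) * (r * u\<^sup>2)" by (simp add: s_def algebra_simps)
      also have "\<dots> \<le> \<epsilon> * (Cs * (D + z + 1)) + 1 / (4 * \<epsilon>) * (2 * N * (z + 1))"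
        using s_le u2 \<epsilon> by (intro add_mono mult_left_mono) auto
      finally have "Ca * (r * (discrepancy r X * u)) \<le> Ca * (\<epsilon> * (Cs * (D + z + 1)) + 1 / (4 * \<epsilon>) * (2 * N * (z + 1)))"
        using Ca(1) by (intro mult_left_mono) auto
      also have "\<dots> = (D + z + 1) / 8 + Ce * (z + 1)"
      proof -
        have "Ca * (\<epsilon> * (Cs * t)) = t / 8" for t using Ca(1) Cs(1) by (simp add: \<epsilon>_def)
        moreover have "Ca * (1 / (4 * \<epsilon>) * (2 * N * t)) = Ce * t" for t
          using Ca(1) Cs(1) by (simp add: \<epsilon>_def Ce_def power2_eq_square)
        ultimately show ?thesis by (simp only: distrib_left[of Ca])
      qed
      finally show ?thesis using Ca(2)[OF reg] by (simp add: u_def D_def l_def)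
    qed
    define \<eta> where "\<eta> = \<kappa> / l"
    have \<eta>: "0 \<le> \<eta>" "\<eta> * l = \<kappa>" "\<eta> \<le> \<kappa>" using \<kappa>(1) l by (auto simp: \<eta>_def field_simps mult_le_cancel_left1)
    have g2: "2 * \<eta> * entropy_sq_drift r X \<le> (D + z + 1) / 8"
    proof -
      have t: "0 \<le> D + z + 1" using D z by simp
      have "2 * \<eta> * entropy_sq_drift r X \<le> 2 * \<eta> * (Cg * (l * D + s + 1))"
        using Cg(2)[OF reg] \<eta>(1) by (intro mult_left_mono) (auto simp: l_def D_def s_def)
      also have "\<dots> = 2 * Cg * ((\<eta> * l) * D + \<eta> * (s + 1))" by (simp add: algebra_simps)
      also have "\<dots> \<le> 2 * Cg * (\<kappa> * D + \<kappa> * (s + 1))"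
        unfolding \<eta>(2) using \<eta>(3) s Cg(1) by (intro mult_left_mono add_left_mono mult_right_mono) auto
      also have "\<dots> = 2 * Cg * \<kappa> * (D + s + 1)" by (simp add: algebra_simps)
      also have "\<dots> \<le> 2 * Cg * \<kappa> * (2 * Cs * (D + z + 1))"
      proof (rule mult_left_mono)
        have "D + 1 \<le> Cs * (D + z + 1)" using mult_right_mono[OF Cs(1) t] z by simp
        then show "D + s + 1 \<le> 2 * Cs * (D + z + 1)" using s_le by simp
      qed (use Cg(1) \<kappa>(1) in simp)
      also have "\<dots> = (\<kappa> * (32 * Cg * Cs)) * ((D + z + 1) / 8)" by simp
      also have "\<dots> \<le> 1 * ((D + z + 1) / 8)" using \<kappa>1 t by (intro mult_right_mono) auto
      finally show ?thesis by simp
    qed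
    have l2: "2 * \<eta> * quad_sq_drift r X \<le> m * (l * z) + m * l"
    proof -
      have "2 * \<eta> * quad_sq_drift r X \<le> 2 * \<eta> * (Cm * (l * (l * z + l)))"
        using Cm(2)[OF reg] \<eta>(1) by (intro mult_left_mono) (auto simp: l_def z_def)
      also have "\<dots> = ((\<eta> * l) * (2 * Cm)) * (l * z + l)" by (simp add: algebra_simps)
      also have "\<dots> \<le> m * (l * z + l)" unfolding \<eta>(2) using \<kappa>2 l z by (intro mult_right_mono) auto
      finally show ?thesis by (simp add: distrib_left)
    qed
    have l1: "quad_drift r X \<le> - 2 * m * (l * z) + Cl * l" using Cl(3)[OF reg] by (simp add: l_def z_def)
    have "drift \<eta> r X \<le> - (3 / 4) * D - (m / 2) * (l * z) + C5 * l"
    proof -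
      have "(1 / 4 + Ce) * z \<le> (m / 2 * l) * z" using l0 z by (intro mult_right_mono) auto
      then have 1: "z / 4 + Ce * z \<le> (m / 2) * (l * z)" by (simp add: algebra_simps)
      have "(1 / 4 + Ce) * 1 \<le> (1 / 4 + Ce) * l" using l Ce by (intro mult_left_mono) auto
      then have 2: "1 / 4 + Ce \<le> l / 4 + Ce * l" by (simp add: algebra_simps)
      have 3: "drift \<eta> r X \<le> - D + (D + z + 1) / 8 + (Ce * z + Ce) + Ca * l + (- 2 * (m * (l * z)) + Cl * l) + (D + z + 1) / 8 + (m * (l * z) + m * l)"
      proof -
        have "Ce * (z + 1) = Ce * z + Ce" "- 2 * m * (l * z) = - 2 * (m * (l * z))" by (simp_all add: distrib_left)
        with drift_split[OF reg \<eta>(1)] g1 g2 l1 l2 show ?thesis by linarith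
      qed
      have 4: "C5 * l = l / 4 + Ce * l + Ca * l + Cl * l + m * l" by (simp add: C5_def algebra_simps)
      have 5: "(m / 2) * (l * z) = m * (l * z) / 2" by simp
      from 1 2 3 show ?thesis unfolding 4 5 by argo
    qed
    moreover have "c * lyap r X \<le> 3 / 4 * D + m / 2 * (l * z) + c * Cq * l"
    proof -
      have ChCs: "Ch \<le> Ch * Cs" using Ch(1) Cs(1) mult_left_mono[OF Cs(1), of Ch] by simp
      have "lyap r X \<le> Ch * (Cs * (D + z + 1)) + Ch * l + l * z"
      proof -
        have "lyap r X \<le> Ch * s + Ch * l + l * z" using Ch(2)[OF reg] by (simp add: s_def l_def z_def)
        moreover have "Ch * s \<le> Ch * (Cs * (D + z + 1))" using s_le Ch(1) by (intro mult_left_mono) auto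
        ultimately show ?thesis by linarith
      qed
      also have "\<dots> = (Ch * Cs) * D + ((Ch * Cs) * z + l * z) + ((Ch * Cs) * 1 + Ch * l)" by (simp add: algebra_simps)
      also have "\<dots> \<le> Cq * D + Cq * (l * z) + Cq * l"
      proof (intro add_mono)
        have p: "0 \<le> Ch * Cs" using Ch(1) Cs(1) by simp
        show "(Ch * Cs) * D \<le> Cq * D" using D p by (intro mult_right_mono) (auto simp: Cq_def)
        have "(Ch * Cs) * z \<le> (Ch * Cs) * (l * z)" using zl p by (rule mult_left_mono)
        moreover have "0 \<le> (Ch * Cs) * (l * z)" using p l z by simp
        ultimately show "(Ch * Cs) * z + l * z \<le> Cq * (l * z)" by (simp add: Cq_def distrib_right mult.assoc)
        have "(Ch * Cs) * 1 \<le> (Ch * Cs) * l" using l p by (rule mult_left_mono)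
        moreover have "Ch * l \<le> (Ch * Cs) * l" using ChCs l by (intro mult_right_mono) auto
        ultimately show "(Ch * Cs) * 1 + Ch * l \<le> Cq * l" using l by (simp add: Cq_def distrib_right mult.assoc)
      qed
      finally have "c * lyap r X \<le> c * (Cq * D + Cq * (l * z) + Cq * l)" using c by (intro mult_left_mono) auto
      also have "\<dots> = (c * Cq) * D + (c * Cq) * (l * z) + c * Cq * l" by (simp add: algebra_simps)
      also have "\<dots> \<le> 3 / 4 * D + m / 2 * (l * z) + c * Cq * l"
        using cq D l z Cq by (intro add_mono mult_right_mono) auto
      finally show ?thesis .
    qed
    ultimately have "drift \<eta> r X \<le> - c * lyap r X + C * l" unfolding C_def by (simp add: distrib_right)
    then show "drift (\<kappa> / ln r) r X \<le> - c * lyap r X + C * ln r" by (simp add: \<eta>_def l_def)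
  qed
qed

text \<open>With \<open>\<eta> = \<kappa> / ln r\<close> and \<open>\<kappa> * J \<le> 1\<close> it
  keeps the exponents in the range of \<open>exp_quadratic_bound\<close>. Nonzero counts keep the
  argument of \<open>phi\<close> at least 1.\<close>

lemma jump_bound:
  obtains J where "1 \<le> J"
    "\<And>r X i k. region r X \<Longrightarrow> k \<in> Admit i \<Longrightarrow> X k \<noteq> 0 \<Longrightarrow> \<bar>jump_up r X i k + quad_jump_up r X i\<bar> \<le> J * ln r"
    "\<And>r X i k. region r X \<Longrightarrow> k \<in> Admit i \<Longrightarrow> X (k + unitv i) \<noteq> 0 \<Longrightarrow> \<bar>jump_down r X i k + quad_jump_down r X i\<bar> \<le> J * ln r"
proof -
  obtain Bp where Bp: "1 \<le> Bp"
    "\<And>r X k x. region r X \<Longrightarrow> k \<in> Kb \<Longrightarrow> 1 \<le> x \<Longrightarrow> x \<le> (2 * a + 3) * r \<Longrightarrow> \<bar>phi r k x\<bar> \<le> Bp * ln r"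
    using phi_bound by metis
  have P: "\<bar>quad_jump_up r X i\<bar> \<le> 3 * ln r" "\<bar>quad_jump_down r X i\<bar> \<le> 3 * ln r" if reg: "region r X" for r X i
  proof -
    note b = region_bounds[OF reg]
    have "0 < 1 / r" "1 / r \<le> 1" using b(1) by auto
    then have "\<bar>2 * load_dev r X i + 1 / r\<bar> \<le> 3" "\<bar>- 2 * load_dev r X i + 1 / r\<bar> \<le> 3"
      using load_dev_le_1[OF reg, of i] by linarith+
    then show "\<bar>quad_jump_up r X i\<bar> \<le> 3 * ln r" "\<bar>quad_jump_down r X i\<bar> \<le> 3 * ln r"
      unfolding quad_jump_up_def quad_jump_down_def abs_mult using b(2) by (auto simp: mult.commute[of "\<bar>ln r\<bar>"] intro!: mult_mono)
  qed
  have ph: "\<bar>phi r k (real (X k) + 1)\<bar> \<le> Bp * ln r" "X k \<noteq> 0 \<Longrightarrow> \<bar>phi r k (real (X k))\<bar> \<le> Bp * ln r"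
    if reg: "region r X" and k: "k \<in> Kb" for r X k
    using region_bounds(8)[OF reg k] by (auto intro!: Bp(2)[OF reg k])
  show thesis
  proof (rule that[of "2 * Bp + 3"])
    show "1 \<le> 2 * Bp + 3" using Bp(1) by simp
    fix r X i k assume reg: "region r X" and k: "k \<in> Admit i"
    have kb: "k \<in> Kb" "k + unitv i \<in> Kb" using k by (auto simp: Admit_def)
    show "\<bar>jump_up r X i k + quad_jump_up r X i\<bar> \<le> (2 * Bp + 3) * ln r" if "X k \<noteq> 0"
      using ph(2)[OF reg kb(1) that] ph(1)[OF reg kb(2)] P(1)[OF reg, of i]
      unfolding jump_up_def distrib_right by linarith
    show "\<bar>jump_down r X i k + quad_jump_down r X i\<bar> \<le> (2 * Bp + 3) * ln r" if "X (k + unitv i) \<noteq> 0"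
      using ph(2)[OF reg kb(2) that] ph(1)[OF reg kb(1)] P(2)[OF reg, of i]
      unfolding jump_down_def distrib_right by linarith
  qed
qed


subsection \<open>Concentration of the server counts\<close>

text \<open>The value at \<open>0\<close> is the number \<open>X\<^sub>0 = \<lceil>a Z\<rceil>\<close> used by the algorithm; infinitely many servers are empty.\<close>

definition counts :: "(nat \<Rightarrow> 'i \<Rightarrow> nat) \<Rightarrow> ('i \<Rightarrow> nat) \<Rightarrow> nat" where
  "counts s k = (if k = 0 then X0 a s else card {l. s l = k})"

definition state_lyap :: "real \<Rightarrow> (nat \<Rightarrow> 'i \<Rightarrow> nat) \<Rightarrow> real" where
  "state_lyap r s = lyap r (counts s)"

lemma K_neq_0: "k \<in> K \<Longrightarrow> k \<noteq> 0" by (auto simp: Kset_def)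

lemma sum_occ:
  fixes f :: "('i \<Rightarrow> nat) \<Rightarrow> real"
  assumes "valid_state Kb s"
  shows "(\<Sum>l\<in>occ s. f (s l)) = (\<Sum>k\<in>K. real (counts s k) * f k)"
proof -
  have "(\<Sum>l\<in>occ s. f (s l)) = (\<Sum>k\<in>K. \<Sum>l\<in>{l \<in> occ s. s l = k}. f (s l))"
    using assms by (intro sum.group[symmetric] occ_finite) (auto simp: occ_def Kset_def valid_state_def)
  also have "\<dots> = (\<Sum>k\<in>K. real (counts s k) * f k)"
  proof (rule sum.cong[OF refl])
    fix k assume "k \<in> K"
    then have "k \<noteq> 0" by (rule K_neq_0)
    then have "{l \<in> occ s. s l = k} = {l. s l = k}" by (auto simp: occ_def)
    then show "(\<Sum>l\<in>{l \<in> occ s. s l = k}. f (s l)) = real (counts s k) * f k"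
      using \<open>k \<noteq> 0\<close> by (simp add: counts_def)
  qed
  finally show ?thesis .
qed

lemma type_load_counts:
  assumes "valid_state Kb s"
  shows "type_load (counts s) i = Zi s i"
proof -
  have "real (type_load (counts s) i) = (\<Sum>k\<in>K. real (counts s k) * real (k i))"
    by (simp add: type_load_def mult.commute)
  also have "\<dots> = real (Zi s i)"
    unfolding sum_occ[OF assms, symmetric] by (simp add: Zi_def)
  finally show ?thesis by simp
qed

lemma load_dev_counts: "valid_state Kb s \<Longrightarrow> load_dev r (counts s) i = real (Zi s i) / r - rho i"
  by (simp add: load_dev_def type_load_counts)

lemma region_counts:
  assumes "valid_state Kb s" "exp 1 \<le> r" "\<And>i. \<bar>load_dev r (counts s) i\<bar> \<le> 1 / (2 * real CARD('i))"
  shows "region r (counts s)"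
  using assms by (simp add: region_def counts_def X0_def Ztot_eq type_load_counts)

lemma sum_Admit_split: "(\<Sum>k\<in>Admit i. f k) = f 0 + (\<Sum>k\<in>Admit i - {0}. f k)" for f :: "_ \<Rightarrow> real"
  by (rule sum.remove) auto

lemma sum_acc:
  fixes f :: "('i \<Rightarrow> nat) \<Rightarrow> real"
  assumes "valid_state Kb s"
  shows "(\<Sum>l\<in>acc Kb i s. f (s l)) = (\<Sum>k\<in>Admit i - {0}. real (counts s k) * f k)"
proof -
  have "(\<Sum>l\<in>acc Kb i s. f (s l)) = (\<Sum>l\<in>occ s. if s l + unitv i \<in> Kb then f (s l) else 0)"
    using occ_finite[OF assms] by (intro sum.mono_neutral_cong_left acc_subset) (auto simp: acc_def occ_def Kset_def)
  also have "\<dots> = (\<Sum>k\<in>K. real (counts s k) * (if k + unitv i \<in> Kb then f k else 0))"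
    by (rule sum_occ[OF assms])
  also have "\<dots> = (\<Sum>k\<in>Admit i - {0}. real (counts s k) * f k)"
    by (intro sum.mono_neutral_cong_right) (auto simp: Admit_def Kset_def)
  finally show ?thesis .
qed

lemma Xi_counts:
  assumes "valid_state Kb s"
  shows "Xi Kb a i s = admit_count (counts s) i"
proof -
  have "real (admit_count (counts s) i) = real (X0 a s) + (\<Sum>k\<in>Admit i - {0}. real (counts s k) * 1)"
    unfolding admit_count_def of_nat_sum sum_Admit_split by (simp add: counts_def)
  also have "\<dots> = real (Xi Kb a i s)"
    unfolding sum_acc[OF assms, symmetric, of "\<lambda>_. 1" i] by (simp add: Xi_def Xdiam_def)
  finally show ?thesis by simp
qed

text \<open>The increments depend only on the configuration of the server that changes, so the sum
  over servers becomes one over edges. The first empty server is chosen with the combined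
  probability of the artificial ones and yields the term \<open>k = 0\<close>.\<close>

lemma gen_counts:
  assumes v: "valid_state Kb s" and reg: "region r (counts s)"
    and A: "\<And>i l. l \<in> insert (first_empty s) (acc Kb i s) \<Longrightarrow> g (add_cust s l i) - g s \<le> A i (s l)"
    and B: "\<And>i l. l \<in> occ s \<Longrightarrow> 0 < s l i \<Longrightarrow> g (rem_cust s l i) - g s \<le> B i (s l)"
  shows "gen r g s \<le> (\<Sum>i\<in>UNIV. \<Sum>k\<in>Admit i. up_rate r (counts s) i * real (counts s k) * A i k
    + down_rate i k * real (counts s (k + unitv i)) * B i (k + unitv i))"
proof -
  note fin = occ_finite[OF v]
  have r: "0 \<le> r" using region_bounds(1)[OF reg] by simp
  have X: "admit_count (counts s) i \<noteq> 0" for i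
  proof
    assume "admit_count (counts s) i = 0"
    then have "up_rate r (counts s) i = 0" by (simp add: up_rate_def)
    then show False using up_rate_pos[OF reg, of i] by simp
  qed
  have up: "(\<Sum>l\<in>insert (first_empty s) (acc Kb i s). arr_rate Kb lam a r s i l * (g (add_cust s l i) - g s))
    \<le> (\<Sum>k\<in>Admit i. up_rate r (counts s) i * real (counts s k) * A i k)" for i
  proof -
    have "(\<Sum>l\<in>insert (first_empty s) (acc Kb i s). arr_rate Kb lam a r s i l * (g (add_cust s l i) - g s))
      \<le> (\<Sum>l\<in>insert (first_empty s) (acc Kb i s). arr_rate Kb lam a r s i l * A i (s l))"
      using arr_rate_nonneg[OF r] A by (intro sum_mono mult_left_mono) auto
    also have "\<dots> = up_rate r (counts s) i * (real (X0 a s) * A i 0 + (\<Sum>l\<in>acc Kb i s. A i (s l)))"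
      unfolding arr_rate_sum[OF fin] using X[of i] by (simp add: Xi_counts[OF v] up_rate_def first_empty(2)[OF fin])
    also have "\<dots> = up_rate r (counts s) i * (real (counts s 0) * A i 0 + (\<Sum>k\<in>Admit i - {0}. real (counts s k) * A i k))"
      unfolding sum_acc[OF v] by (simp add: counts_def)
    also have "\<dots> = (\<Sum>k\<in>Admit i. up_rate r (counts s) i * real (counts s k) * A i k)"
      unfolding sum_Admit_split[symmetric, of "\<lambda>k. real (counts s k) * A i k"] by (simp add: sum_distrib_left mult.assoc)
    finally show ?thesis .
  qed
  have down: "(\<Sum>l\<in>{l\<in>occ s. 0 < s l i}. mu i * real (s l i) * (g (rem_cust s l i) - g s))
    \<le> (\<Sum>k\<in>Admit i. down_rate i k * real (counts s (k + unitv i)) * B i (k + unitv i))" for i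
  proof -
    have "(\<Sum>l\<in>{l\<in>occ s. 0 < s l i}. mu i * real (s l i) * (g (rem_cust s l i) - g s))
      \<le> (\<Sum>l\<in>{l\<in>occ s. 0 < s l i}. mu i * real (s l i) * B i (s l))"
      using B mu_pos by (intro sum_mono mult_left_mono) (auto simp: less_imp_le)
    also have "\<dots> = (\<Sum>l\<in>occ s. mu i * real (s l i) * B i (s l))"
      using fin by (intro sum.mono_neutral_left) auto
    also have "\<dots> = (\<Sum>k\<in>K. real (counts s k) * (mu i * real (k i) * B i k))"
      by (rule sum_occ[OF v])
    also have "\<dots> = (\<Sum>k\<in>K. real (k i) * (mu i * real (counts s k) * B i k))"
      by (intro sum.cong) auto
    also have "\<dots> = (\<Sum>k\<in>Admit i. down_rate i k * real (counts s (k + unitv i)) * B i (k + unitv i))"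
      unfolding sum_K_weight by (intro sum.cong) (auto simp: down_rate_def)
    finally show ?thesis .
  qed
  show ?thesis
    unfolding gen_def sum.distrib by (intro add_mono sum_mono up down)
qed

text \<open>Only configurations in \<open>K\<close> enter, so the change of \<open>X0\<close> caused
  by a jump is invisible here.\<close>

definition config_lyap :: "real \<Rightarrow> (nat \<Rightarrow> 'i \<Rightarrow> nat) \<Rightarrow> real" where
  "config_lyap r s = (\<Sum>k\<in>K. Phi r k (card {l. s l = k}))"

lemma state_lyap_eq:
  assumes "valid_state Kb s"
  shows "state_lyap r s = config_lyap r s + ln r * (r * (\<Sum>i\<in>UNIV. (real (Zi s i) / r - rho i)\<^sup>2))"
proof -
  have "(\<Sum>k\<in>K. Phi r k (counts s k)) = config_lyap r s"
    unfolding config_lyap_def using K_neq_0 by (intro sum.cong) (auto simp: counts_def)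
  then show ?thesis by (simp add: state_lyap_def lyap_def load_dev_sq_def load_dev_counts[OF assms])
qed

lemma Phi_Suc:
  assumes "0 < r" "k \<noteq> 0"
  shows "Phi r k (Suc n) = Phi r k n + phi r k (real n + 1)"
proof -
  have "0 < r * xst k" using assms xst_pos by simp
  then have "ln ((real n + 1) / (r * xst k)) = ln (real n + 1) - ln (r * xst k)"
    by (subst ln_div) auto
  moreover have "ln (fact (Suc n)) = ln (real n + 1) + ln (fact n)"
    by (simp add: ln_mult add.commute)
  ultimately show ?thesis using assms by (simp add: Phi_def phi_def algebra_simps)
qed

text \<open>Only the counts of the old and the new configuration change, each by one, and
  \<open>Phi_Suc\<close> is exact; an endpoint 0 contributes nothing because \<open>phi r 0\<close>
  is 0.\<close>

lemma config_lyap_upd: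
  assumes r: "0 < r" and fin: "finite (occ s)" and c: "s l \<noteq> c'" "s l \<in> Kb" "c' \<in> Kb"
  shows "config_lyap r (s(l := c')) = config_lyap r s + phi r c' (real (counts s c') + 1) - phi r (s l) (real (counts s (s l)))"
proof -
  define n where "n k = card {m. s m = k}" for k
  define n' where "n' k = card {m. (s(l := c')) m = k}" for k
  have fk: "finite {m. s m = k}" if "k \<noteq> 0" for k
    by (rule finite_subset[OF _ fin]) (use that in \<open>auto simp: occ_def\<close>)
  have n1: "n' c' = Suc (n c')" if "c' \<noteq> 0"
  proof -
    have "{m. (s(l := c')) m = c'} = insert l {m. s m = c'}" by auto
    then show ?thesis unfolding n_def n'_def using fk[OF that] c(1) by simp
  qed
  have n2: "n (s l) = Suc (n' (s l))" if "s l \<noteq> 0"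
  proof -
    have "{m. s m = s l} = insert l {m. (s(l := c')) m = s l}" using c(1) by auto
    moreover have "finite {m. (s(l := c')) m = s l}"
      by (rule finite_subset[OF _ fk[OF that]]) (use c(1) in auto)
    ultimately show ?thesis unfolding n_def n'_def using c(1) by simp
  qed
  have n3: "n' k = n k" if "k \<noteq> c'" "k \<noteq> s l" for k
    unfolding n_def n'_def using that by (intro arg_cong[of _ _ card]) auto
  have "Phi r k (n' k) = Phi r k (n k) + (if k = c' then phi r c' (real (counts s c') + 1) else 0)
    - (if k = s l then phi r (s l) (real (counts s (s l))) else 0)" if "k \<in> K" for k
  proof -
    have k0: "k \<noteq> 0" using that by (rule K_neq_0)
    consider "k = c'" | "k = s l" | "k \<noteq> c'" "k \<noteq> s l" by blast
    then show ?thesis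
    proof cases
      case 1
      then have "counts s c' = n c'" using k0 by (simp add: counts_def n_def)
      then show ?thesis using 1 n1 k0 c(1) Phi_Suc[OF r, of c' "n c'"] by auto
    next
      case 2
      then have "counts s (s l) = Suc (n' (s l))" using k0 n2 by (simp add: counts_def n_def)
      then show ?thesis using 2 n2 k0 c(1) Phi_Suc[OF r, of "s l" "n' (s l)"] by (auto simp: add.commute)
    next
      case 3
      then show ?thesis by (simp add: n3)
    qed
  qed
  then have "config_lyap r (s(l := c')) = (\<Sum>k\<in>K. Phi r k (n k) + (if k = c' then phi r c' (real (counts s c') + 1) else 0)
    - (if k = s l then phi r (s l) (real (counts s (s l))) else 0))"
    unfolding config_lyap_def n'_def[symmetric] by (rule sum.cong[OF refl])
  also have "\<dots> = config_lyap r s + (if c' \<in> K then phi r c' (real (counts s c') + 1) else 0) - (if s l \<in> K then phi r (s l) (real (counts s (s l))) else 0)"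
    unfolding sum_subtractf sum.distrib config_lyap_def n_def[symmetric] by simp
  also have "\<dots> = config_lyap r s + phi r c' (real (counts s c') + 1) - phi r (s l) (real (counts s (s l)))"
    using c by (auto simp: Kset_def phi_def)
  finally show ?thesis .
qed

lemma state_lyap_add:
  assumes v: "valid_state Kb s" and r: "0 < r" and l: "l \<in> insert (first_empty s) (acc Kb i s)"
  shows "state_lyap r (add_cust s l i) - state_lyap r s = jump_up r (counts s) i (s l) + quad_jump_up r (counts s) i" "s l \<in> Admit i" "valid_state Kb (add_cust s l i)"
proof -
  note fin = occ_finite[OF v]
  show v': "valid_state Kb (add_cust s l i)" by (rule valid_add[OF v l])
  have k: "s l \<in> Kb" "s l + unitv i \<in> Kb"
    using v l first_empty(2)[OF fin] by (auto simp: valid_state_def acc_def Kset_def)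
  then show "s l \<in> Admit i" by (simp add: Admit_def)
  have neq: "s l \<noteq> s l + unitv i"
  proof
    assume "s l = s l + unitv i"
    then have "s l i = (s l + unitv i) i" by simp
    then show False by (simp add: unitv_def)
  qed
  have "(\<Sum>j\<in>UNIV. (real (Zi (add_cust s l i) j) / r - rho j)\<^sup>2) - (\<Sum>j\<in>UNIV. (real (Zi s j) / r - rho j)\<^sup>2)
      = (\<Sum>j\<in>UNIV. if j = i then (2 * load_dev r (counts s) i + 1 / r) / r else 0)"
    unfolding sum_subtractf[symmetric]
  proof (rule sum.cong[OF refl])
    fix j
    have G: "((z + 1) / r - q)\<^sup>2 - (z / r - q)\<^sup>2 = (2 * (z / r - q) + 1 / r) / r" for z q :: real
      using r by (simp add: field_simps power2_eq_square)
    show "(real (Zi (add_cust s l i) j) / r - rho j)\<^sup>2 - (real (Zi s j) / r - rho j)\<^sup>2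
      = (if j = i then (2 * load_dev r (counts s) i + 1 / r) / r else 0)"
    proof (cases "j = i")
      case True
      have "real (Zi (add_cust s l i) i) = real (Zi s i) + 1" by (simp add: Zi_add[OF fin] unitv_def)
      then show ?thesis unfolding True load_dev_counts[OF v] by (simp only: G refl if_True)
    qed (simp add: Zi_add[OF fin] unitv_def)
  qed
  then have z: "(\<Sum>j\<in>UNIV. (real (Zi (add_cust s l i) j) / r - rho j)\<^sup>2)
      = (\<Sum>j\<in>UNIV. (real (Zi s j) / r - rho j)\<^sup>2) + (2 * load_dev r (counts s) i + 1 / r) / r" by simp
  have p: "config_lyap r (add_cust s l i) = config_lyap r s + jump_up r (counts s) i (s l)"
    unfolding add_cust_def jump_up_def using config_lyap_upd[OF r fin neq k] by simp
  have "ln r * (r * (q + w / r)) = ln r * (r * q) + ln r * w" for q w using r by (simp add: field_simps)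
  then show "state_lyap r (add_cust s l i) - state_lyap r s = jump_up r (counts s) i (s l) + quad_jump_up r (counts s) i"
    unfolding state_lyap_eq[OF v] state_lyap_eq[OF v'] z p quad_jump_up_def by simp
qed

lemma state_lyap_rem:
  assumes v: "valid_state Kb s" and r: "0 < r" and l: "0 < s l i"
  shows "state_lyap r (rem_cust s l i) - state_lyap r s = jump_down r (counts s) i (s l - unitv i) + quad_jump_down r (counts s) i"
    "s l - unitv i \<in> Admit i" "s l - unitv i + unitv i = s l" "valid_state Kb (rem_cust s l i)"
proof -
  note fin = occ_finite[OF v]
  show v': "valid_state Kb (rem_cust s l i)" by (rule valid_rem[OF v])
  show e: "s l - unitv i + unitv i = s l" using l by (auto simp: fun_eq_iff unitv_def)
  have kb: "s l \<in> Kb" using v by (simp add: valid_state_def)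
  have kb': "s l - unitv i \<in> Kb" using Kb_down[OF kb, of "s l - unitv i"] by simp
  show "s l - unitv i \<in> Admit i" using kb kb' e by (simp add: Admit_def)
  have neq: "s l \<noteq> s l - unitv i"
  proof
    assume "s l = s l - unitv i"
    then have "s l i = (s l - unitv i) i" by simp
    then show False using l by (simp add: unitv_def)
  qed
  have "(\<Sum>j\<in>UNIV. (real (Zi (rem_cust s l i) j) / r - rho j)\<^sup>2) - (\<Sum>j\<in>UNIV. (real (Zi s j) / r - rho j)\<^sup>2)
      = (\<Sum>j\<in>UNIV. if j = i then (- 2 * load_dev r (counts s) i + 1 / r) / r else 0)"
    unfolding sum_subtractf[symmetric]
  proof (rule sum.cong[OF refl])
    fix j
    have G: "((z - 1) / r - q)\<^sup>2 - (z / r - q)\<^sup>2 = (- 2 * (z / r - q) + 1 / r) / r" for z q :: real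
      using r by (simp add: field_simps power2_eq_square)
    have zr: "real (Zi (rem_cust s l i) j) = real (Zi s j) - real (unitv i j)" for j
      using Zi_rem[OF fin l, of j] by (simp add: of_nat_diff)
    show "(real (Zi (rem_cust s l i) j) / r - rho j)\<^sup>2 - (real (Zi s j) / r - rho j)\<^sup>2
      = (if j = i then (- 2 * load_dev r (counts s) i + 1 / r) / r else 0)"
    proof (cases "j = i")
      case True
      have "real (Zi (rem_cust s l i) i) = real (Zi s i) - 1" using zr[of i] by (simp add: unitv_def)
      then show ?thesis unfolding True load_dev_counts[OF v] by (simp only: G refl if_True)
    qed (simp add: zr unitv_def)
  qed
  then have z: "(\<Sum>j\<in>UNIV. (real (Zi (rem_cust s l i) j) / r - rho j)\<^sup>2)
      = (\<Sum>j\<in>UNIV. (real (Zi s j) / r - rho j)\<^sup>2) + (- 2 * load_dev r (counts s) i + 1 / r) / r" by simp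
  have p: "config_lyap r (rem_cust s l i) = config_lyap r s + jump_down r (counts s) i (s l - unitv i)"
    unfolding rem_cust_def jump_down_def e using config_lyap_upd[OF r fin neq kb kb'] by simp
  have "ln r * (r * (q + w / r)) = ln r * (r * q) + ln r * w" for q w using r by (simp add: field_simps)
  then show "state_lyap r (rem_cust s l i) - state_lyap r s = jump_down r (counts s) i (s l - unitv i) + quad_jump_down r (counts s) i"
    unfolding state_lyap_eq[OF v] state_lyap_eq[OF v'] z p quad_jump_down_def by simp
qed


section \<open>Truncation and the exponential tail of the Lyapunov function\<close>

definition radius :: real where "radius = 1 / (2 * real CARD('i))"

lemma radius_pos: "0 < radius" by (simp add: radius_def)

text \<open>A single load deviation of size \<open>radius\<close> makes the quadratic part of
  \<open>lyap\<close> at least this large; hence \<open>region_below_cutoff\<close>.\<close>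

definition cutoff :: "real \<Rightarrow> real" where "cutoff r = ln r * (r * radius\<^sup>2)"

lemma lyap_ge: "0 < r \<Longrightarrow> ln r * (r * load_dev_sq r X) \<le> lyap r X"
  unfolding lyap_def by (simp add: sum_nonneg Phi_nonneg)

lemma state_lyap_nonneg: "1 \<le> r \<Longrightarrow> 0 \<le> state_lyap r s"
proof -
  assume r: "1 \<le> r"
  have "0 \<le> ln r * (r * load_dev_sq r (counts s))" using r load_dev_sq_nonneg[of r "counts s"] by simp
  also have "\<dots> \<le> state_lyap r s" unfolding state_lyap_def using r by (intro lyap_ge) auto
  finally show ?thesis .
qed

lemma region_below_cutoff:
  assumes v: "valid_state Kb s" and r: "exp 1 \<le> r" and H: "state_lyap r s < cutoff r"
  shows "region r (counts s)"
proof (rule region_counts[OF v r])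
  fix i
  have "(1::real) < exp 1" by simp
  then have r1: "1 < r" using r by linarith
  have l: "0 < ln r" using r1 by simp
  have "ln r * (r * (load_dev r (counts s) i)\<^sup>2) \<le> ln r * (r * load_dev_sq r (counts s))"
    unfolding load_dev_sq_def using l r1 by (intro mult_left_mono member_le_sum) auto
  also have "\<dots> \<le> state_lyap r s" unfolding state_lyap_def using r1 by (intro lyap_ge) auto
  also have "\<dots> < ln r * (r * radius\<^sup>2)" using H by (simp add: cutoff_def)
  finally have "\<bar>load_dev r (counts s) i\<bar>\<^sup>2 < radius\<^sup>2" using l r1 by simp
  then have "\<bar>load_dev r (counts s) i\<bar> < radius" by (rule power2_less_imp_less) (use radius_pos in simp)
  then show "\<bar>load_dev r (counts s) i\<bar> \<le> 1 / (2 * real CARD('i))" by (simp add: radius_def)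
qed

text \<open>The truncation makes the test function bounded.  It also makes it maximal where \<open>region\<close> may fail,
  so that no drift estimate is needed there.\<close>

definition trunc_exp_lyap :: "real \<Rightarrow> real \<Rightarrow> (nat \<Rightarrow> 'i \<Rightarrow> nat) \<Rightarrow> real" where
  "trunc_exp_lyap \<eta> r s = exp (\<eta> * min (state_lyap r s) (cutoff r))"

text \<open>The maximum principle: no jump out of a global maximum increases the function.\<close>

lemma gen_nonpos:
  assumes "0 \<le> r" "\<And>s'. g s' \<le> g s"
  shows "gen r g s \<le> 0"
proof -
  have "(\<Sum>i\<in>UNIV. \<Sum>l\<in>insert (first_empty s) (acc Kb i s). arr_rate Kb lam a r s i l * (g (add_cust s l i) - g s)) \<le> 0"
    using assms arr_rate_nonneg[OF assms(1)] by (intro sum_nonpos mult_nonneg_nonpos) auto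
  moreover have "(\<Sum>i\<in>UNIV. \<Sum>l\<in>{l\<in>occ s. 0 < s l i}. mu i * real (s l i) * (g (rem_cust s l i) - g s)) \<le> 0"
    using assms mu_pos by (intro sum_nonpos mult_nonneg_nonpos) (auto simp: less_imp_le)
  ultimately show ?thesis by (simp add: gen_def)
qed

text \<open>Removing the truncation after the jump only increases the value, and
  \<open>H < M\<close> means that it is inactive before the jump.\<close>

lemma exp_min_diff:
  fixes \<eta> H d M :: real
  assumes "0 \<le> \<eta>" "\<eta> * \<bar>d\<bar> \<le> 1" "H < M"
  shows "exp (\<eta> * min (H + d) M) - exp (\<eta> * min H M) \<le> exp (\<eta> * H) * \<eta> * (d + \<eta> * d\<^sup>2)"
proof -
  have "\<eta> * min (H + d) M \<le> \<eta> * (H + d)" using assms by (intro mult_left_mono) auto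
  then have "exp (\<eta> * min (H + d) M) \<le> exp (\<eta> * H) * exp (\<eta> * d)"
    unfolding exp_add[symmetric] by (simp add: distrib_left)
  also have "\<dots> \<le> exp (\<eta> * H) * (1 + \<eta> * d + (\<eta> * d)\<^sup>2)"
  proof (intro mult_left_mono exp_quadratic_bound)
    have "\<eta> * d \<le> \<eta> * \<bar>d\<bar>" using assms(1) by (intro mult_left_mono) auto
    then show "\<eta> * d \<le> 1" using assms(2) by linarith
  qed simp
  finally have "exp (\<eta> * min (H + d) M) \<le> exp (\<eta> * H) * (1 + \<eta> * d + (\<eta> * d)\<^sup>2)" .
  then show ?thesis using assms(3) by (simp add: algebra_simps power2_eq_square)
qed

lemma gen_trunc_exp_lyap:
  assumes v: "valid_state Kb s" and r: "exp 1 \<le> r" and H: "state_lyap r s < cutoff r"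
    and \<kappa>: "0 < \<kappa>" "\<kappa> * J \<le> 1"
    and J: "\<And>i k. k \<in> Admit i \<Longrightarrow> counts s k \<noteq> 0 \<Longrightarrow> \<bar>jump_up r (counts s) i k + quad_jump_up r (counts s) i\<bar> \<le> J * ln r"
      "\<And>i k. k \<in> Admit i \<Longrightarrow> counts s (k + unitv i) \<noteq> 0 \<Longrightarrow> \<bar>jump_down r (counts s) i k + quad_jump_down r (counts s) i\<bar> \<le> J * ln r"
  defines "\<eta> \<equiv> \<kappa> / ln r"
  shows "gen r (trunc_exp_lyap \<eta> r) s \<le> exp (\<eta> * state_lyap r s) * \<eta> * drift \<eta> r (counts s)"
proof -
  have reg: "region r (counts s)" by (rule region_below_cutoff[OF v r H])
  note b = region_bounds[OF reg]
  have r0: "0 < r" using b(1) by simp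
  have l: "0 < ln r" using b(2) by simp
  have \<eta>: "0 \<le> \<eta>" using \<kappa>(1) l by (simp add: \<eta>_def)
  have \<eta>J: "\<eta> * \<bar>d\<bar> \<le> 1" if "\<bar>d\<bar> \<le> J * ln r" for d
  proof -
    have "\<eta> * \<bar>d\<bar> \<le> \<eta> * (J * ln r)" using that \<eta> by (rule mult_left_mono)
    also have "\<dots> = \<kappa> * J" using l by (simp add: \<eta>_def)
    finally show ?thesis using \<kappa>(2) by simp
  qed
  define c where "c = exp (\<eta> * state_lyap r s) * \<eta>"
  define A where "A i k = c * ((jump_up r (counts s) i k + quad_jump_up r (counts s) i) + \<eta> * (jump_up r (counts s) i k + quad_jump_up r (counts s) i)\<^sup>2)" for i k
  define B where "B i k = c * ((jump_down r (counts s) i (k - unitv i) + quad_jump_down r (counts s) i) + \<eta> * (jump_down r (counts s) i (k - unitv i) + quad_jump_down r (counts s) i)\<^sup>2)" for i k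
  have "gen r (trunc_exp_lyap \<eta> r) s \<le> (\<Sum>i\<in>UNIV. \<Sum>k\<in>Admit i. up_rate r (counts s) i * real (counts s k) * A i k
    + down_rate i k * real (counts s (k + unitv i)) * B i (k + unitv i))"
  proof (rule gen_counts[OF v reg])
    fix i l assume l: "l \<in> insert (first_empty s) (acc Kb i s)"
    note Ha = state_lyap_add[OF v r0 l]
    \<comment> \<open>Needed for the jump bound. An empty server is represented by
      \<open>X0\<close>, positive because the load is at least \<open>r / 2\<close>; an occupied one
      is counted itself.\<close>
    have "counts s (s l) \<noteq> 0"
    proof (cases "s l = 0")
      case True
      have "0 < a * (r / 2)" using a_pos r0 by simp
      also have "\<dots> \<le> a * real (\<Sum>i\<in>UNIV. type_load (counts s) i)" using b(4) a_pos by (intro mult_left_mono) auto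
      also have "\<dots> \<le> real (counts s 0)" by (rule b(6))
      finally show ?thesis unfolding True by simp
    next
      case False
      have "finite {m. s m = s l}"
        by (rule finite_subset[OF _ occ_finite[OF v]]) (use False in \<open>auto simp: occ_def\<close>)
      then have "card {m. s m = s l} \<noteq> 0" by auto
      then show ?thesis using False by (simp add: counts_def)
    qed
    then have "\<eta> * \<bar>jump_up r (counts s) i (s l) + quad_jump_up r (counts s) i\<bar> \<le> 1" using Ha(2) J(1) \<eta>J by blast
    from exp_min_diff[OF \<eta> this H] show "trunc_exp_lyap \<eta> r (add_cust s l i) - trunc_exp_lyap \<eta> r s \<le> A i (s l)"
      unfolding Ha(1)[symmetric] by (simp add: trunc_exp_lyap_def A_def c_def Ha(1)[symmetric])
  next
    fix i l assume "l \<in> occ s" and l: "0 < s l i"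
    note Hr = state_lyap_rem[OF v r0 l]
    have "finite {m. s m = s l}"
      by (rule finite_subset[OF _ occ_finite[OF v]]) (use l in \<open>auto simp: occ_def\<close>)
    then have "card {m. s m = s l} \<noteq> 0" by auto
    then have "counts s (s l - unitv i + unitv i) \<noteq> 0" unfolding Hr(3) using l by (auto simp: counts_def)
    then have "\<eta> * \<bar>jump_down r (counts s) i (s l - unitv i) + quad_jump_down r (counts s) i\<bar> \<le> 1" using Hr(2) J(2) \<eta>J by blast
    from exp_min_diff[OF \<eta> this H] show "trunc_exp_lyap \<eta> r (rem_cust s l i) - trunc_exp_lyap \<eta> r s \<le> B i (s l)"
      unfolding Hr(1)[symmetric] by (simp add: trunc_exp_lyap_def B_def c_def Hr(1)[symmetric])
  qed
  also have "\<dots> = c * drift \<eta> r (counts s)"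
  proof -
    have k: "k + unitv i - unitv i = k" for k :: "'i \<Rightarrow> nat" and i by (auto simp: fun_eq_iff)
    have "up_rate r (counts s) i * real (counts s k) * A i k + down_rate i k * real (counts s (k + unitv i)) * B i (k + unitv i)
      = c * (up_rate r (counts s) i * real (counts s k) * ((jump_up r (counts s) i k + quad_jump_up r (counts s) i) + \<eta> * (jump_up r (counts s) i k + quad_jump_up r (counts s) i)\<^sup>2)
       + down_rate i k * real (counts s (k + unitv i)) * ((jump_down r (counts s) i k + quad_jump_down r (counts s) i) + \<eta> * (jump_down r (counts s) i k + quad_jump_down r (counts s) i)\<^sup>2))" for i k
      unfolding A_def B_def k by (simp only: distrib_left[of c] mult.left_commute[of c] mult.assoc)
    then show ?thesis unfolding drift_def sum_distrib_left by simp
  qed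
  finally show ?thesis by (simp add: c_def)
qed

text \<open>The expected drift is 0, so the positive drift at small \<open>lyap\<close> must balance
  the negative drift on the event, where the test function is at least
  \<open>exp (\<kappa> * (ln r)\<^sup>2)\<close>.\<close>

lemma middle_bound:
  obtains \<kappa> C r0 where "0 < \<kappa>" "0 < C" "exp 1 \<le> r0"
    "\<And>r \<pi>. r0 \<le> r \<Longrightarrow> stationary Kb lam mu a r \<pi> \<Longrightarrow>
      measure_pmf.prob \<pi> {s. (ln r) ^ 3 \<le> state_lyap r s \<and> state_lyap r s < cutoff r} \<le> C * exp (- \<kappa> * (ln r)\<^sup>2)"
proof -
  obtain J where J: "1 \<le> J"
    "\<And>r X i k. region r X \<Longrightarrow> k \<in> Admit i \<Longrightarrow> X k \<noteq> 0 \<Longrightarrow> \<bar>jump_up r X i k + quad_jump_up r X i\<bar> \<le> J * ln r"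
    "\<And>r X i k. region r X \<Longrightarrow> k \<in> Admit i \<Longrightarrow> X (k + unitv i) \<noteq> 0 \<Longrightarrow> \<bar>jump_down r X i k + quad_jump_down r X i\<bar> \<le> J * ln r"
    by (rule jump_bound, rule that)
  have "0 < 1 / J" using J(1) by simp
  then obtain \<kappa> c C r1 where \<kappa>: "0 < \<kappa>" "\<kappa> \<le> 1 / J" and c: "0 < c" "0 < C" and
    dr: "\<And>r X. r1 \<le> r \<Longrightarrow> region r X \<Longrightarrow> drift (\<kappa> / ln r) r X \<le> - c * lyap r X + C * ln r"
    using drift_bound by metis
  have \<kappa>J: "\<kappa> * J \<le> 1" using \<kappa>(2) J(1) by (simp add: pos_le_divide_eq)
  \<comment> \<open>Ensures \<open>2 * C \<le> c * ln r\<close>, so that beyond the level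
    \<open>(ln r) ^ 3\<close> the drift is at most \<open>- C * ln r\<close>.\<close>
  define r0 where "r0 = max r1 (exp (1 + 2 * C / c))"
  have r0: "exp 1 \<le> r0"
  proof -
    have "exp 1 \<le> exp (1 + 2 * C / c)" using c by simp
    then show ?thesis unfolding r0_def by (rule order_trans[OF _ max.cobounded2])
  qed
  show thesis
  proof (rule that[OF \<kappa>(1) exp_gt_zero[of "\<kappa> * C / c"] r0])
    fix r \<pi> assume rr: "r0 \<le> r" and st: "stationary Kb lam mu a r \<pi>"
    have re: "exp 1 \<le> r" by (rule order_trans[OF r0 rr])
    have r1: "r1 \<le> r" by (rule order_trans[OF max.cobounded1 rr[unfolded r0_def]])
    have "exp (1 + 2 * C / c) \<le> r" by (rule order_trans[OF max.cobounded2 rr[unfolded r0_def]])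
    moreover have r: "1 < r"
    proof -
      have "(1::real) < exp 1" by simp
      then show ?thesis using re by linarith
    qed
    ultimately have l2: "1 + 2 * C / c \<le> ln r" by (simp add: ln_ge_iff)
    define l where "l = ln r"
    have l: "1 \<le> l" "2 * C \<le> c * l"
    proof -
      have "0 \<le> 2 * C / c" using c by simp
      then show "1 \<le> l" using l2 by (simp add: l_def)
      have "2 * C / c \<le> l" using l2 by (simp add: l_def)
      then show "2 * C \<le> c * l" using c by (simp add: field_simps)
    qed
    define \<eta> where "\<eta> = \<kappa> / l"
    have \<eta>: "0 < \<eta>" "\<eta> * l = \<kappa>" using \<kappa>(1) l by (auto simp: \<eta>_def)
    let ?M = "{s. l ^ 3 \<le> state_lyap r s \<and> state_lyap r s < cutoff r}"
    \<comment> \<open>The drift bound can be positive only for \<open>h \<le> C * l / c\<close>;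
      since \<open>\<eta> * l = \<kappa>\<close>, the test function is at most \<open>E\<close>
      there.\<close>
    define E where "E = exp (\<kappa> * C / c)"
    have E: "0 < E" by (simp add: E_def)
    have pt: "gen r (trunc_exp_lyap \<eta> r) s \<le> \<eta> * (C * l) * (E - exp (\<kappa> * l\<^sup>2) * indicator ?M s)"
      if v: "valid_state Kb s" for s
    proof (cases "state_lyap r s < cutoff r")
      case False
      have "gen r (trunc_exp_lyap \<eta> r) s \<le> 0"
      proof (rule gen_nonpos)
        show "trunc_exp_lyap \<eta> r s' \<le> trunc_exp_lyap \<eta> r s" for s'
          using False \<eta>(1) by (auto simp: trunc_exp_lyap_def intro!: mult_left_mono)
      qed (use r in simp)
      also have "0 \<le> \<eta> * (C * l) * (E - exp (\<kappa> * l\<^sup>2) * indicator ?M s)"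
        using False mult_pos_pos[OF mult_pos_pos[OF \<eta>(1) mult_pos_pos[OF c(2) less_le_trans[OF zero_less_one l(1)]]] E] by simp
      finally show ?thesis .
    next
      case True
      have reg: "region r (counts s)" by (rule region_below_cutoff[OF v re True])
      define h where "h = state_lyap r s"
      have h0: "0 \<le> h" using state_lyap_nonneg[of r s] r by (simp add: h_def)
      have "gen r (trunc_exp_lyap \<eta> r) s \<le> exp (\<eta> * h) * \<eta> * drift \<eta> r (counts s)"
        unfolding \<eta>_def l_def h_def by (rule gen_trunc_exp_lyap[OF v re True \<kappa>(1) \<kappa>J J(2)[OF reg] J(3)[OF reg]])
      also have "\<dots> \<le> exp (\<eta> * h) * \<eta> * (- c * h + C * l)"
      proof (rule mult_left_mono)
        show "drift \<eta> r (counts s) \<le> - c * h + C * l"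
          using dr[OF r1 reg] unfolding h_def state_lyap_def \<eta>_def l_def .
        show "0 \<le> exp (\<eta> * h) * \<eta>" using \<eta>(1) by simp
      qed
      also have "\<dots> = \<eta> * (exp (\<eta> * h) * (- c * h + C * l))"
        by (simp only: mult.assoc mult.left_commute)
      also have "\<dots> \<le> \<eta> * ((C * l) * (E - exp (\<kappa> * l\<^sup>2) * indicator ?M s))"
      proof (rule mult_left_mono)
        have Cl: "0 \<le> C * l" using c l by simp
        show "exp (\<eta> * h) * (- c * h + C * l) \<le> (C * l) * (E - exp (\<kappa> * l\<^sup>2) * indicator ?M s)"
        proof (cases "l ^ 3 \<le> h")
          case big: True
          have l3: "2 * (C * l) \<le> c * h" "l\<^sup>2 * l \<le> h"
          proof -
            show *: "l\<^sup>2 * l \<le> h" using big by (simp add: power2_eq_square power3_eq_cube)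
            have ll: "l * l \<le> l\<^sup>2 * l" using l(1) by (simp add: power2_eq_square)
            have "2 * C * l \<le> c * l * l" using l by (intro mult_right_mono) auto
            also have "\<dots> \<le> c * h" using ll * c by (simp add: mult.assoc)
            finally show "2 * (C * l) \<le> c * h" by simp
          qed
          have "\<eta> * h \<ge> \<eta> * (l\<^sup>2 * l)" using l3(2) \<eta>(1) by (intro mult_left_mono) auto
          also have "\<eta> * (l\<^sup>2 * l) = (\<eta> * l) * l\<^sup>2" by simp
          finally have e: "exp (\<kappa> * l\<^sup>2) \<le> exp (\<eta> * h)" unfolding \<eta>(2) by simp
          have "exp (\<eta> * h) * (- c * h + C * l) \<le> exp (\<eta> * h) * (- (C * l))"
            using l3(1) by (intro mult_left_mono) auto
          also have "\<dots> \<le> exp (\<kappa> * l\<^sup>2) * (- (C * l))" using e Cl by (simp add: mult_right_mono)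
          also have "\<dots> \<le> (C * l) * (E - exp (\<kappa> * l\<^sup>2) * indicator ?M s)"
            using Cl mult_nonneg_nonneg[OF Cl less_imp_le[OF E]] True big by (simp add: h_def algebra_simps)
          finally show ?thesis .
        next
          case small: False
          have "exp (\<eta> * h) * (- c * h + C * l) \<le> E * (C * l)"
          proof (cases "c * h \<le> C * l")
            case le: True
            then have "h \<le> C * l / c" by (simp only: pos_le_divide_eq[OF c(1)] mult.commute)
            then have "\<eta> * h \<le> \<eta> * (C * l / c)" using \<eta>(1) by (intro mult_left_mono) auto
            also have "\<dots> = (\<eta> * l) * C / c" by simp
            finally have "\<eta> * h \<le> \<kappa> * C / c" unfolding \<eta>(2) .
            moreover have "0 \<le> c * h" using c h0 by simp
            ultimately show ?thesis unfolding E_def using le by (intro mult_mono) auto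
          next
            case False
            then have "exp (\<eta> * h) * (- c * h + C * l) \<le> 0" by (intro mult_nonneg_nonpos) auto
            also have "0 \<le> E * (C * l)" using mult_nonneg_nonneg[OF less_imp_le[OF E] Cl] .
            finally show ?thesis .
          qed
          then show ?thesis using small by (simp add: h_def mult.commute)
        qed
      qed (use \<eta>(1) in simp)
      finally show ?thesis by (simp add: mult.assoc)
    qed
    have tb: "0 \<le> trunc_exp_lyap \<eta> r s" "trunc_exp_lyap \<eta> r s \<le> exp (\<eta> * cutoff r)" for s
      using \<eta>(1) by (auto simp: trunc_exp_lyap_def intro!: mult_left_mono)
    have r0': "0 < r" using r by simp
    note g = stationary_gen_bounded[OF st r0' tb]
    have intI: "integrable \<pi> (indicator ?M :: _ \<Rightarrow> real)"
      by (intro measure_pmf.integrable_const_bound[of _ 1]) auto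
    have "0 = measure_pmf.expectation \<pi> (gen r (trunc_exp_lyap \<eta> r))" using g(2) by simp
    also have "\<dots> \<le> measure_pmf.expectation \<pi> (\<lambda>s. \<eta> * (C * l) * (E - exp (\<kappa> * l\<^sup>2) * indicator ?M s))"
    proof (rule integral_mono_AE)
      show "AE s in \<pi>. gen r (trunc_exp_lyap \<eta> r) s \<le> \<eta> * (C * l) * (E - exp (\<kappa> * l\<^sup>2) * indicator ?M s)"
        using stationary_AE_valid[OF st] by eventually_elim (rule pt)
    qed (use g(1) intI in auto)
    also have "\<dots> = \<eta> * (C * l) * (E - exp (\<kappa> * l\<^sup>2) * measure_pmf.prob \<pi> ?M)"
      using intI by simp
    finally have "0 \<le> \<eta> * (C * l) * (E - exp (\<kappa> * l\<^sup>2) * measure_pmf.prob \<pi> ?M)" .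
    moreover have "0 < \<eta> * (C * l)" using \<eta>(1) c(2) l(1) by simp
    ultimately have "0 \<le> E - exp (\<kappa> * l\<^sup>2) * measure_pmf.prob \<pi> ?M"
      unfolding zero_le_mult_iff by linarith
    then have P: "exp (\<kappa> * l\<^sup>2) * measure_pmf.prob \<pi> ?M \<le> E" by simp
    have "measure_pmf.prob \<pi> ?M = exp (- \<kappa> * l\<^sup>2) * (exp (\<kappa> * l\<^sup>2) * measure_pmf.prob \<pi> ?M)"
      by (simp add: exp_minus)
    also have "\<dots> \<le> exp (- \<kappa> * l\<^sup>2) * E" using P by (intro mult_left_mono) auto
    finally show "measure_pmf.prob \<pi> {s. (ln r) ^ 3 \<le> state_lyap r s \<and> state_lyap r s < cutoff r} \<le> exp (\<kappa> * C / c) * exp (- \<kappa> * (ln r)\<^sup>2)"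
      by (simp only: l_def E_def mult.commute)
  qed
qed

end

lemma measure_pmf_mono_AE:
  assumes "AE s in measure_pmf \<pi>. s \<in> A \<longrightarrow> s \<in> B"
  shows "measure_pmf.prob \<pi> A \<le> measure_pmf.prob \<pi> B"
  using assms by (intro measure_pmf.finite_measure_mono_AE) auto

context packing_eq
begin

text \<open>On \<open>region\<close> the entropy part is at most of order \<open>r\<close>, hence
  negligible against \<open>cutoff r\<close>, which has order \<open>r * ln r\<close>.\<close>

lemma lyap_crude:
  obtains C where "0 \<le> C" "\<And>r X. region r X \<Longrightarrow> lyap r X \<le> C * r + ln r * (r * load_dev_sq r X)"
proof -
  define c where "c = 2 * a + 3"
  define C where "C = (\<Sum>k\<in>K. (c\<^sup>2 + (xst k)\<^sup>2) / xst k + xst k)"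
  have c: "0 \<le> c" using a_pos by (simp add: c_def)
  show thesis
  proof (rule that[of C])
    show "0 \<le> C" unfolding C_def using xst_pos by (intro sum_nonneg add_nonneg_nonneg) (auto simp: less_imp_le)
    fix r X assume reg: "region r X"
    note b = region_bounds[OF reg]
    have r: "0 < r" using b(1) by simp
    have "(\<Sum>k\<in>K. Phi r k (X k)) \<le> (\<Sum>k\<in>K. ((c\<^sup>2 + (xst k)\<^sup>2) / xst k + xst k) * r)"
    proof (rule sum_mono)
      fix k assume "k \<in> K"
      then have kb: "k \<in> Kb" by (simp add: Kset_def)
      define x where "x = xst k"
      have x: "0 < x" unfolding x_def by (rule xst_pos)
      define y where "y = real (X k) + 1"
      have y: "0 \<le> y" "y \<le> c * r" using b(8)[OF kb] by (auto simp: y_def c_def)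
      have "(y - r * x)\<^sup>2 \<le> y\<^sup>2 + (r * x)\<^sup>2"
        using y r x by (simp add: power2_diff)
      also have "\<dots> \<le> (c * r)\<^sup>2 + (r * x)\<^sup>2" using y by (intro add_right_mono power_mono) auto
      also have "\<dots> = (c\<^sup>2 + x\<^sup>2) * r * r" by (simp add: power2_eq_square algebra_simps)
      finally have "(y - r * x)\<^sup>2 / (r * x) \<le> ((c\<^sup>2 + x\<^sup>2) * r * r) / (r * x)"
        using r x by (intro divide_right_mono) auto
      also have "\<dots> = (c\<^sup>2 + x\<^sup>2) / x * r" using r x by simp
      finally have 1: "(y - r * x)\<^sup>2 / (r * x) \<le> (c\<^sup>2 + x\<^sup>2) / x * r" .
      have "ln (r * x) \<le> r * x - 1" using r x by (intro ln_le_minus_one) auto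
      then have "Phi r k (X k) \<le> (c\<^sup>2 + x\<^sup>2) / x * r + x * r"
        using Phi_upper[OF r, of k "X k"] 1 by (simp add: y_def x_def mult.commute)
      then show "Phi r k (X k) \<le> ((c\<^sup>2 + (xst k)\<^sup>2) / xst k + xst k) * r"
        by (simp only: x_def distrib_right)
    qed
    also have "\<dots> = C * r" unfolding C_def sum_distrib_right ..
    finally show "lyap r X \<le> C * r + ln r * (r * load_dev_sq r X)" by (simp add: lyap_def)
  qed
qed

text \<open>If all loads are within \<open>\<delta> * r\<close> of their means, the entropy part
  stays below half of the cutoff and the quadratic part below a quarter. Exceeding the cutoff thus
  forces a Poisson variable to deviate by order \<open>r\<close>.\<close>

lemma outer_bound:
  obtains c C r0 where "0 < c" "0 < C"
    "\<And>r \<pi>. r0 \<le> r \<Longrightarrow> exp 1 \<le> r \<Longrightarrow> stationary Kb lam mu a r \<pi> \<Longrightarrow>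
      measure_pmf.prob \<pi> {s. cutoff r \<le> state_lyap r s} \<le> C * exp (- c * r)"
proof -
  obtain C0 where C0: "0 \<le> C0" "\<And>r X. region r X \<Longrightarrow> lyap r X \<le> C0 * r + ln r * (r * load_dev_sq r X)"
    using lyap_crude by metis
  define N where "N = real CARD('i)"
  have N: "1 \<le> N" unfolding N_def using one_le_card_finite[where 'a='i] by linarith
  \<comment> \<open>Small enough for \<open>region\<close> to hold and for all types together to
    contribute at most \<open>radius\<^sup>2 / 4\<close>.\<close>
  define \<delta> where "\<delta> = radius / (2 * N)"
  have \<delta>: "0 < \<delta>" "\<delta> \<le> radius" using radius_pos N by (auto simp: \<delta>_def field_simps)
  have N\<delta>: "N * \<delta>\<^sup>2 \<le> radius\<^sup>2 / 4"
  proof -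
    have "N * \<delta>\<^sup>2 = radius\<^sup>2 / (4 * N)" using N by (simp add: \<delta>_def power2_eq_square)
    also have "\<dots> \<le> radius\<^sup>2 / 4" using N by (intro divide_left_mono) auto
    finally show ?thesis .
  qed
  define c where "c i = min 1 (\<delta> / (2 * rho i)) * \<delta> / 2" for i
  have c: "0 < c i" for i
  proof -
    have "0 < \<delta> / (2 * rho i)" by (rule divide_pos_pos[OF \<delta>(1) mult_pos_pos[OF zero_less_numeral rho_pos]])
    then have "0 < min 1 (\<delta> / (2 * rho i))" by (simp only: min_less_iff_conj zero_less_one simp_thms)
    then show ?thesis unfolding c_def using \<delta>(1) by (intro divide_pos_pos mult_pos_pos) auto
  qed
  define c0 where "c0 = Min (range c)"
  have c0: "0 < c0" "\<And>i. c0 \<le> c i" unfolding c0_def using c by (auto simp: Min_gr_iff)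
  define r0 where "r0 = exp (2 * C0 / radius\<^sup>2 + 1)"
  show thesis
  proof (rule that[OF c0(1), of "2 * N" r0])
    show "0 < 2 * N" using N by simp
    fix r \<pi> assume rr: "r0 \<le> r" and re: "exp 1 \<le> r" and st: "stationary Kb lam mu a r \<pi>"
    have r: "1 < r"
    proof -
      have "(1::real) < exp 1" by simp
      then show ?thesis using re by linarith
    qed
    have l: "2 * C0 / radius\<^sup>2 + 1 \<le> ln r" using rr r by (simp add: r0_def ln_ge_iff)
    have l0: "C0 < ln r * (radius\<^sup>2 / 2)"
    proof -
      have "2 * C0 / radius\<^sup>2 < ln r" using l by simp
      then show ?thesis using radius_pos by (simp add: field_simps)
    qed
    have lpos: "0 < ln r" using r by simp
    let ?A = "\<lambda>i. {s. \<delta> * r \<le> \<bar>real (Zi s i) - rho i * r\<bar>}"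
    have sub: "\<exists>i. s \<in> ?A i" if v: "valid_state Kb s" and H: "cutoff r \<le> state_lyap r s" for s
    proof (rule ccontr)
      assume "\<not> (\<exists>i. s \<in> ?A i)"
      then have lt: "\<bar>real (Zi s i) - rho i * r\<bar> < \<delta> * r" for i by (simp add: not_le)
      have z: "\<bar>load_dev r (counts s) i\<bar> < \<delta>" for i
      proof -
        have "load_dev r (counts s) i * r = real (Zi s i) - rho i * r"
          unfolding load_dev_counts[OF v] left_diff_distrib using r by simp
        then have "\<bar>load_dev r (counts s) i * r\<bar> < \<delta> * r" using lt[of i] by (simp only:)
        then show ?thesis using r by (simp add: abs_mult)
      qed
      have reg: "region r (counts s)"
      proof (rule region_counts[OF v re])
        show "\<bar>load_dev r (counts s) i\<bar> \<le> 1 / (2 * real CARD('i))" for i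
          using z[of i] \<delta>(2) unfolding radius_def by linarith
      qed
      have "load_dev_sq r (counts s) \<le> N * \<delta>\<^sup>2"
      proof -
        have "(load_dev r (counts s) i)\<^sup>2 \<le> \<delta>\<^sup>2" for i
          using z[of i] power_mono[of "\<bar>load_dev r (counts s) i\<bar>" \<delta> 2] by simp
        then show ?thesis unfolding load_dev_sq_def N_def
          using sum_bounded_above[of UNIV "\<lambda>i. (load_dev r (counts s) i)\<^sup>2" "\<delta>\<^sup>2"] by simp
      qed
      then have "ln r * (r * load_dev_sq r (counts s)) \<le> ln r * (r * (radius\<^sup>2 / 4))"
        using N\<delta> lpos r by (intro mult_left_mono) auto
      then have "state_lyap r s \<le> C0 * r + ln r * (r * (radius\<^sup>2 / 4))"
        using C0(2)[OF reg] by (simp add: state_lyap_def)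
      also have "\<dots> < (ln r * (radius\<^sup>2 / 2)) * r + ln r * (r * (radius\<^sup>2 / 2))"
        using l0 r lpos radius_pos by (intro add_less_le_mono mult_strict_right_mono mult_left_mono) auto
      also have "\<dots> = cutoff r" by (simp add: cutoff_def)
      finally show False using H by simp
    qed
    have "measure_pmf.prob \<pi> {s. cutoff r \<le> state_lyap r s} \<le> measure_pmf.prob \<pi> (\<Union>i\<in>UNIV. ?A i)"
    proof (rule measure_pmf_mono_AE)
      show "AE s in \<pi>. s \<in> {s. cutoff r \<le> state_lyap r s} \<longrightarrow> s \<in> (\<Union>i\<in>UNIV. ?A i)"
        using stationary_AE_valid[OF st] by eventually_elim (use sub in blast)
    qed
    also have "\<dots> \<le> (\<Sum>i\<in>UNIV. measure_pmf.prob \<pi> (?A i))"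
      by (rule measure_pmf.finite_measure_subadditive_finite) auto
    also have "\<dots> \<le> (\<Sum>i\<in>(UNIV::'i set). 2 * exp (- c0 * r))"
    proof (rule sum_mono)
      fix i
      have "measure_pmf.prob \<pi> (?A i) \<le> 2 * exp (- (min 1 (\<delta> / (2 * rho i)) * \<delta> / 2) * r)"
        by (rule Zi_tail[OF st _ \<delta>(1)]) (use r in simp)
      also have "\<dots> = 2 * exp (- c i * r)" by (simp only: c_def)
      also have "\<dots> \<le> 2 * exp (- c0 * r)" using c0(2)[of i] r by simp
      finally show "measure_pmf.prob \<pi> (?A i) \<le> 2 * exp (- c0 * r)" .
    qed
    also have "\<dots> = 2 * N * exp (- c0 * r)" by (simp add: N_def)
    finally show "measure_pmf.prob \<pi> {s. cutoff r \<le> state_lyap r s} \<le> 2 * N * exp (- c0 * r)" .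
  qed
qed

definition good :: "real \<Rightarrow> (nat \<Rightarrow> 'i \<Rightarrow> nat) set" where
  "good r = {s. valid_state Kb s \<and> state_lyap r s < (ln r) ^ 3 \<and> state_lyap r s < cutoff r}"

lemma bad_bound:
  obtains \<kappa> c C r0 where "0 < \<kappa>" "0 < c" "0 < C" "exp 1 \<le> r0"
    "\<And>r \<pi>. r0 \<le> r \<Longrightarrow> stationary Kb lam mu a r \<pi> \<Longrightarrow>
      measure_pmf.prob \<pi> (- good r) \<le> C * (exp (- \<kappa> * (ln r)\<^sup>2) + exp (- c * r))"
proof -
  obtain \<kappa> C1 r1 where 1: "0 < \<kappa>" "0 < C1" "exp 1 \<le> r1"
    "\<And>r \<pi>. r1 \<le> r \<Longrightarrow> stationary Kb lam mu a r \<pi> \<Longrightarrow>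
      measure_pmf.prob \<pi> {s. (ln r) ^ 3 \<le> state_lyap r s \<and> state_lyap r s < cutoff r} \<le> C1 * exp (- \<kappa> * (ln r)\<^sup>2)"
    by (rule middle_bound, rule that)
  obtain c C2 r2 where 2: "0 < c" "0 < C2"
    "\<And>r \<pi>. r2 \<le> r \<Longrightarrow> exp 1 \<le> r \<Longrightarrow> stationary Kb lam mu a r \<pi> \<Longrightarrow>
      measure_pmf.prob \<pi> {s. cutoff r \<le> state_lyap r s} \<le> C2 * exp (- c * r)"
    by (rule outer_bound, rule that)
  show thesis
  proof (rule that[OF 1(1) 2(1), of "C1 + C2" "max r1 r2"])
    show "0 < C1 + C2" using 1(2) 2(2) by simp
    show "exp 1 \<le> max r1 r2" using 1(3) by (rule order_trans[OF _ max.cobounded1])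
    fix r \<pi> assume r: "max r1 r2 \<le> r" and st: "stationary Kb lam mu a r \<pi>"
    have r1: "r1 \<le> r" "r2 \<le> r" "exp 1 \<le> r"
      using r order_trans[OF 1(3), of r] by auto
    let ?M = "{s. (ln r) ^ 3 \<le> state_lyap r s \<and> state_lyap r s < cutoff r}" and ?O = "{s. cutoff r \<le> state_lyap r s}"
    have "measure_pmf.prob \<pi> (- good r) \<le> measure_pmf.prob \<pi> (?M \<union> ?O)"
    proof (rule measure_pmf_mono_AE)
      show "AE s in \<pi>. s \<in> - good r \<longrightarrow> s \<in> ?M \<union> ?O"
        using stationary_AE_valid[OF st] by eventually_elim (auto simp: good_def)
    qed
    also have "\<dots> \<le> measure_pmf.prob \<pi> ?M + measure_pmf.prob \<pi> ?O"
      by (rule measure_Un_le) auto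
    also have "\<dots> \<le> C1 * exp (- \<kappa> * (ln r)\<^sup>2) + C2 * exp (- c * r)"
      by (intro add_mono 1(4)[OF r1(1) st] 2(3)[OF r1(2,3) st])
    also have "\<dots> \<le> (C1 + C2) * (exp (- \<kappa> * (ln r)\<^sup>2) + exp (- c * r))"
      using 1(2) 2(2) by (simp add: algebra_simps)
    finally show "measure_pmf.prob \<pi> (- good r) \<le> (C1 + C2) * (exp (- \<kappa> * (ln r)\<^sup>2) + exp (- c * r))" .
  qed
qed

lemma good_region: "exp 1 \<le> r \<Longrightarrow> s \<in> good r \<Longrightarrow> region r (counts s)"
  using region_below_cutoff by (auto simp: good_def)

lemma good_Ztot: "exp 1 \<le> r \<Longrightarrow> s \<in> good r \<Longrightarrow> r / 2 \<le> real (Ztot s)"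
  using region_bounds(4)[OF good_region, of r s] by (simp add: good_def Ztot_eq type_load_counts)

lemma card_occ:
  assumes "valid_state Kb s"
  shows "real (card (occ s)) = (\<Sum>k\<in>K. real (counts s k))"
  using sum_occ[OF assms, of "\<lambda>_. 1"] by simp

text \<open>Square roots of the counts are within \<open>(ln r)\<^sup>2\<close> of their targets by
  \<open>Phi_lower\<close>; multiplying by the sum of the square roots, of order
  \<open>sqrt r\<close>, gives the counts.\<close>

lemma good_occ:
  obtains C where "0 < C" "\<And>r s. exp 1 \<le> r \<Longrightarrow> s \<in> good r \<Longrightarrow>
    \<bar>real (card (occ s)) - (\<Sum>k\<in>K. xst k) * r\<bar> \<le> C * (sqrt r * (ln r)\<^sup>2)"
proof -
  define c where "c = 2 * a + 3"
  have c: "0 < c" using a_pos by (simp add: c_def)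
  define C where "C = (\<Sum>k\<in>K. sqrt c + sqrt (xst k))"
  have "K \<noteq> {}" using unitv_in_K by blast
  then have C: "0 < C" unfolding C_def using c xst_pos by (intro sum_pos add_pos_pos) auto
  show thesis
  proof (rule that[OF C])
    fix r s assume re: "exp 1 \<le> r" and g: "s \<in> good r"
    have v: "valid_state Kb s" using g by (simp add: good_def)
    have reg: "region r (counts s)" by (rule good_region[OF re g])
    note b = region_bounds[OF reg]
    have r: "0 < r" using b(1) by simp
    have l: "1 \<le> ln r" by (rule b(2))
    have each: "\<bar>real (counts s k) - r * xst k\<bar> \<le> (sqrt c + sqrt (xst k)) * (sqrt r * (ln r)\<^sup>2)" if k: "k \<in> K" for k
    proof -
      have kb: "k \<in> Kb" using k by (simp add: Kset_def)
      have "(sqrt (real (counts s k)) - sqrt (r * xst k))\<^sup>2 \<le> Phi r k (counts s k)" by (rule Phi_lower[OF r])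
      also have "\<dots> \<le> (\<Sum>k\<in>K. Phi r k (counts s k))" using k Phi_nonneg[OF r] by (intro member_le_sum) auto
      also have "\<dots> \<le> lyap r (counts s)"
      proof -
        have "0 \<le> ln r * (r * load_dev_sq r (counts s))"
          by (intro mult_nonneg_nonneg load_dev_sq_nonneg) (use l b(1) in auto)
        then show ?thesis by (simp add: lyap_def)
      qed
      also have "\<dots> \<le> (ln r) ^ 3" using g by (simp add: good_def state_lyap_def)
      \<comment> \<open>Raising the exponent to an even one gives a perfect square, so that no root
        of the logarithm appears.\<close>
      also have "\<dots> \<le> (ln r) ^ 4" using l by (intro power_increasing) auto
      also have "\<dots> = ((ln r)\<^sup>2)\<^sup>2" by simp
      finally have "\<bar>sqrt (real (counts s k)) - sqrt (r * xst k)\<bar> \<le> \<bar>(ln r)\<^sup>2\<bar>"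
        by (simp only: abs_le_square_iff)
      then have d: "\<bar>sqrt (real (counts s k)) - sqrt (r * xst k)\<bar> \<le> (ln r)\<^sup>2" by simp
      have "sqrt (real (counts s k)) \<le> sqrt (c * r)" using b(8)[OF kb] by (simp add: c_def)
      then have su: "sqrt (real (counts s k)) + sqrt (r * xst k) \<le> (sqrt c + sqrt (xst k)) * sqrt r"
        by (simp add: real_sqrt_mult algebra_simps)
      have "real (counts s k) - r * xst k = (sqrt (real (counts s k)) - sqrt (r * xst k)) * (sqrt (real (counts s k)) + sqrt (r * xst k))"
        using r xst_pos[of k] by (simp add: algebra_simps)
      then have "\<bar>real (counts s k) - r * xst k\<bar> = \<bar>sqrt (real (counts s k)) - sqrt (r * xst k)\<bar> * (sqrt (real (counts s k)) + sqrt (r * xst k))"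
        using r xst_pos[of k] by (simp add: abs_mult)
      also have "\<dots> \<le> (ln r)\<^sup>2 * ((sqrt c + sqrt (xst k)) * sqrt r)"
        using d su r xst_pos[of k] by (intro mult_mono) auto
      finally show ?thesis by (simp add: ac_simps)
    qed
    have "\<bar>real (card (occ s)) - (\<Sum>k\<in>K. xst k) * r\<bar> = \<bar>\<Sum>k\<in>K. real (counts s k) - r * xst k\<bar>"
      unfolding card_occ[OF v] by (simp add: sum_subtractf sum_distrib_left mult.commute)
    also have "\<dots> \<le> (\<Sum>k\<in>K. (sqrt c + sqrt (xst k)) * (sqrt r * (ln r)\<^sup>2))"
      by (rule order_trans[OF sum_abs]) (intro sum_mono each)
    also have "\<dots> = C * (sqrt r * (ln r)\<^sup>2)" unfolding C_def sum_distrib_right ..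
    finally show "\<bar>real (card (occ s)) - (\<Sum>k\<in>K. xst k) * r\<bar> \<le> C * (sqrt r * (ln r)\<^sup>2)" .
  qed
qed

end

subsection \<open>The right-most occupied server\<close>

text \<open>\<open>exp (- \<kappa> * (ln r)\<^sup>2)\<close> is \<open>r\<close> to the power
  \<open>- \<kappa> * ln r\<close> and beats the linear factor.\<close>

lemma rate_bound_tendsto:
  fixes \<kappa> c C D :: real
  assumes "0 < \<kappa>" "0 < c"
  shows "((\<lambda>r. (2 + D * r) * (C * (exp (- \<kappa> * (ln r)\<^sup>2) + exp (- c * r)))) \<longlongrightarrow> 0) at_top"
  using assms by real_asymp

text \<open>Here the extra power \<open>\<epsilon>\<close> absorbs the logarithms.\<close>

lemma fluctuation_tendsto:
  fixes \<epsilon> C :: real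
  assumes "0 < \<epsilon>"
  shows "((\<lambda>r. (C * (sqrt r * (ln r)\<^sup>2) + 2) / r powr (1 / 2 + \<epsilon>)) \<longlongrightarrow> 0) at_top"
  using assms by real_asymp

text \<open>The limit distribution function jumps only at 0. At negative points nonnegativity
  decides, at positive points the tail probability.\<close>

lemma weak_conv_to_zero:
  fixes Y :: "nat \<Rightarrow> 'a \<Rightarrow> real" and \<pi> :: "nat \<Rightarrow> 'a pmf"
  assumes nn: "\<And>n s. 0 \<le> Y n s"
    and lim: "\<And>\<delta>. 0 < \<delta> \<Longrightarrow> (\<lambda>n. measure_pmf.prob (\<pi> n) {s. \<delta> < Y n s}) \<longlonglongrightarrow> 0"
  shows "weak_conv_m (\<lambda>n. distr (measure_pmf (\<pi> n)) borel (Y n)) (return borel 0)"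
  unfolding weak_conv_m_def weak_conv_def
proof (intro allI impI)
  fix x :: real
  interpret D: prob_space "return borel (0::real)" by (rule prob_space_return) simp
  interpret R: real_distribution "return borel (0::real)" by unfold_locales auto
  assume "isCont (cdf (return borel 0)) x"
  then have "measure (return borel (0::real)) {x} = 0" using R.isCont_cdf by simp
  then have x: "x \<noteq> 0" by (auto simp: measure_return indicator_def)
  have cdf0: "cdf (return borel 0) x = indicator {0..} x"
    by (simp add: cdf_def measure_return indicator_def)
  have cdfn: "cdf (distr (measure_pmf (\<pi> n)) borel (Y n)) x = measure_pmf.prob (\<pi> n) {s. Y n s \<le> x}" for n
    by (simp add: cdf_def measure_distr vimage_def)
  show "(\<lambda>n. cdf (distr (measure_pmf (\<pi> n)) borel (Y n)) x) \<longlonglongrightarrow> cdf (return borel 0) x"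
  proof (cases "x < 0")
    case True
    then have "{s. Y n s \<le> x} = {}" for n using nn[of n] by (auto simp: not_le intro: less_le_trans)
    then show ?thesis unfolding cdf0 cdfn using True by simp
  next
    case False
    then have "0 < x" using x by simp
    have "measure_pmf.prob (\<pi> n) {s. Y n s \<le> x} = 1 - measure_pmf.prob (\<pi> n) {s. x < Y n s}" for n
    proof -
      have "{s. Y n s \<le> x} = space (measure_pmf (\<pi> n)) - {s. x < Y n s}" by auto
      then show ?thesis using measure_pmf.prob_compl[of "{s. x < Y n s}" "\<pi> n"] by simp
    qed
    moreover have "(\<lambda>n. 1 - measure_pmf.prob (\<pi> n) {s. x < Y n s}) \<longlonglongrightarrow> 1 - 0"
      by (intro tendsto_diff tendsto_const lim \<open>0 < x\<close>)
    ultimately show ?thesis unfolding cdf0 cdfn using False by simp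
  qed
qed

section \<open>Weighted count of the servers of high rank\<close>

context packing
begin

definition size_of :: "('i \<Rightarrow> nat) \<Rightarrow> nat" where "size_of k = (\<Sum>i\<in>UNIV. k i)"

lemma size_of_add: "size_of (k + unitv i) = Suc (size_of k)"
  by (simp add: size_of_def sum.distrib) (simp add: unitv_def)

lemma size_of_diff:
  assumes "0 < k i"
  shows "size_of k = Suc (size_of (k - unitv i))"
proof -
  have "k - unitv i + unitv i = k" using assms by (auto simp: fun_eq_iff unitv_def)
  then show ?thesis using size_of_add[of "k - unitv i" i] by simp
qed

lemma card_occ_le_Ztot:
  assumes "finite (occ s)"
  shows "card (occ s) \<le> Ztot s"
proof -
  have "1 \<le> (\<Sum>i\<in>UNIV. s l i)" if "l \<in> occ s" for l
  proof -
    from that obtain i where "s l i \<noteq> 0" by (auto simp: occ_def fun_eq_iff)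
    moreover have "s l i \<le> (\<Sum>i\<in>UNIV. s l i)" by (rule member_le_sum) auto
    ultimately show ?thesis by linarith
  qed
  then have "(\<Sum>l\<in>occ s. 1) \<le> Ztot s" unfolding Ztot_def by (intro sum_mono) auto
  then show ?thesis by simp
qed

lemma sum_fun_upd:
  fixes F :: "nat \<Rightarrow> ('i \<Rightarrow> nat) \<Rightarrow> real"
  assumes "finite (occ s)" "\<And>m. F m 0 = 0"
  shows "(\<Sum>m\<in>occ (s(l := c)). F m ((s(l := c)) m)) - (\<Sum>m\<in>occ s. F m (s m)) = F l c - F l (s l)"
proof -
  let ?A = "insert l (occ s)"
  have fin: "finite ?A" using assms by simp
  have "(\<Sum>m\<in>occ (s(l := c)). F m ((s(l := c)) m)) = (\<Sum>m\<in>?A. F m ((s(l := c)) m))"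
    using fin assms(2) by (intro sum.mono_neutral_left) (auto simp: occ_def)
  moreover have "(\<Sum>m\<in>occ s. F m (s m)) = (\<Sum>m\<in>?A. F m (s m))"
    using fin assms(2) by (intro sum.mono_neutral_left) (auto simp: occ_def)
  moreover have "(\<Sum>m\<in>?A. F m ((s(l := c)) m)) - (\<Sum>m\<in>?A. F m (s m)) = (\<Sum>m\<in>?A. if m = l then F l c - F l (s l) else 0)"
    unfolding sum_subtractf[symmetric] by (intro sum.cong) auto
  ultimately show ?thesis using fin by simp
qed

text \<open>A plain customer count may drift upwards, because \<open>\<beta>\<close> can exceed
  \<open>m\<close>. With \<open>w n = D * (1 - q ^ n)\<close> the gain from an arrival is
  \<open>q\<close> times the loss from a departure at the same size, so a small \<open>q\<close>
  makes departures dominate; \<open>D\<close> normalises the drift over the finitely many sizes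
  below \<open>M\<close>.\<close>

lemma tail_weights:
  fixes \<beta> :: real
  assumes "0 < \<beta>" "0 < m"
  obtains w :: "nat \<Rightarrow> real" and D where "0 \<le> D" "w 0 = 0" "\<And>n. 0 \<le> w n" "\<And>n. w n \<le> D" "\<And>n. w n \<le> w (Suc n)"
    "\<And>n. n < M \<Longrightarrow> \<beta> * (w (Suc (Suc n)) - w (Suc n)) + m * (w n - w (Suc n)) \<le> - 1"
proof -
  define q where "q = min (1 / 2) (m / (2 * \<beta>))"
  have q: "0 < q" "q \<le> 1 / 2" using assms by (auto simp: q_def)
  have "q \<le> m / (2 * \<beta>)" by (simp add: q_def)
  then have \<beta>q: "\<beta> * q \<le> m / 2" using assms by (simp add: field_simps)
  define D where "D = 4 / (m * q ^ M)"
  have D: "0 < D" using assms q by (simp add: D_def)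
  define w where "w n = D * (1 - q ^ n)" for n
  have qn: "0 < q ^ n" "q ^ n \<le> 1" for n using q by (auto intro: power_le_one)
  have diff: "w (Suc n) - w n = D * q ^ n * (1 - q)" for n
    by (simp add: w_def algebra_simps)
  show thesis
  proof (rule that[of D w])
    show "0 \<le> D" using D by simp
    show "w 0 = 0" by (simp add: w_def)
    show "0 \<le> w n" for n using D qn[of n] by (simp add: w_def)
    show "w n \<le> D" for n using D qn[of n] mult_left_mono[of "1 - q ^ n" 1 D] by (simp add: w_def)
    show "w n \<le> w (Suc n)" for n
    proof -
      have "0 \<le> D * q ^ n * (1 - q)" using D qn[of n] q by simp
      then show ?thesis using diff[of n] by linarith
    qed
    fix n assume n: "n < M"
    define e where "e = D * q ^ n * (1 - q)"
    have "w n - w (Suc n) = - e" "w (Suc (Suc n)) - w (Suc n) = q * e"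
      using diff[of n] diff[of "Suc n"] by (simp_all add: e_def)
    then have "\<beta> * (w (Suc (Suc n)) - w (Suc n)) + m * (w n - w (Suc n)) = e * (\<beta> * q - m)"
      by (simp only:) (simp add: algebra_simps)
    also have "\<dots> = D * q ^ n * (1 - q) * (\<beta> * q - m)" by (simp only: e_def)
    also have "\<dots> \<le> D * q ^ n * (1 - q) * (- (m / 2))"
      using \<beta>q D qn[of n] q by (intro mult_left_mono) auto
    also have "\<dots> = - (D * (q ^ n * ((1 - q) * (m / 2))))" by simp
    also have "\<dots> \<le> - (D * (q ^ M * ((1 / 2) * (m / 2))))"
    proof -
      have "q ^ M \<le> q ^ n" using n q by (intro power_decreasing) auto
      moreover have "(1 / 2) * (m / 2) \<le> (1 - q) * (m / 2)" using q assms by (intro mult_right_mono) auto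
      ultimately have "q ^ M * ((1 / 2) * (m / 2)) \<le> q ^ n * ((1 - q) * (m / 2))"
        using qn[of n] assms by (intro mult_mono) auto
      then show ?thesis using D by simp
    qed
    also have "\<dots> = - 1" using assms q by (simp add: D_def)
    finally show "\<beta> * (w (Suc (Suc n)) - w (Suc n)) + m * (w n - w (Suc n)) \<le> - 1" .
  qed
qed

lemma rank_tail:
  obtains C where "0 \<le> C"
    "\<And>r \<pi> G N. 0 < r \<Longrightarrow> stationary Kb lam mu a r \<pi> \<Longrightarrow>
      \<forall>s\<in>G. valid_state Kb s \<and> r / 2 \<le> real (Ztot s) \<and> card (occ s) + 1 \<le> N \<Longrightarrow>
      measure_pmf.prob \<pi> {s. \<exists>l\<in>occ s. N < l} \<le> (1 + C * r) * measure_pmf.prob \<pi> (- G)"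
proof -
  define m where "m = Min (range mu)"
  have m: "0 < m" and m_le: "m \<le> mu i" for i unfolding m_def using mu_pos by (auto simp: Min_gr_iff)
  \<comment> \<open>Bounds the total arrival rate at one occupied server on \<open>G\<close>, where
    \<open>Xi\<close> is at least \<open>a * r / 2\<close>.\<close>
  define \<beta> where "\<beta> = (\<Sum>i\<in>UNIV. 2 * lam i / a)"
  have \<beta>: "0 < \<beta>" unfolding \<beta>_def using lam_pos a_pos by (intro sum_pos) auto
  define M where "M = (\<Sum>k\<in>Kb. size_of k)"
  obtain w D where D: "0 \<le> D" and w0: "w 0 = 0" and w: "\<And>n. 0 \<le> w n" "\<And>n. w n \<le> D" "\<And>n. w n \<le> w (Suc n)"
    and wd: "\<And>n. n < M \<Longrightarrow> \<beta> * (w (Suc (Suc n)) - w (Suc n)) + m * (w n - w (Suc n)) \<le> - 1"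
    using tail_weights[OF \<beta> m, of M] by metis
  define C where "C = (\<Sum>i\<in>UNIV. lam i) * D"
  have L: "0 \<le> (\<Sum>i\<in>UNIV. lam i)" using lam_pos by (intro sum_nonneg) (auto simp: less_imp_le)
  show thesis
  proof (rule that[of C])
    show "0 \<le> C" using L D by (simp add: C_def)
    fix r \<pi> G and N :: nat
    assume r: "0 < r" and st: "stationary Kb lam mu a r \<pi>"
      and G: "\<forall>s\<in>G. valid_state Kb s \<and> r / 2 \<le> real (Ztot s) \<and> card (occ s) + 1 \<le> N"
    define F where "F l k = (if N < l then w (size_of k) else 0)" for l k
    have F0: "F l 0 = 0" for l by (simp add: F_def size_of_def w0)
    define f where "f s = (if valid_state Kb s then \<Sum>l\<in>occ s. F l (s l) else 0)" for s
    define up where "up l k = (if N < l then w (Suc (size_of k)) - w (size_of k) else 0)" for l k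
    have up: "0 \<le> up l k" "up l k \<le> D" for l k
    proof -
      show "0 \<le> up l k" using w(3)[of "size_of k"] by (simp add: up_def)
      have "w (Suc (size_of k)) - w (size_of k) \<le> D" using w(2)[of "Suc (size_of k)"] w(1)[of "size_of k"] by linarith
      then show "up l k \<le> D" using D by (simp add: up_def)
    qed
    have f_add: "f (add_cust s l i) - f s = up l (s l)"
      if v: "valid_state Kb s" and l: "l \<in> insert (first_empty s) (acc Kb i s)" for s l i
    proof -
      have "f (add_cust s l i) - f s = F l (s l + unitv i) - F l (s l)"
        using sum_fun_upd[where F = F, OF occ_finite[OF v] F0, of l "s l + unitv i"] valid_add[OF v l] v
        by (simp add: f_def add_cust_def)
      then show ?thesis by (simp add: F_def up_def size_of_add)
    qed
    have f_rem: "f (rem_cust s l i) - f s = - up l (s l - unitv i)"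
      if v: "valid_state Kb s" and l: "0 < s l i" for s l i
    proof -
      have "f (rem_cust s l i) - f s = F l (s l - unitv i) - F l (s l)"
        using sum_fun_upd[where F = F, OF occ_finite[OF v] F0, of l "s l - unitv i"] valid_rem[OF v, of l i] v
        by (simp add: f_def rem_cust_def)
      then show ?thesis using size_of_diff[of "s l" i, OF l] by (simp add: F_def up_def)
    qed
    let ?T = "{s. \<exists>l\<in>occ s. N < l}"
    have dep: "(\<Sum>i\<in>UNIV. \<Sum>l\<in>{l\<in>occ s. 0 < s l i}. mu i * real (s l i) * (f (rem_cust s l i) - f s))
        \<le> (\<Sum>l\<in>occ s. - m * (if N < l then w (size_of (s l)) - w (size_of (s l) - 1) else 0))"
      if v: "valid_state Kb s" for s
    proof -
      note fin = occ_finite[OF v]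
      define e where "e l = (if N < l then w (size_of (s l)) - w (size_of (s l) - 1) else 0)" for l
      have e: "0 \<le> e l" for l using w(3)[of "size_of (s l) - 1"] by (cases "size_of (s l)") (auto simp: e_def)
      have "(\<Sum>i\<in>UNIV. \<Sum>l\<in>{l\<in>occ s. 0 < s l i}. mu i * real (s l i) * (f (rem_cust s l i) - f s))
        = (\<Sum>i\<in>UNIV. \<Sum>l\<in>occ s. - (mu i * real (s l i) * e l))"
      proof (rule sum.cong[OF refl])
        fix i
        have "(\<Sum>l\<in>{l\<in>occ s. 0 < s l i}. mu i * real (s l i) * (f (rem_cust s l i) - f s)) =
            (\<Sum>l\<in>{l\<in>occ s. 0 < s l i}. - (mu i * real (s l i) * e l))"
        proof (rule sum.cong[OF refl])
          fix l assume "l \<in> {l\<in>occ s. 0 < s l i}"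
          then have l: "0 < s l i" by simp
          have "up l (s l - unitv i) = e l" using size_of_diff[of "s l" i, OF l] by (simp add: up_def e_def)
          then show "mu i * real (s l i) * (f (rem_cust s l i) - f s) = - (mu i * real (s l i) * e l)"
            unfolding f_rem[OF v l] by simp
        qed
        also have "\<dots> = (\<Sum>l\<in>occ s. - (mu i * real (s l i) * e l))"
          using fin by (intro sum.mono_neutral_left) auto
        finally show "(\<Sum>l\<in>{l\<in>occ s. 0 < s l i}. mu i * real (s l i) * (f (rem_cust s l i) - f s)) = (\<Sum>l\<in>occ s. - (mu i * real (s l i) * e l))" .
      qed
      also have "\<dots> = (\<Sum>l\<in>occ s. - ((\<Sum>i\<in>UNIV. mu i * real (s l i)) * e l))"
        by (subst sum.swap) (simp add: sum_negf sum_distrib_right)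
      also have "\<dots> \<le> (\<Sum>l\<in>occ s. - m * e l)"
      proof (rule sum_mono)
        fix l assume "l \<in> occ s"
        then obtain j where j: "s l j \<noteq> 0" by (auto simp: occ_def fun_eq_iff)
        have "m * 1 \<le> mu j * real (s l j)" using m_le[of j] m j by (intro mult_mono) auto
        also have "\<dots> \<le> (\<Sum>i\<in>UNIV. mu i * real (s l i))"
          using mu_pos by (intro member_le_sum) (auto simp: less_imp_le)
        finally have "m * e l \<le> (\<Sum>i\<in>UNIV. mu i * real (s l i)) * e l" using e[of l] by (intro mult_right_mono) auto
        then show "- ((\<Sum>i\<in>UNIV. mu i * real (s l i)) * e l) \<le> - m * e l" by simp
      qed
      finally show ?thesis by (simp only: e_def)
    qed
    have gen_le: "gen r f s \<le> C * r * indicator (- G) s - indicator (?T \<inter> G) s"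
      if v: "valid_state Kb s" for s
    proof (cases "s \<in> G")
      case True
      note fin = occ_finite[OF v]
      have Z: "r / 2 \<le> real (Ztot s)" and N: "card (occ s) + 1 \<le> N" using bspec[OF G True] by auto
      \<comment> \<open>A newly opened server has rank at most \<open>card (occ s) + 1\<close>,
        hence at most \<open>N\<close>, and does not change \<open>f\<close>.\<close>
      have fe: "\<not> N < first_empty s" using first_empty(3)[OF fin] N by simp
      have X0: "a * (r / 2) \<le> real (X0 a s)"
      proof -
        have "a * (r / 2) \<le> a * real (Ztot s)" using Z a_pos by (intro mult_left_mono) auto
        also have "\<dots> \<le> real (X0 a s)" unfolding X0_def by (rule real_nat_ceiling_ge)
        finally show ?thesis .
      qed
      have Xi: "a * (r / 2) \<le> real (Xi Kb a i s)" for i using X0 by (simp add: Xi_def)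
      have "0 < a * (r / 2)" using a_pos r by simp
      then have Xi0: "0 < real (Xi Kb a i s)" for i using Xi[of i] by linarith
      have arr: "(\<Sum>l\<in>insert (first_empty s) (acc Kb i s). arr_rate Kb lam a r s i l * (f (add_cust s l i) - f s))
          \<le> 2 * lam i / a * (\<Sum>l\<in>occ s. up l (s l))" for i
      proof -
        have "(\<Sum>l\<in>insert (first_empty s) (acc Kb i s). arr_rate Kb lam a r s i l * (f (add_cust s l i) - f s))
          = (\<Sum>l\<in>insert (first_empty s) (acc Kb i s). arr_rate Kb lam a r s i l * up l (s l))"
          using f_add[OF v] by (intro sum.cong) auto
        also have "\<dots> = lam i * r / Xi Kb a i s * (\<Sum>l\<in>acc Kb i s. up l (s l))"
          unfolding arr_rate_sum[OF fin] using Xi0[of i] fe by (simp add: up_def)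
        also have "\<dots> \<le> 2 * lam i / a * (\<Sum>l\<in>occ s. up l (s l))"
        proof (rule mult_mono)
          show "lam i * r / Xi Kb a i s \<le> 2 * lam i / a"
            using mult_left_mono[OF Xi[of i], of "2 * lam i"] lam_pos[of i] a_pos Xi0[of i] by (simp add: field_simps)
          show "(\<Sum>l\<in>acc Kb i s. up l (s l)) \<le> (\<Sum>l\<in>occ s. up l (s l))"
            using fin up by (intro sum_mono2 acc_subset) auto
        qed (use lam_pos[of i] a_pos up in \<open>auto intro!: sum_nonneg\<close>)
        finally show ?thesis .
      qed
      have "gen r f s \<le> (\<Sum>i\<in>UNIV. 2 * lam i / a * (\<Sum>l\<in>occ s. up l (s l)))
          + (\<Sum>l\<in>occ s. - m * (if N < l then w (size_of (s l)) - w (size_of (s l) - 1) else 0))"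
        unfolding gen_def by (intro add_mono sum_mono arr dep[OF v])
      also have "\<dots> = (\<Sum>l\<in>occ s. \<beta> * up l (s l) + - m * (if N < l then w (size_of (s l)) - w (size_of (s l) - 1) else 0))"
        unfolding sum.distrib sum_distrib_left[symmetric] sum_distrib_right[symmetric] \<beta>_def by simp
      also have "\<dots> \<le> (\<Sum>l\<in>occ s. - (if N < l then 1 else 0))"
      proof (rule sum_mono)
        fix l assume l: "l \<in> occ s"
        show "\<beta> * up l (s l) + - m * (if N < l then w (size_of (s l)) - w (size_of (s l) - 1) else 0) \<le> - (if N < l then 1 else 0)"
        proof (cases "N < l")
          case True
          have "size_of (s l) \<noteq> 0" using l by (auto simp: occ_def size_of_def fun_eq_iff)
          then obtain n where n: "size_of (s l) = Suc n" using not0_implies_Suc by blast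
          have "s l \<in> Kb" using v by (simp add: valid_state_def)
          then have "size_of (s l) \<le> M" unfolding M_def by (intro member_le_sum) auto
          then have "n < M" using n by simp
          from wd[OF this] show ?thesis using True by (simp add: up_def n algebra_simps)
        qed (simp add: up_def)
      qed
      also have "\<dots> \<le> - indicator ?T s"
      proof (cases "s \<in> ?T")
        case True
        then obtain l where l: "l \<in> occ s" "N < l" by auto
        have "(if N < l then 1 else 0 :: real) \<le> (\<Sum>l\<in>occ s. (if N < l then 1 else 0))"
          using l fin by (intro member_le_sum) auto
        then show ?thesis using True l by (simp add: sum_negf)
      next
        case False
        then show ?thesis by (auto intro!: sum_nonpos)
      qed
      finally show ?thesis using True by (simp add: indicator_def)
    next
      case False
      note fin = occ_finite[OF v]
      \<comment> \<open>Outside \<open>G\<close> an arrival may open a server above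
        \<open>N\<close>, but it raises \<open>f\<close> by at most \<open>D\<close>, while
        departures never raise it.\<close>
      have arr: "(\<Sum>l\<in>insert (first_empty s) (acc Kb i s). arr_rate Kb lam a r s i l * (f (add_cust s l i) - f s)) \<le> lam i * r * D" for i
      proof -
        have "(\<Sum>l\<in>insert (first_empty s) (acc Kb i s). arr_rate Kb lam a r s i l * (f (add_cust s l i) - f s))
            \<le> (\<Sum>l\<in>insert (first_empty s) (acc Kb i s). arr_rate Kb lam a r s i l * D)"
          using f_add[OF v] up r by (intro sum_mono mult_left_mono arr_rate_nonneg) auto
        also have "\<dots> = lam i * r * D" by (simp only: sum_distrib_right[symmetric] arr_rate_total[OF fin])
        finally show ?thesis .
      qed
      have "(\<Sum>l\<in>occ s. - m * (if N < l then w (size_of (s l)) - w (size_of (s l) - 1) else 0)) \<le> 0"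
      proof (rule sum_nonpos)
        fix l
        have "w (size_of (s l) - 1) \<le> w (size_of (s l))" using w(3)[of "size_of (s l) - 1"] by (cases "size_of (s l)") auto
        then show "- m * (if N < l then w (size_of (s l)) - w (size_of (s l) - 1) else 0) \<le> 0" using m by auto
      qed
      then have "gen r f s \<le> (\<Sum>i\<in>UNIV. lam i * r * D) + 0"
        unfolding gen_def using dep[OF v] by (intro add_mono sum_mono arr) linarith
      also have "(\<Sum>i\<in>UNIV. lam i * r * D) = C * r"
        unfolding C_def sum_distrib_right by (simp only: ac_simps)
      finally show ?thesis using False by (simp add: indicator_def)
    qed
    have f_nn: "0 \<le> f s" for s by (auto simp: f_def F_def intro!: sum_nonneg w)
    have f_le: "f s \<le> D * real (Ztot s)" for s
    proof (cases "valid_state Kb s")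
      case True
      have "(\<Sum>l\<in>occ s. F l (s l)) \<le> (\<Sum>l\<in>occ s. D)" using w D by (intro sum_mono) (auto simp: F_def)
      also have "\<dots> \<le> D * real (Ztot s)"
        using card_occ_le_Ztot[OF occ_finite[OF True]] D by (simp add: mult.commute mult_left_mono)
      finally show ?thesis using True by (simp add: f_def)
    qed (use D in \<open>simp add: f_def\<close>)
    have "integrable \<pi> (\<lambda>s. total_rate r s * f s)"
    proof (rule Bochner_Integration.integrable_bound)
      let ?L = "(\<Sum>i\<in>UNIV. lam i * r)" and ?S = "(\<Sum>i\<in>UNIV. mu i)"
      have LS: "0 \<le> ?L" "0 \<le> ?S" using lam_pos mu_pos r by (auto intro!: sum_nonneg simp: less_imp_le)
      show "integrable \<pi> (\<lambda>s. (?L + ?S) * D * (real (Ztot s))\<^sup>2)" using Ztot_sq_integrable[OF st r] by simp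
      have "total_rate r s * f s \<le> (?L + ?S) * D * (real (Ztot s))\<^sup>2" for s
      proof (cases "Ztot s = 0")
        case True
        then show ?thesis using f_le[of s] f_nn[of s] by simp
      next
        case False
        then have z: "1 \<le> real (Ztot s)" by simp
        have "total_rate r s \<le> ?L * 1 + ?S * real (Ztot s)" using total_rate_le[of r s] by simp
        also have "\<dots> \<le> ?L * real (Ztot s) + ?S * real (Ztot s)" using z LS by (intro add_right_mono mult_left_mono) auto
        finally have "total_rate r s \<le> (?L + ?S) * real (Ztot s)" by (simp add: distrib_right)
        then have "total_rate r s * f s \<le> ((?L + ?S) * real (Ztot s)) * (D * real (Ztot s))"
          using f_le[of s] f_nn[of s] LS by (intro mult_mono) auto
        then show ?thesis by (simp add: power2_eq_square ac_simps)
      qed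
      then show "AE s in \<pi>. norm (total_rate r s * f s) \<le> norm ((?L + ?S) * D * (real (Ztot s))\<^sup>2)"
        using f_nn total_rate_nonneg[OF less_imp_le[OF r]] LS D by (intro AE_I2) simp
    qed simp
    note g = stationary_gen[OF st less_imp_le[OF r] f_nn this]
    have ind: "integrable \<pi> (indicator A :: _ \<Rightarrow> real)" for A
      by (intro measure_pmf.integrable_const_bound[of _ 1]) auto
    have "0 = measure_pmf.expectation \<pi> (gen r f)" using g(2) by simp
    also have "\<dots> \<le> measure_pmf.expectation \<pi> (\<lambda>s. C * r * indicator (- G) s - indicator (?T \<inter> G) s)"
    proof (rule integral_mono_AE)
      show "AE s in \<pi>. gen r f s \<le> C * r * indicator (- G) s - indicator (?T \<inter> G) s"
        using stationary_AE_valid[OF st] by eventually_elim (rule gen_le)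
      show "integrable \<pi> (\<lambda>s. C * r * indicator (- G) s - indicator (?T \<inter> G) s)"
        by (intro Bochner_Integration.integrable_diff integrable_mult_right ind)
    qed (use g(1) in simp)
    also have "\<dots> = C * r * measure_pmf.prob \<pi> (- G) - measure_pmf.prob \<pi> (?T \<inter> G)"
      using ind[of "- G"] ind[of "?T \<inter> G"] by simp
    finally have 1: "measure_pmf.prob \<pi> (?T \<inter> G) \<le> C * r * measure_pmf.prob \<pi> (- G)" by simp
    have "measure_pmf.prob \<pi> ?T \<le> measure_pmf.prob \<pi> ((?T \<inter> G) \<union> - G)"
      by (rule measure_pmf.finite_measure_mono) auto
    also have "\<dots> \<le> measure_pmf.prob \<pi> (?T \<inter> G) + measure_pmf.prob \<pi> (- G)"
      by (rule measure_Un_le) auto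
    also have "\<dots> \<le> (1 + C * r) * measure_pmf.prob \<pi> (- G)" using 1 by (simp add: algebra_simps)
    finally show "measure_pmf.prob \<pi> ?T \<le> (1 + C * r) * measure_pmf.prob \<pi> (- G)" .
  qed
qed

end

text \<open>Below, the rank is at least the number of occupied servers; above, it is at most
  \<open>N\<close> unless some server beyond \<open>N\<close> is occupied, which
  \<open>rank_tail\<close> makes unlikely.\<close>

lemma (in packing_eq) rank_deviation:
  obtains A \<kappa> c C D r0 where "0 < \<kappa>" "0 < c" "exp 1 \<le> r0"
    "\<And>r \<pi>. r0 \<le> r \<Longrightarrow> stationary Kb lam mu a r \<pi> \<Longrightarrow>
      measure_pmf.prob \<pi> {s. A * (sqrt r * (ln r)\<^sup>2) + 2 < \<bar>real (Urank s) - qstar Kb lam mu a * r\<bar>}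
      \<le> (2 + D * r) * (C * (exp (- \<kappa> * (ln r)\<^sup>2) + exp (- c * r)))"
proof -
  obtain \<kappa> c C r0 where bad: "0 < \<kappa>" "0 < c" "0 < C" "exp 1 \<le> r0"
    "\<And>r \<pi>. r0 \<le> r \<Longrightarrow> stationary Kb lam mu a r \<pi> \<Longrightarrow>
      measure_pmf.prob \<pi> (- good r) \<le> C * (exp (- \<kappa> * (ln r)\<^sup>2) + exp (- c * r))"
    by (rule bad_bound, rule that)
  obtain A where A: "0 < A" "\<And>r s. exp 1 \<le> r \<Longrightarrow> s \<in> good r \<Longrightarrow>
    \<bar>real (card (occ s)) - (\<Sum>k\<in>K. xst k) * r\<bar> \<le> A * (sqrt r * (ln r)\<^sup>2)"
    by (rule good_occ, rule that)
  obtain D where D: "0 \<le> D"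
    "\<And>r \<pi> G N. 0 < r \<Longrightarrow> stationary Kb lam mu a r \<pi> \<Longrightarrow>
      \<forall>s\<in>G. valid_state Kb s \<and> r / 2 \<le> real (Ztot s) \<and> card (occ s) + 1 \<le> N \<Longrightarrow>
      measure_pmf.prob \<pi> {s. \<exists>l\<in>occ s. N < l} \<le> (1 + D * r) * measure_pmf.prob \<pi> (- G)"
    by (rule rank_tail, rule that)
  show thesis
  proof (rule that[OF bad(1,2,4), of A D C])
    fix r \<pi> assume rr: "r0 \<le> r" and st: "stationary Kb lam mu a r \<pi>"
    have re: "exp 1 \<le> r" by (rule order_trans[OF bad(4) rr])
    have r: "0 < r" using re exp_gt_zero[of "1::real"] by linarith
    define q where "q = (\<Sum>k\<in>K. xst k)"
    have q: "0 \<le> q" unfolding q_def using xst_pos by (intro sum_nonneg) (auto simp: less_imp_le)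
    define W where "W = A * (sqrt r * (ln r)\<^sup>2)"
    have W: "0 \<le> W" using A(1) r by (simp add: W_def)
    \<comment> \<open>The added 1 leaves room for the first empty rank, which may be one more than
      the number of occupied servers.\<close>
    define N where "N = nat \<lfloor>q * r + W\<rfloor> + 1"
    have N_le: "real N \<le> q * r + W + 1" using q r W by (simp add: N_def)
    have occ_dev: "\<bar>real (card (occ s)) - q * r\<bar> \<le> W" if "s \<in> good r" for s
      using A(2)[OF re that] by (simp only: q_def W_def)
    have "\<forall>s\<in>good r. valid_state Kb s \<and> r / 2 \<le> real (Ztot s) \<and> card (occ s) + 1 \<le> N"
    proof (intro ballI conjI)
      fix s assume g: "s \<in> good r"
      show "valid_state Kb s" using g by (simp add: good_def)
      show "r / 2 \<le> real (Ztot s)" by (rule good_Ztot[OF re g])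
      have "real (card (occ s)) \<le> q * r + W" using occ_dev[OF g] by linarith
      then have "int (card (occ s)) \<le> \<lfloor>q * r + W\<rfloor>" by (simp add: le_floor_iff)
      then show "card (occ s) + 1 \<le> N" by (simp add: N_def nat_le_iff le_nat_iff)
    qed
    note tail = D(2)[OF r st this]
    let ?T = "{s. \<exists>l\<in>occ s. N < l}"
    have sub: "{s. W + 2 < \<bar>real (Urank s) - q * r\<bar>} \<subseteq> ?T \<union> - good r"
    proof (rule ccontr)
      assume "\<not> {s. W + 2 < \<bar>real (Urank s) - q * r\<bar>} \<subseteq> ?T \<union> - good r"
      then obtain s where dev: "W + 2 < \<bar>real (Urank s) - q * r\<bar>" and sT: "s \<notin> ?T" and g: "s \<in> good r" by auto
      have v: "valid_state Kb s" using g by (simp add: good_def)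
      note fin = occ_finite[OF v]
      have "card (occ s) \<le> Urank s"
      proof (cases "occ s = {}")
        case False
        have "occ s \<subseteq> {1..Max (occ s)}"
        proof
          fix l assume l: "l \<in> occ s"
          then have "l \<noteq> 0" using v by (auto simp: occ_def valid_state_def)
          then show "l \<in> {1..Max (occ s)}" using l fin by simp
        qed
        then have "card (occ s) \<le> card {1..Max (occ s)}" by (rule card_mono[rotated]) simp
        then show ?thesis using False by (simp add: Urank_def)
      qed simp
      moreover have "Urank s \<le> N"
        using sT fin by (auto simp: Urank_def not_less)
      then have "real (Urank s) \<le> real N" by simp
      ultimately show False using dev occ_dev[OF g] N_le by linarith
    qed
    have "measure_pmf.prob \<pi> {s. W + 2 < \<bar>real (Urank s) - q * r\<bar>} \<le> measure_pmf.prob \<pi> (?T \<union> - good r)"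
      using sub by (intro measure_pmf.finite_measure_mono) auto
    also have "\<dots> \<le> measure_pmf.prob \<pi> ?T + measure_pmf.prob \<pi> (- good r)"
      by (rule measure_Un_le) auto
    also have "\<dots> \<le> (2 + D * r) * measure_pmf.prob \<pi> (- good r)"
      using tail by (simp add: algebra_simps)
    also have "\<dots> \<le> (2 + D * r) * (C * (exp (- \<kappa> * (ln r)\<^sup>2) + exp (- c * r)))"
      using bad(5)[OF rr st] D(1) r by (intro mult_left_mono) auto
    finally show "measure_pmf.prob \<pi> {s. A * (sqrt r * (ln r)\<^sup>2) + 2 < \<bar>real (Urank s) - qstar Kb lam mu a * r\<bar>}
      \<le> (2 + D * r) * (C * (exp (- \<kappa> * (ln r)\<^sup>2) + exp (- c * r)))"
      by (simp only: W_def q_def qstar_eq)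
  qed
qed

theorem theorem3p1:
  fixes Kb :: "('i::finite \<Rightarrow> nat) set"
    and lam mu :: "'i \<Rightarrow> real"
    and a :: real
    and r :: "nat \<Rightarrow> real"
    and \<pi> :: "nat \<Rightarrow> (nat \<Rightarrow> 'i \<Rightarrow> nat) pmf"
  assumes Kb: "config_set_ok Kb"
    and lam_pos: "\<forall>i. 0 < lam i"
    and mu_pos: "\<forall>i. 0 < mu i"
    and load: "(\<Sum>i\<in>UNIV. lam i / mu i) = 1"
    and a_pos: "0 < a"
    and r_pos: "\<forall>n. 0 < r n"
    and r_lim: "filterlim r at_top sequentially"
    and stat: "\<forall>n. stationary Kb lam mu a (r n) (\<pi> n)"
  shows "\<forall>\<epsilon>>0. weak_conv_m
           (\<lambda>n. distr (measure_pmf (\<pi> n)) borel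
                  (\<lambda>s. \<bar>real (Urank s) - qstar Kb lam mu a * r n\<bar> / r n powr (1/2 + \<epsilon>)))
           (return borel 0)"
proof (intro allI impI)
  fix \<epsilon> :: real assume \<epsilon>: "0 < \<epsilon>"
  interpret packing Kb lam mu a
    using Kb lam_pos mu_pos load a_pos by unfold_locales auto
  obtain \<nu> where "\<forall>i. (\<Sum>k\<in>K. real (k i) * (a / ccoef k * exp (\<Sum>j\<in>UNIV. real (k j) * \<nu> j))) = rho i"
    using multipliers_exist by blast
  then interpret packing_eq Kb lam mu a \<nu>
    by unfold_locales blast
  obtain A \<kappa> c C D r0 where dev: "0 < \<kappa>" "0 < c" "exp 1 \<le> r0"
    "\<And>r \<pi>. r0 \<le> r \<Longrightarrow> stationary Kb lam mu a r \<pi> \<Longrightarrow>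
      measure_pmf.prob \<pi> {s. A * (sqrt r * (ln r)\<^sup>2) + 2 < \<bar>real (Urank s) - qstar Kb lam mu a * r\<bar>}
      \<le> (2 + D * r) * (C * (exp (- \<kappa> * (ln r)\<^sup>2) + exp (- c * r)))"
    by (rule rank_deviation, rule that)
  define Y where "Y n s = \<bar>real (Urank s) - qstar Kb lam mu a * r n\<bar> / r n powr (1/2 + \<epsilon>)" for n and s :: "nat \<Rightarrow> 'i \<Rightarrow> nat"
  have "weak_conv_m (\<lambda>n. distr (measure_pmf (\<pi> n)) borel (Y n)) (return borel 0)"
  proof (rule weak_conv_to_zero)
    show "0 \<le> Y n s" for n s by (simp add: Y_def)
    fix \<delta> :: real assume \<delta>: "0 < \<delta>"
    define b where "b n = (2 + D * r n) * (C * (exp (- \<kappa> * (ln (r n))\<^sup>2) + exp (- c * r n)))" for n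
    have b: "b \<longlonglongrightarrow> 0"
      unfolding b_def by (rule filterlim_compose[OF rate_bound_tendsto[OF dev(1,2)] r_lim])
    have "(\<lambda>n. (A * (sqrt (r n) * (ln (r n))\<^sup>2) + 2) / r n powr (1/2 + \<epsilon>)) \<longlonglongrightarrow> 0"
      by (rule filterlim_compose[OF fluctuation_tendsto[OF \<epsilon>] r_lim])
    then have ev: "eventually (\<lambda>n. (A * (sqrt (r n) * (ln (r n))\<^sup>2) + 2) / r n powr (1/2 + \<epsilon>) < \<delta>) sequentially"
      using \<delta> by (rule order_tendstoD)
    have er: "eventually (\<lambda>n. r0 \<le> r n) sequentially"
      using r_lim by (simp add: filterlim_at_top)
    have "eventually (\<lambda>n. measure_pmf.prob (\<pi> n) {s. \<delta> < Y n s} \<le> b n) sequentially"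
      using ev er
    proof eventually_elim
      case (elim n)
      have p: "0 < r n powr (1/2 + \<epsilon>)" using r_pos by (simp add: less_imp_neq[symmetric])
      have "A * (sqrt (r n) * (ln (r n))\<^sup>2) + 2 < \<bar>real (Urank s) - qstar Kb lam mu a * r n\<bar>" if "\<delta> < Y n s" for s
      proof -
        have "(A * (sqrt (r n) * (ln (r n))\<^sup>2) + 2) / r n powr (1/2 + \<epsilon>) < Y n s" using elim(1) that by linarith
        then show ?thesis unfolding Y_def using p by (simp add: divide_less_cancel)
      qed
      then have "measure_pmf.prob (\<pi> n) {s. \<delta> < Y n s}
          \<le> measure_pmf.prob (\<pi> n) {s. A * (sqrt (r n) * (ln (r n))\<^sup>2) + 2 < \<bar>real (Urank s) - qstar Kb lam mu a * r n\<bar>}"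
        by (intro measure_pmf.finite_measure_mono) auto
      also have "\<dots> \<le> b n" unfolding b_def using stat by (intro dev(4) elim(2)) auto
      finally show ?case .
    qed
    then show "(\<lambda>n. measure_pmf.prob (\<pi> n) {s. \<delta> < Y n s}) \<longlonglongrightarrow> 0"
      by (intro tendsto_sandwich[OF _ _ tendsto_const b]) auto
  qed
  then show "weak_conv_m (\<lambda>n. distr (measure_pmf (\<pi> n)) borel
      (\<lambda>s. \<bar>real (Urank s) - qstar Kb lam mu a * r n\<bar> / r n powr (1/2 + \<epsilon>))) (return borel 0)"
    unfolding Y_def .
qed

end
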